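(* Let $\mathcal{A}$ and $\mathcal{B}$ be two unital locally $C^{\ast}$-algebras and $\varphi:\mathcal{A}\rightarrow\mathcal{B}$ be a linear map. If for some $n\geq 2$ the map $\varphi\otimes\mathrm{id}_{M_{n}(\mathbb{C})}:\mathcal{A}\otimes M_{n}(\mathbb{C})\rightarrow\mathcal{B}\otimes M_{n}(\mathbb{C})$ is local decomposable, then $\varphi$ is local completely positive.
   Context: A locally $C^{\ast}$-algebra is a complete Hausdorff complex topological $\ast$-algebra $\mathcal{A}$ whose topology is determined by an upward filtered family $\{p_{\lambda}\}_{\lambda\in\Lambda}$ of $C^{\ast}$-seminorms. For $a\in\mathcal{A}$ write $a\geq_{\lambda}0$ if $a=b^{\ast}b+c$ with $b,c\in\mathcal{A}$, $p_{\lambda}(c)=0$ (equivalently, the image of $a$ in the $C^{\ast}$-algebra $\mathcal{A}_\lambda=\mathcal{A}/\ker p_{\lambda}$ is positive), and $a=_{\lambda}0$ if $p_{\lambda}(a)=0$. The matrix algebra $M_{k}(\mathcal{A})\cong\mathcal{A}\otimes M_{k}(\mathbb{C})$ is a locally $C^{\ast}$-algebra with seminorms $\{p_{\lambda}^{k}\}_{\lambda\in\Lambda}$, where $p_{\lambda}^{k}$ is induced by the $C^{\ast}$-norm of $M_{k}(\mathcal{A}_{\lambda})$; $\geq_{\lambda}0$ and $=_{\lambda}0$ in $M_{k}(\mathcal{A})$ refer to $p_{\lambda}^{k}$. Let $\mathcal{A},\mathcal{B}$ have defining families $\{p_{\lambda}\}_{\lambda\in\Lambda}$, $\{q_{\delta}\}_{\delta\in\Delta}$,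 and let $\varphi:\mathcal{A}\to\mathcal{B}$ be linear. - $\varphi$ is local completely positive if for each $\delta\in\Delta$ there is $\lambda\in\Lambda$ such that, for all $k\in\mathbb{N}$, $[\varphi(a_{ij})]_{i,j=1}^{k}\geq_{\delta}0$ whenever $[a_{ij}]_{i,j=1}^{k}\geq_{\lambda}0$, and $[\varphi(a_{ij})]_{i,j=1}^{k}=_{\delta}0$ whenever $[a_{ij}]_{i,j=1}^{k}=_{\lambda}0$. - $\varphi$ is local completely copositive if for each $\delta\in\Delta$ there is $\lambda\in\Lambda$ such that, for all $k\in\mathbb{N}$, $[\varphi(a_{ji})]_{i,j=1}^{k}\geq_{\delta}0$ whenever $[a_{ij}]_{i,j=1}^{k}\geq_{\lambda}0$, and $[\varphi(a_{ji})]_{i,j=1}^{k}=_{\delta}0$ whenever $[a_{ij}]_{i,j=1}^{k}=_{\lambda}0$. - $\varphi$ is local decomposable if it is the sum of a local completely positive map and a local completely copositive map. The map $\varphi\otimes\mathrm{id}_{M_{n}(\mathbb{C})}$ is $[a_{ij}]\mapsto[\varphi(a_{ij})]$. *)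

theory Defs
  imports "HOL-Analysis.Analysis" "HOL-Algebra.Module"
begin

definition complex_ring :: "complex ring" where
  "complex_ring = \<lparr>carrier = UNIV, mult = (*), one = 1, zero = 0, add = (+)\<rparr>"

record 'a star_algebra = "(complex, 'a) module" +
  star :: "'a \<Rightarrow> 'a"

locale unital_star_algebra = ring A + module complex_ring A
  for A :: "'a star_algebra" (structure) +
  assumes smult_mult_left: "\<lbrakk>x \<in> carrier A; y \<in> carrier A\<rbrakk> \<Longrightarrow> (c \<odot> x) \<otimes> y = c \<odot> (x \<otimes> y)"
    and smult_mult_right: "\<lbrakk>x \<in> carrier A; y \<in> carrier A\<rbrakk> \<Longrightarrow> x \<otimes> (c \<odot> y) = c \<odot> (x \<otimes> y)"
    and star_closed: "x \<in> carrier A \<Longrightarrow> star A x \<in> carrier A"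
    and star_star: "x \<in> carrier A \<Longrightarrow> star A (star A x) = x"
    and star_add: "\<lbrakk>x \<in> carrier A; y \<in> carrier A\<rbrakk> \<Longrightarrow> star A (x \<oplus> y) = star A x \<oplus> star A y"
    and star_smult: "x \<in> carrier A \<Longrightarrow> star A (c \<odot> x) = cnj c \<odot> star A x"
    and star_mult: "\<lbrakk>x \<in> carrier A; y \<in> carrier A\<rbrakk> \<Longrightarrow> star A (x \<otimes> y) = star A y \<otimes> star A x"

text \<open>Nonnegativity and invariance under the involution follow from these axioms.\<close>

definition cstar_seminorm :: "'a star_algebra \<Rightarrow> ('a \<Rightarrow> real) \<Rightarrow> bool" where
  "cstar_seminorm A p \<longleftrightarrow>
     (\<forall>x\<in>carrier A. \<forall>y\<in>carrier A. p (x \<oplus>\<^bsub>A\<^esub> y) \<le> p x + p y) \<and>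
     (\<forall>c. \<forall>x\<in>carrier A. p (c \<odot>\<^bsub>A\<^esub> x) = cmod c * p x) \<and>
     (\<forall>x\<in>carrier A. \<forall>y\<in>carrier A. p (x \<otimes>\<^bsub>A\<^esub> y) \<le> p x * p y) \<and>
     (\<forall>x\<in>carrier A. p (star A x \<otimes>\<^bsub>A\<^esub> x) = (p x)\<^sup>2)"

definition seminorm_topology :: "'a star_algebra \<Rightarrow> 'l set \<Rightarrow> ('l \<Rightarrow> 'a \<Rightarrow> real) \<Rightarrow> 'a topology" where
  "seminorm_topology A \<Lambda> p =
     topology_generated_by
       {{y \<in> carrier A. p l (y \<ominus>\<^bsub>A\<^esub> x) < e} | x l e. x \<in> carrier A \<and> l \<in> \<Lambda> \<and> 0 < e}"

text \<open>
  The topology is the one determined by the family \<open>p\<close>; the algebra operations and the involution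
  are automatically continuous for it. Completeness is convergence of all Cauchy filters.
\<close>

locale locally_cstar_algebra = unital_star_algebra A
  for A :: "'a star_algebra" (structure) +
  fixes \<Lambda> :: "'l set" and p :: "'l \<Rightarrow> 'a \<Rightarrow> real"
  assumes index_nonempty: "\<Lambda> \<noteq> {}"
    and seminorms: "l \<in> \<Lambda> \<Longrightarrow> cstar_seminorm A (p l)"
    and upward_filtered:
      "\<lbrakk>l \<in> \<Lambda>; m \<in> \<Lambda>\<rbrakk> \<Longrightarrow> \<exists>r\<in>\<Lambda>. \<forall>x\<in>carrier A. p l x \<le> p r x \<and> p m x \<le> p r x"
    and hausdorff: "Hausdorff_space (seminorm_topology A \<Lambda> p)"
    and complete:
      "\<lbrakk>F \<noteq> bot; eventually (\<lambda>x. x \<in> carrier A) F;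
        \<And>l e. l \<in> \<Lambda> \<Longrightarrow> 0 < e \<Longrightarrow> eventually (\<lambda>(x, y). p l (x \<ominus> y) < e) (F \<times>\<^sub>F F)\<rbrakk>
       \<Longrightarrow> \<exists>a. limitin (seminorm_topology A \<Lambda> p) (\<lambda>x. x) a F"

text \<open>
  A \<open>k \<times> k\<close> matrix is a function of an index pair, with indices \<open>0, \<dots>, k - 1\<close>, which is
  extensional, so that equality of matrices is equality of functions.
\<close>

abbreviation idx :: "nat \<Rightarrow> (nat \<times> nat) set" where
  "idx k \<equiv> {..<k} \<times> {..<k}"

definition mat_algebra :: "nat \<Rightarrow> 'a star_algebra \<Rightarrow> (nat \<times> nat \<Rightarrow> 'a) star_algebra" where
  "mat_algebra k A =
     \<lparr>carrier = idx k \<rightarrow>\<^sub>E carrier A,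
      mult = (\<lambda>M N. \<lambda>(i, j)\<in>idx k. \<Oplus>\<^bsub>A\<^esub>r\<in>{..<k}. M (i, r) \<otimes>\<^bsub>A\<^esub> N (r, j)),
      one = (\<lambda>(i, j)\<in>idx k. if i = j then \<one>\<^bsub>A\<^esub> else \<zero>\<^bsub>A\<^esub>),
      zero = (\<lambda>(i, j)\<in>idx k. \<zero>\<^bsub>A\<^esub>),
      add = (\<lambda>M N. \<lambda>(i, j)\<in>idx k. M (i, j) \<oplus>\<^bsub>A\<^esub> N (i, j)),
      smult = (\<lambda>c M. \<lambda>(i, j)\<in>idx k. c \<odot>\<^bsub>A\<^esub> M (i, j)),
      star = (\<lambda>M. \<lambda>(i, j)\<in>idx k. star A (M (j, i)))\<rparr>"

text \<open>
  The \<open>C\<^sup>*\<close>-norm of \<open>M\<^sub>k(D)\<close>, for a \<open>C\<^sup>*\<close>-algebra \<open>D\<close>, is the operator norm of matrices acting on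
  the Hilbert \<open>D\<close>-module \<open>D\<^sup>k\<close>, whose inner product is \<open>\<langle>x, y\<rangle> = \<Sum>\<^sub>i x\<^sub>i\<^sup>* y\<^sub>i\<close> and whose norm is
  \<open>\<parallel>x\<parallel> = \<parallel>\<langle>x, x\<rangle>\<parallel>\<^sup>1\<^sup>/\<^sup>2\<close>. For \<open>D = A / ker p\<close>, where \<open>\<parallel>a + ker p\<parallel> = p a\<close>, that norm pulls back along
  \<open>M\<^sub>k(A) \<rightarrow> M\<^sub>k(A / ker p)\<close> to \<open>mat_seminorm k A p\<close>. The supremum below is finite, being
  the operator norm of an adjointable operator.
\<close>

definition col_norm :: "nat \<Rightarrow> 'a star_algebra \<Rightarrow> ('a \<Rightarrow> real) \<Rightarrow> (nat \<Rightarrow> 'a) \<Rightarrow> real" where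
  "col_norm k A p x = sqrt (p (\<Oplus>\<^bsub>A\<^esub>i\<in>{..<k}. star A (x i) \<otimes>\<^bsub>A\<^esub> x i))"

definition mat_apply :: "nat \<Rightarrow> 'a star_algebra \<Rightarrow> (nat \<times> nat \<Rightarrow> 'a) \<Rightarrow> (nat \<Rightarrow> 'a) \<Rightarrow> nat \<Rightarrow> 'a" where
  "mat_apply k A M x = (\<lambda>i\<in>{..<k}. \<Oplus>\<^bsub>A\<^esub>j\<in>{..<k}. M (i, j) \<otimes>\<^bsub>A\<^esub> x j)"

definition mat_seminorm ::
  "nat \<Rightarrow> 'a star_algebra \<Rightarrow> ('a \<Rightarrow> real) \<Rightarrow> (nat \<times> nat \<Rightarrow> 'a) \<Rightarrow> real" where
  "mat_seminorm k A p M =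
     (SUP x \<in> {x \<in> {..<k} \<rightarrow>\<^sub>E carrier A. col_norm k A p x \<le> 1}. col_norm k A p (mat_apply k A M x))"

text \<open>\<open>a \<ge>\<^sub>\<lambda> 0\<close> and \<open>a =\<^sub>\<lambda> 0\<close>, for \<open>p = p\<^sub>\<lambda>\<close>.\<close>

definition local_pos :: "'a star_algebra \<Rightarrow> ('a \<Rightarrow> real) \<Rightarrow> 'a \<Rightarrow> bool" where
  "local_pos A p a \<longleftrightarrow>
     (\<exists>b\<in>carrier A. \<exists>c\<in>carrier A. a = star A b \<otimes>\<^bsub>A\<^esub> b \<oplus>\<^bsub>A\<^esub> c \<and> p c = 0)"

definition local_zero :: "'a star_algebra \<Rightarrow> ('a \<Rightarrow> real) \<Rightarrow> 'a \<Rightarrow> bool" where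
  "local_zero A p a \<longleftrightarrow> a \<in> carrier A \<and> p a = 0"

definition linear_map :: "'a star_algebra \<Rightarrow> 'b star_algebra \<Rightarrow> ('a \<Rightarrow> 'b) \<Rightarrow> bool" where
  "linear_map A B \<phi> \<longleftrightarrow>
     \<phi> \<in> carrier A \<rightarrow> carrier B \<and>
     (\<forall>x\<in>carrier A. \<forall>y\<in>carrier A. \<phi> (x \<oplus>\<^bsub>A\<^esub> y) = \<phi> x \<oplus>\<^bsub>B\<^esub> \<phi> y) \<and>
     (\<forall>c. \<forall>x\<in>carrier A. \<phi> (c \<odot>\<^bsub>A\<^esub> x) = c \<odot>\<^bsub>B\<^esub> \<phi> x)"

text \<open>\<open>mat_map k \<phi>\<close> is \<open>\<phi> \<otimes> id\<close> on \<open>k \<times> k\<close> matrices, \<open>[a\<^sub>i\<^sub>j] \<mapsto> [\<phi>(a\<^sub>i\<^sub>j)]\<close>.\<close>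

definition mat_map :: "nat \<Rightarrow> ('a \<Rightarrow> 'b) \<Rightarrow> (nat \<times> nat \<Rightarrow> 'a) \<Rightarrow> (nat \<times> nat \<Rightarrow> 'b)" where
  "mat_map k \<phi> M = (\<lambda>(i, j)\<in>idx k. \<phi> (M (i, j)))"

definition mat_map_transposed :: "nat \<Rightarrow> ('a \<Rightarrow> 'b) \<Rightarrow> (nat \<times> nat \<Rightarrow> 'a) \<Rightarrow> (nat \<times> nat \<Rightarrow> 'b)" where
  "mat_map_transposed k \<phi> M = (\<lambda>(i, j)\<in>idx k. \<phi> (M (j, i)))"

definition local_completely_positive ::
  "'a star_algebra \<Rightarrow> 'l set \<Rightarrow> ('l \<Rightarrow> 'a \<Rightarrow> real) \<Rightarrow>
   'b star_algebra \<Rightarrow> 'd set \<Rightarrow> ('d \<Rightarrow> 'b \<Rightarrow> real) \<Rightarrow> ('a \<Rightarrow> 'b) \<Rightarrow> bool" where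
  "local_completely_positive A \<Lambda> p B \<Delta> q \<phi> \<longleftrightarrow>
     linear_map A B \<phi> \<and>
     (\<forall>d\<in>\<Delta>. \<exists>l\<in>\<Lambda>. \<forall>k\<ge>1. \<forall>M\<in>carrier (mat_algebra k A).
        (local_pos (mat_algebra k A) (mat_seminorm k A (p l)) M \<longrightarrow>
         local_pos (mat_algebra k B) (mat_seminorm k B (q d)) (mat_map k \<phi> M)) \<and>
        (local_zero (mat_algebra k A) (mat_seminorm k A (p l)) M \<longrightarrow>
         local_zero (mat_algebra k B) (mat_seminorm k B (q d)) (mat_map k \<phi> M)))"

definition local_completely_copositive ::
  "'a star_algebra \<Rightarrow> 'l set \<Rightarrow> ('l \<Rightarrow> 'a \<Rightarrow> real) \<Rightarrow>
   'b star_algebra \<Rightarrow> 'd set \<Rightarrow> ('d \<Rightarrow> 'b \<Rightarrow> real) \<Rightarrow> ('a \<Rightarrow> 'b) \<Rightarrow> bool" where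
  "local_completely_copositive A \<Lambda> p B \<Delta> q \<phi> \<longleftrightarrow>
     linear_map A B \<phi> \<and>
     (\<forall>d\<in>\<Delta>. \<exists>l\<in>\<Lambda>. \<forall>k\<ge>1. \<forall>M\<in>carrier (mat_algebra k A).
        (local_pos (mat_algebra k A) (mat_seminorm k A (p l)) M \<longrightarrow>
         local_pos (mat_algebra k B) (mat_seminorm k B (q d)) (mat_map_transposed k \<phi> M)) \<and>
        (local_zero (mat_algebra k A) (mat_seminorm k A (p l)) M \<longrightarrow>
         local_zero (mat_algebra k B) (mat_seminorm k B (q d)) (mat_map_transposed k \<phi> M)))"

definition local_decomposable ::
  "'a star_algebra \<Rightarrow> 'l set \<Rightarrow> ('l \<Rightarrow> 'a \<Rightarrow> real) \<Rightarrow>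
   'b star_algebra \<Rightarrow> 'd set \<Rightarrow> ('d \<Rightarrow> 'b \<Rightarrow> real) \<Rightarrow> ('a \<Rightarrow> 'b) \<Rightarrow> bool" where
  "local_decomposable A \<Lambda> p B \<Delta> q \<phi> \<longleftrightarrow>
     (\<exists>\<psi> \<theta>. local_completely_positive A \<Lambda> p B \<Delta> q \<psi> \<and>
            local_completely_copositive A \<Lambda> p B \<Delta> q \<theta> \<and>
            (\<forall>x\<in>carrier A. \<phi> x = \<psi> x \<oplus>\<^bsub>B\<^esub> \<theta> x))"

end

(* If phi (x) id = psi + theta with psi completely positive and theta completely copositive, write
   psi_{ij,rs}(a) and theta_{ij,rs}(a) for the (r,s) entry of the image of the matrix with single
   entry a at (i,j).  For a = b* b, applying both maps to the positive matrix with (i,j) entry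
   a (x) e_{ij} exhibits psi_{ij,rs}(a) = <V_ir, V_js> and theta_{ji,rs}(a) = <U_ir, U_js> modulo the
   kernel of the seminorm.  The (0,0;1,1) entry of phi (x) id vanishes, hence V_01 = U_01 = 0; then
   phi(a) = <V_00, V_11> = <V_11, V_00>, and so
   |V_00 - V_11|^2 + |U_00|^2 + |U_11|^2 = 0.  Thus theta_{00,00} vanishes on all squares, hence
   everywhere by polarization, and phi = psi_{00,00} is completely positive.

   The compression psi_{00,00} of a positive matrix is a sum of terms c* c, so a square root in
   M_k(B) is needed.  It is found modulo the seminorms, as are the order properties of C*-seminorms,
   in the free algebra over the elements of the algebra: evaluation pulls the seminorms back to it,
   and it is a ring in the sense of the type class. *)

theory Submission
  imports Defs "HOL-Library.Poly_Mapping"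
begin

section \<open>C*-seminorms on a ring\<close>

text \<open>Local positivity asks for one exact square modulo the kernel of a seminorm, whereas the
  compression yields several squares; approximate roots do not suffice and a limit has to exist.
  Completeness concerns all seminorms jointly, so one sequence must be Cauchy for each of them,
  although the element whose root is sought may be unbounded over the family. For a single seminorm
  no limits are available, hence neither spectrum nor functional calculus. The order theory of one
  seminorm therefore rests on the norm test \<open>N (R c - h) \<le> c\<close> for positivity and on
  square roots up to an arbitrarily small error, which commute with everything that commutes with
  the given element. Matrix seminorms enter the final argument only through their null matrices, and
  these are described entry by entry; this keeps matrices over matrices manageable. The hypothesis n
  \<ge> 2 supplies the indices 0 and 1, and the computation with the vectors stays in that
  corner.\<close>

locale cstar_seminormed_ring =
  fixes C :: "complex \<Rightarrow> 'x::ring_1" and st :: "'x \<Rightarrow> 'x" and N :: "'x \<Rightarrow> real"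
  assumes C_add: "C (c + d) = C c + C d" and C_mult: "C (c * d) = C c * C d"
    and C_1 [simp]: "C 1 = 1" and C_commute: "x * C c = C c * x"
    and st_add: "st (x + y) = st x + st y" and st_mult: "st (x * y) = st y * st x"
    and st_st [simp]: "st (st x) = x" and st_C [simp]: "st (C c) = C (cnj c)"
    and N_add: "N (x + y) \<le> N x + N y" and N_C_mult: "N (C c * x) = cmod c * N x"
    and N_mult: "N (x * y) \<le> N x * N y" and N_star: "N (st x * x) = (N x)\<^sup>2"
begin

lemma C_0 [simp]: "C 0 = 0"
  using C_add[of 0 0] by simp

lemma C_minus: "C (- c) = - C c"
  using C_add[of c "- c"] by (simp add: eq_neg_iff_add_eq_0 add.commute)

lemma C_diff: "C (c - d) = C c - C d"
  using C_add[of c "- d"] by (simp add: C_minus)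

lemma C_left_commute: "x * (C c * y) = C c * (x * y)"
  by (metis C_commute mult.assoc)

lemma C_C_mult: "C c * (C d * x) = C (c * d) * x"
  by (simp add: C_mult mult.assoc)

lemma C_numeral: "C (numeral k) = numeral k"
proof -
  have "C (of_nat m) = of_nat m" for m
    by (induction m) (auto simp: C_add)
  from this[of "numeral k"] show ?thesis by simp
qed

lemma st_0 [simp]: "st 0 = 0"
  using st_add[of 0 0] by simp

lemma st_minus: "st (- x) = - st x"
  using st_add[of x "- x"] by (simp add: eq_neg_iff_add_eq_0 add.commute)

lemma st_diff: "st (x - y) = st x - st y"
  using st_add[of x "- y"] by (simp add: st_minus)

lemma st_1 [simp]: "st 1 = 1"
  using st_C[of 1] by simp

lemma st_sum: "st (sum f I) = (\<Sum>i\<in>I. st (f i))"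
  by (induction I rule: infinite_finite_induct) (auto simp: st_add)

lemma N_0 [simp]: "N 0 = 0"
  using N_C_mult[of 0 0] by simp

lemma N_minus [simp]: "N (- x) = N x"
  using N_C_mult[of "-1" x] by (simp add: C_minus)

lemma N_nonneg [simp]: "0 \<le> N x"
  using N_add[of x "- x"] by simp

lemma N_diff: "N (x - y) \<le> N x + N y"
  using N_add[of x "- y"] by simp

lemma N_diff_commute: "N (x - y) = N (y - x)"
  using N_minus[of "x - y"] by simp

lemma N_triangle: "N (x - z) \<le> N (x - y) + N (y - z)"
  using N_add[of "x - y" "y - z"] by simp

lemma N_sum: "N (sum f I) \<le> (\<Sum>i\<in>I. N (f i))"
proof (induction I rule: infinite_finite_induct)
  case (insert i I)
  then show ?case using N_add[of "f i" "sum f I"] by simp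
qed auto

lemma N_st [simp]: "N (st x) = N x"
proof -
  have *: "N x \<le> N (st x)" for x
  proof (cases "N x = 0")
    case False
    have "(N x)\<^sup>2 \<le> N (st x) * N x"
      using N_star[of x] N_mult[of "st x" x] by simp
    then show ?thesis using False N_nonneg[of x]
      by (simp add: power2_eq_square)
  qed simp
  from *[of x] *[of "st x"] show ?thesis by simp
qed

lemma N_star': "N (x * st x) = (N x)\<^sup>2"
  using N_star[of "st x"] by simp

lemma N_1: "N 1 \<le> 1"
proof -
  have "N 1 = (N 1)\<^sup>2" using N_star[of 1] by simp
  then have "N 1 = 0 \<or> N 1 = 1" by (auto simp: power2_eq_square)
  then show ?thesis by auto
qed

lemma N_C: "N (C c) \<le> cmod c"
  using N_C_mult[of c 1] mult_left_mono[OF N_1, of "cmod c"] by simp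

lemma N_null_add: "N y = 0 \<Longrightarrow> N (x + y) = N x"
  using N_add[of x y] N_diff[of "x + y" y] by simp

lemma N_null_mult_right: "N x = 0 \<Longrightarrow> N (x * y) = 0"
  using N_mult[of x y] N_nonneg[of "x * y"] by simp

lemma N_null_mult_left: "N y = 0 \<Longrightarrow> N (x * y) = 0"
  using N_mult[of x y] N_nonneg[of "x * y"] by simp

lemma N_sq: "st x = x \<Longrightarrow> N (x * x) = (N x)\<^sup>2"
  using N_star[of x] by simp

definition R :: "real \<Rightarrow> 'x" where "R c = C (complex_of_real c)"

lemma R_0 [simp]: "R 0 = 0" and R_1 [simp]: "R 1 = 1" and st_R [simp]: "st (R c) = R c"
  by (simp_all add: R_def)

lemma R_add: "R (c + d) = R c + R d"
  by (simp add: R_def C_add)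

lemma R_diff: "R (c - d) = R c - R d"
  by (simp add: R_def C_diff)

lemma R_mult: "R (c * d) = R c * R d"
  by (simp add: R_def C_mult)

lemma R_commute: "x * R c = R c * x"
  by (simp add: R_def C_commute)

lemma R_left_commute: "x * (R c * y) = R c * (x * y)"
  by (simp add: R_def C_left_commute)

lemma R_R_mult: "R c * (R d * x) = R (c * d) * x"
  by (simp add: R_mult mult.assoc)

lemma R_mult_R_mult: "(R c * x) * (R d * y) = R (c * d) * (x * y)"
  by (metis R_R_mult R_left_commute mult.assoc)

lemma N_R: "N (R c) \<le> \<bar>c\<bar>"
  using N_C[of "complex_of_real c"] by (simp add: R_def)

lemma N_R_nonneg: "0 \<le> c \<Longrightarrow> N (R c) \<le> c"
  using N_R[of c] by simp

lemma N_R_mult: "N (R c * x) = \<bar>c\<bar> * N x"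
  by (simp add: R_def N_C_mult)

text \<open>The element \<open>u = g + C \<i> * k\<close> is normal and
  \<open>st u * u = g * g + k * k\<close>, so the right side is \<open>(N u)\<^sup>2\<close>, and
  \<open>k\<close> is the imaginary part of \<open>u\<close>. This replaces the spectral fact that a
  sum of commuting squares dominates each of them.\<close>

lemma N_le_commuting:
  assumes g: "st g = g" and k: "st k = k" and gk: "g * k = k * g"
  shows "(N k)\<^sup>2 \<le> N (g * g + k * k)"
proof -
  define u where "u = g + C \<i> * k"
  have su: "st u = g - C \<i> * k"
    by (simp add: u_def st_add st_mult g k C_commute C_minus)
  have "C \<i> * (C \<i> * (k * k)) = - (k * k)"
    by (simp add: C_C_mult C_minus)
  then have "C \<i> * k * (C \<i> * k) = - (k * k)" by (metis C_left_commute mult.assoc)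
  moreover have "g * (C \<i> * k) = C \<i> * k * g"
    by (simp add: C_left_commute gk mult.assoc)
  ultimately have "st u * u = g * g + k * k"
    by (simp only: su) (simp add: u_def distrib_left left_diff_distrib)
  then have 1: "(N u)\<^sup>2 = N (g * g + k * k)" by (metis N_star)
  have "C (2 * \<i>) * k = u - st u"
    by (simp only: su) (simp add: u_def algebra_simps C_mult C_numeral mult_2)
  then have "2 * N k = N (u - st u)"
    by (metis N_C_mult norm_mult norm_ii norm_numeral mult.right_neutral)
  also have "\<dots> \<le> 2 * N u" using N_diff[of u "st u"] by simp
  finally have "N k \<le> N u" by simp
  then show ?thesis using 1 by (metis N_nonneg power_mono)
qed

end

text \<open>Visser's iteration \<open>q \<mapsto> (u + q\<^sup>2)/2\<close> for \<open>1 - (1 - u)\<^sup>1\<^sup>/\<^sup>2\<close>; \<open>visser_bound\<close> is the scalar case \<open>u = 1\<close>, which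
  dominates it because all coefficients are nonnegative.\<close>

primrec visser_bound :: "nat \<Rightarrow> real" where
  "visser_bound 0 = 0"
| "visser_bound (Suc n) = (1 + (visser_bound n)\<^sup>2) / 2"

lemma visser_bound_range: "0 \<le> visser_bound n \<and> visser_bound n \<le> 1"
proof (induction n)
  case (Suc n)
  then have "(visser_bound n)\<^sup>2 \<le> 1" by (simp add: power_le_one)
  then show ?case by simp
qed simp

lemma visser_bound_Suc: "visser_bound n \<le> visser_bound (Suc n)"
proof -
  have "0 \<le> (1 - visser_bound n)\<^sup>2" by simp
  then show ?thesis by (simp add: power2_eq_square algebra_simps)
qed

lemma convergent_visser_bound: "convergent visser_bound"
  using visser_bound_Suc visser_bound_range
  by (intro Bseq_mono_convergent BseqI'[where K = 1]) (auto simp: lift_Suc_mono_le)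

lemma visser_bound_step: "(\<lambda>n. visser_bound (Suc n) - visser_bound n) \<longlonglongrightarrow> 0"
proof -
  obtain l where "visser_bound \<longlonglongrightarrow> l"
    using convergent_visser_bound convergent_def by blast
  from tendsto_diff[OF LIMSEQ_Suc[OF this] this] show ?thesis by simp
qed

section \<open>Approximate square roots without completeness\<close>

context cstar_seminormed_ring
begin

primrec visser :: "'x \<Rightarrow> nat \<Rightarrow> 'x" where
  "visser u 0 = 0"
| "visser u (Suc n) = R (1/2) * (u + visser u n * visser u n)"

lemma R_half: "R (1/2) * (x + x) = x" 
proof -
  have "R (1/2) * (x + x) = (R (1/2) + R (1/2)) * x"
    by (simp add: algebra_simps)
  also have "\<dots> = x" by (simp only: R_add[symmetric]) simp
  finally show ?thesis .
qed

lemma st_visser: "st u = u \<Longrightarrow> st (visser u n) = visser u n"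
  by (induction n) (auto simp: st_add st_mult R_commute)

lemma visser_commute: "z * u = u * z \<Longrightarrow> z * visser u n = visser u n * z"
proof (induction n)
  case (Suc n)
  then have IH: "z * visser u n = visser u n * z" by simp
  have "z * (visser u n * visser u n) = visser u n * visser u n * z"
    by (metis IH mult.assoc)
  then show ?case using Suc.prems by (simp add: R_left_commute algebra_simps)
qed simp

lemma N_visser: "N u \<le> 1 \<Longrightarrow> N (visser u n) \<le> visser_bound n"
proof (induction n)
  case (Suc n)
  have "N (visser u n * visser u n) \<le> N (visser u n) * N (visser u n)" by (rule N_mult)
  also have "\<dots> \<le> (visser_bound n)\<^sup>2"
    using Suc unfolding power2_eq_square by (intro mult_mono) (auto simp: visser_bound_range)
  finally show ?case
    using N_add[of u "visser u n * visser u n"] Suc.prems by (simp add: N_R_mult)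
qed simp

lemma N_visser_le_1: "N u \<le> 1 \<Longrightarrow> N (visser u n) \<le> 1"
  using N_visser[of u n] visser_bound_range[of n] by simp

text \<open>Consecutive steps differ by half a difference of squares, which factors because the
  iterates commute; the scalar sequence satisfies the same recursion with equality.\<close>

lemma N_visser_step:
  assumes "N u \<le> 1"
  shows "N (visser u (Suc n) - visser u n) \<le> visser_bound (Suc n) - visser_bound n"
proof (induction n)
  case 0
  then show ?case using assms by (simp add: N_R_mult)
next
  case (Suc n)
  let ?a = "visser u (Suc n)" and ?b = "visser u n"
  let ?A = "visser_bound (Suc n)" and ?B = "visser_bound n"
  have "?b * u = u * ?b" by (metis visser_commute)
  then have c: "?b * ?a = ?a * ?b" by (rule visser_commute)
  have "visser u (Suc (Suc n)) - ?a = R (1/2) * ((?a + ?b) * (?a - ?b))"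
  proof -
    have "visser u (Suc (Suc n)) - ?a = R (1/2) * (u + ?a * ?a) - R (1/2) * (u + ?b * ?b)" by simp
    also have "\<dots> = R (1/2) * (?a * ?a - ?b * ?b)" by (simp add: algebra_simps del: visser.simps)
    also have "?a * ?a - ?b * ?b = (?a + ?b) * (?a - ?b)"
      using c by (simp add: algebra_simps del: visser.simps)
    finally show ?thesis .
  qed
  moreover have "N ((?a + ?b) * (?a - ?b)) \<le> (?A + ?B) * (?A - ?B)"
  proof -
    have "N ((?a + ?b) * (?a - ?b)) \<le> N (?a + ?b) * N (?a - ?b)" by (rule N_mult)
    also have "\<dots> \<le> (?A + ?B) * (?A - ?B)"
      using N_add[of ?a ?b] N_visser[OF assms, of n] N_visser[OF assms, of "Suc n"] Suc.IH
        visser_bound_range[of n] visser_bound_range[of "Suc n"]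
      by (intro mult_mono) (linarith | rule N_nonneg)+
    finally show ?thesis .
  qed
  moreover have "(?A + ?B) * (?A - ?B) / 2 = visser_bound (Suc (Suc n)) - ?A"
    by (simp only: visser_bound.simps) (simp add: field_simps power2_eq_square)
  ultimately show ?case by (simp only: N_R_mult)
qed

lemma N_visser_diff:
  assumes "N u \<le> 1" "n \<le> m"
  shows "N (visser u m - visser u n) \<le> visser_bound m - visser_bound n"
  using assms(2)
proof (induction m rule: dec_induct)
  case (step m)
  then show ?case
    using N_triangle[of "visser u (Suc m)" "visser u n" "visser u m"] N_visser_step[OF assms(1), of m]
    by linarith
qed simp

text \<open>At a fixed point \<open>1 - visser u n\<close> would be an exact root of
  \<open>1 - u\<close>. In general the defect is twice the next step, which
  \<open>N_visser_step\<close> controls.\<close>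

lemma visser_square:
  "(1 - visser u n) * (1 - visser u n) = 1 - u + (visser u (Suc n) - visser u n) + (visser u (Suc n) - visser u n)"
proof -
  have "visser u (Suc n) + visser u (Suc n) = u + visser u n * visser u n"
    using R_half[of "u + visser u n * visser u n"] by (simp add: algebra_simps)
  then show ?thesis by (simp add: algebra_simps del: visser.simps)
qed

text \<open>The index depends on \<open>e\<close> alone, since the scalar sequence bounds the steps
  for all \<open>u\<close> at once.\<close>

lemma visser_error_null:
  assumes "0 < e"
  obtains n where "\<And>u. N u \<le> 1 \<Longrightarrow> N (visser u (Suc n) - visser u n) < e"
proof -
  obtain n where "visser_bound (Suc n) - visser_bound n < e"
    using LIMSEQ_D[OF visser_bound_step assms] by (metis abs_ge_self diff_zero le_less_trans order_refl real_norm_def)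
  then show ?thesis using that N_visser_step by (meson le_less_trans)
qed

text \<open>For an approximate root \<open>g\<close> of \<open>1 - h * h\<close> commuting with
  \<open>h\<close>, the sum \<open>h * h + g * g\<close> is nearly 1, and
  \<open>N_le_commuting\<close> bounds \<open>g\<close>. In spectral terms: 1 - t^2 lies in [0, 1]
  when t lies in [-1, 1].\<close>

lemma N_one_minus_square:
  assumes h: "st h = h" and "N h \<le> 1"
  shows "N (1 - h * h) \<le> 1"
proof (rule field_le_epsilon)
  fix e :: real assume "0 < e"
  then obtain n where n: "\<And>u. N u \<le> 1 \<Longrightarrow> N (visser u (Suc n) - visser u n) < e / 4"
    using visser_error_null[of "e / 4"] by auto
  let ?u = "h * h"
  define g where "g = 1 - visser ?u n"
  define d where "d = visser ?u (Suc n) - visser ?u n"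
  have Nu: "N ?u \<le> 1" using assms by (simp add: N_sq power_le_one)
  have d: "N d < e / 4" unfolding d_def by (rule n[OF Nu])
  have gg: "g * g = 1 - ?u + d + d" unfolding g_def d_def by (rule visser_square)
  have su: "st ?u = ?u" using h by (simp add: st_mult)
  have sg: "st g = g" unfolding g_def by (simp add: st_diff st_visser[OF su])
  have "h * visser ?u n = visser ?u n * h" by (rule visser_commute) (simp add: mult.assoc)
  then have gh: "h * g = g * h" unfolding g_def by (simp add: algebra_simps)
  have "(N g)\<^sup>2 \<le> N (h * h + g * g)" by (rule N_le_commuting[OF h sg gh])
  also have "h * h + g * g = 1 + (d + d)" by (simp add: gg)
  also have "N \<dots> \<le> 1 + 2 * (e / 4)"
    using N_add[of 1 "d + d"] N_add[of d d] N_1 d by linarith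
  finally have 1: "N (g * g) \<le> 1 + e / 2" by (simp add: N_sq[OF sg])
  have "1 - ?u = g * g - (d + d)" by (simp add: gg)
  then show "N (1 - ?u) \<le> 1 + e"
    using N_diff[of "g * g" "d + d"] N_add[of d d] d 1 by simp
qed

lemma N_minus_square:
  assumes h: "st h = h" and c: "(N h)\<^sup>2 \<le> c"
  shows "N (R c - h * h) \<le> c"
proof (cases "c = 0")
  case True
  then show ?thesis using assms by (simp add: N_sq)
next
  case False
  then have c0: "0 < c" using c by (metis less_le order_trans zero_le_power2)
  define k where "k = R (1 / sqrt c) * h"
  have "N h \<le> sqrt c" using c by (simp add: real_le_rsqrt)
  then have "N k \<le> 1" using c0 by (simp add: k_def N_R_mult)
  moreover have "st k = k" by (simp add: k_def st_mult h R_commute)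
  ultimately have 1: "N (1 - k * k) \<le> 1" by (intro N_one_minus_square)
  have "k * k = R (1 / c) * (h * h)"
    using c0 by (simp add: k_def R_mult_R_mult)
  then have "R c * (k * k) = h * h" using c0 by (simp add: R_R_mult)
  then have "R c - h * h = R c * (1 - k * k)" by (simp add: right_diff_distrib)
  then show ?thesis using 1 c0 by (simp add: N_R_mult)
qed

section \<open>The positive cone of one seminorm\<close>

text \<open>Positivity without spectra: in a C*-algebra the inequality places the spectrum of the
  self-adjoint \<open>h\<close> in [0, 2c]. By \<open>pos_bound\<close> the test then succeeds for
  every \<open>c\<close> from \<open>N h\<close> on.\<close>

definition pos :: "'x \<Rightarrow> bool" where
  "pos h \<longleftrightarrow> st h = h \<and> (\<exists>c\<ge>0. N (R c - h) \<le> c)"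

lemma pos_st: "pos h \<Longrightarrow> st h = h"
  by (simp add: pos_def)

text \<open>Scaling by the witness \<open>c\<close> makes \<open>u = 1 - R (1 / c) * h\<close>
  contractive, and \<open>R (sqrt c) * (1 - visser u n)\<close> squares to \<open>h\<close> up to an
  error proportional to one iteration step. The root is a polynomial in \<open>h\<close>; the clause
  on \<open>z\<close> records what is used of this.\<close>

lemma pos_approx_square:
  assumes "pos h" "0 < e"
  shows "\<exists>g. st g = g \<and> (\<forall>z. z * h = h * z \<longrightarrow> z * g = g * z) \<and> N (h - g * g) < e"
proof -
  obtain c where c: "0 \<le> c" "N (R c - h) \<le> c" and h: "st h = h"
    using assms(1) by (auto simp: pos_def)
  show ?thesis
  proof (cases "c = 0")
    case True
    then show ?thesis using c assms(2) by (intro exI[of _ 0]) simp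
  next
    case False
    with c have c0: "0 < c" by simp
    define u where "u = 1 - R (1 / c) * h"
    have "R (1 / c) * R c = 1" using c0 by (simp flip: R_mult)
    then have "u = R (1 / c) * (R c - h)" by (simp add: u_def right_diff_distrib)
    then have Nu: "N u \<le> 1" using c c0 by (simp add: N_R_mult)
    obtain n where n: "N (visser u (Suc n) - visser u n) < e / (2 * c)"
      using visser_error_null[of "e / (2 * c)"] assms(2) c0 Nu by auto
    define d where "d = visser u (Suc n) - visser u n"
    define g where "g = R (sqrt c) * (1 - visser u n)"
    have su: "st u = u" by (simp add: u_def st_diff st_mult h R_commute)
    have "st g = g" by (simp add: g_def st_diff st_mult R_commute st_visser[OF su])
    moreover have "z * g = g * z" if "z * h = h * z" for z
    proof -
      have "z * u = u * z" using that by (simp add: u_def algebra_simps R_left_commute)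
      from visser_commute[OF this, of n] show ?thesis
        by (simp add: g_def algebra_simps R_left_commute R_commute)
    qed
    moreover have "N (h - g * g) < e"
    proof -
      have "g * g = R c * ((1 - visser u n) * (1 - visser u n))"
        unfolding g_def using c0
        by (simp add: R_mult_R_mult)
      also have "\<dots> = R c * (1 - u) + R c * (d + d)"
        unfolding visser_square d_def by (simp only: add.assoc distrib_left)
      also have "R c * (1 - u) = h" using c0 by (simp add: u_def R_R_mult)
      finally have "h - g * g = - (R c * (d + d))" by simp
      then have "N (h - g * g) = c * N (d + d)" using c0 by (simp add: N_R_mult)
      also have "\<dots> \<le> c * (N d + N d)" using c0 N_add[of d d] by simp
      also have "\<dots> < e" using n c0 unfolding d_def[symmetric] by (simp add: field_simps)
      finally show ?thesis .
    qed
    ultimately show ?thesis by blast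
  qed
qed

text \<open>A positive \<open>h\<close> is close to some \<open>g * g\<close>, for which
  \<open>N_minus_square\<close> provides the bound with every constant from
  \<open>(N g)\<^sup>2\<close> on; that square is hardly larger than \<open>N h\<close>.\<close>

lemma pos_bound:
  assumes "pos h" "N h \<le> c"
  shows "N (R c - h) \<le> c"
proof (rule field_le_epsilon)
  fix e :: real assume e: "0 < e"
  have e3: "0 < e / 3" using e by simp
  obtain g where g: "st g = g" "N (h - g * g) < e / 3"
    using pos_approx_square[OF assms(1) e3] by blast
  have "N (g * g) \<le> N h + N (h - g * g)"
    using N_diff[of h "h - g * g"] by simp
  then have "(N g)\<^sup>2 \<le> c + e / 3" using g assms(2) N_sq[OF g(1)] by linarith
  then have "N (R (c + e / 3) - g * g) \<le> c + e / 3" by (rule N_minus_square[OF g(1)])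
  moreover have eq: "R c - h = (R (c + e / 3) - g * g) - (R (e / 3) + (h - g * g))"
    by (simp add: R_add)
  ultimately show "N (R c - h) \<le> c + e"
    unfolding eq using N_diff[of "R (c + e / 3) - g * g" "R (e / 3) + (h - g * g)"]
      N_add[of "R (e / 3)" "h - g * g"] N_R_nonneg[of "e / 3"] g(2) e by linarith
qed

lemma posI: "st h = h \<Longrightarrow> N (R c - h) \<le> c \<Longrightarrow> pos h"
  unfolding pos_def using order_trans[OF N_nonneg[of "R c - h"]] by auto

lemma pos_diff_of_bound:
  assumes "st h = h" "N h \<le> c"
  shows "pos (R c - h)"
  using assms by (intro posI[of _ c]) (auto simp: st_diff)

lemma pos_add:
  assumes "pos h" "pos k"
  shows "pos (h + k)"
proof (rule posI)
  show "st (h + k) = h + k" using assms by (simp add: st_add pos_st)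
  have eq: "R (N h + N k) - (h + k) = (R (N h) - h) + (R (N k) - k)"
    by (simp add: R_add)
  show "N (R (N h + N k) - (h + k)) \<le> N h + N k"
    unfolding eq using N_add[of "R (N h) - h" "R (N k) - k"] pos_bound[OF assms(1), of "N h"]
      pos_bound[OF assms(2), of "N k"] by simp
qed

lemma pos_0: "pos 0"
  by (rule posI[of _ 0]) auto

lemma pos_sum: "(\<And>i. i \<in> I \<Longrightarrow> pos (f i)) \<Longrightarrow> pos (sum f I)"
  by (induction I rule: infinite_finite_induct) (auto intro: pos_add pos_0)

lemma pos_scale:
  assumes "pos h" "0 \<le> t"
  shows "pos (R t * h)"
proof (rule posI)
  show "st (R t * h) = R t * h" using assms by (simp add: st_mult pos_st R_commute)
  have "R (t * N h) - R t * h = R t * (R (N h) - h)"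
    by (simp add: algebra_simps R_mult)
  then show "N (R (t * N h) - R t * h) \<le> t * N h"
    using assms pos_bound[OF assms(1), of "N h"] by (simp add: N_R_mult mult_left_mono)
qed

lemma pos_square: "st h = h \<Longrightarrow> pos (h * h)"
  using N_minus_square[of h "(N h)\<^sup>2"] by (intro posI[of _ "(N h)\<^sup>2"]) (auto simp: st_mult)

lemma pos_closed:
  assumes h: "st h = h" and approx: "\<And>e. 0 < e \<Longrightarrow> \<exists>k. pos k \<and> N (h - k) \<le> e"
  shows "pos h"
proof (rule posI[OF h])
  show "N (R (N h) - h) \<le> N h"
  proof (rule field_le_epsilon)
    fix e :: real assume e: "0 < e"
    obtain k where k: "pos k" "N (h - k) \<le> e / 3" using approx[of "e / 3"] e by auto
    have "N k \<le> N h + e / 3"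
      using N_diff[of h "h - k"] k by simp
    then have "N (R (N h + e / 3) - k) \<le> N h + e / 3" using k by (intro pos_bound)
    moreover have eq: "R (N h) - h = (R (N h + e / 3) - k) - (R (e / 3) + (h - k))"
      by (simp add: R_add)
    ultimately show "N (R (N h) - h) \<le> N h + e"
      unfolding eq using N_diff[of "R (N h + e / 3) - k" "R (e / 3) + (h - k)"]
        N_add[of "R (e / 3)" "h - k"] N_R_nonneg[of "e / 3"] k(2) e by linarith
  qed
qed

text \<open>Approximate roots \<open>f\<close> of \<open>h\<close> and \<open>g\<close> of
  \<open>k\<close> commute: \<open>k\<close> commutes with \<open>h\<close>, hence with
  \<open>f\<close>, and so \<open>f\<close>, commuting with \<open>k\<close>, commutes with
  \<open>g\<close>. It remains to apply \<open>N_le_commuting\<close> to them.\<close>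

lemma N_mono_commuting:
  assumes h: "pos h" and k: "pos k" and hk: "h * k = k * h"
  shows "N h \<le> N (h + k)"
proof (rule field_le_epsilon)
  fix e :: real assume e: "0 < e"
  have e_pos: "0 < e / 3" using e by simp
  obtain f where f: "st f = f" "\<forall>z. z * h = h * z \<longrightarrow> z * f = f * z" "N (h - f * f) < e / 3"
    using pos_approx_square[OF h e_pos] by blast
  have e_pos_k: "0 < e / 3" using e by simp
  obtain g where g: "st g = g" "\<forall>z. z * k = k * z \<longrightarrow> z * g = g * z" "N (k - g * g) < e / 3"
    using pos_approx_square[OF k e_pos_k] by blast
  have "k * f = f * k" by (rule f(2)[rule_format, OF hk[symmetric]])
  then have "f * g = g * f" by (intro g(2)[rule_format]) simp
  then have "(N f)\<^sup>2 \<le> N (g * g + f * f)" by (intro N_le_commuting g(1) f(1)) simp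
  moreover have "N (g * g + f * f) = N ((h + k) - (h - f * f) - (k - g * g))"
    by (simp add: algebra_simps)
  moreover have "N h \<le> N (f * f) + N (h - f * f)" using N_add[of "f * f" "h - f * f"] by simp
  ultimately show "N h \<le> N (h + k) + e"
    using N_diff[of "(h + k) - (h - f * f)" "k - g * g"] N_diff[of "h + k" "h - f * f"]
      f(3) g(3) N_sq[OF f(1)] e by linarith
qed

text \<open>Reduction to the commuting case: \<open>R (N m) - h\<close> is positive, being the sum
  of \<open>R (N m) - m\<close> and \<open>m - h\<close>, and it commutes with \<open>h\<close>
  because \<open>R (N m)\<close> is a scalar.\<close>

lemma N_mono:
  assumes h: "pos h" and mh: "pos (m - h)"
  shows "N h \<le> N m"
proof -
  have "st m = m" using pos_st[OF h] pos_st[OF mh] by (simp add: st_diff)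
  then have "pos (R (N m) - m)" by (intro pos_diff_of_bound) auto
  from pos_add[OF this mh] have "pos (R (N m) - h)" by simp
  from N_mono_commuting[OF h this] have "N h \<le> N (R (N m))"
    by (simp add: algebra_simps R_commute)
  then show ?thesis using N_R[of "N m"] by simp
qed

end

section \<open>Positivity of \<open>x\<^sup>*x\<close>\<close>

context cstar_seminormed_ring begin

text \<open>If the middle factor were \<open>k * k\<close> with \<open>k\<close> commuting with
  \<open>st y * y\<close>, the two sides would be the seminorms of \<open>w * st w\<close> and
  \<open>st w * w\<close> for \<open>w = y * k\<close>, which agree. The middle factor is positive,
  so such a \<open>k\<close> exists up to an error.\<close>

lemma N_conjugate_eq:
  assumes M: "N (st y * y) \<le> K"
  shows "N (y * (R K - st y * y) * st y) = N ((R K - st y * y) * (st y * y))"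
proof -
  define z where "z = R K - st y * y"
  have pz: "pos z"
    unfolding z_def using M by (intro pos_diff_of_bound) (simp_all add: st_mult)
  have *: "\<bar>N (y * z * st y) - N (z * (st y * y))\<bar> \<le> e" if e: "0 < e" for e
  proof -
    define M where "M = (N y)\<^sup>2 + 1"
    have M0: "M > 0" by (simp add: M_def add_nonneg_pos)
    have eM: "0 < e / (2 * M)" using e M0 by simp
    obtain k where k: "st k = k" "\<forall>x. x * z = z * x \<longrightarrow> x * k = k * x" "N (z - k * k) < e / (2 * M)"
      using pos_approx_square[OF pz eM] by blast
    have kc: "(st y * y) * k = k * (st y * y)"
      by (rule k(2)[rule_format]) (simp add: z_def algebra_simps R_commute)
    have "N ((y * k) * st (y * k)) = N (st (y * k) * (y * k))"
      by (simp only: N_star N_star')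
    moreover have "(y * k) * st (y * k) = y * (k * k) * st y"
      by (simp add: st_mult k(1) mult.assoc)
    moreover have "st (y * k) * (y * k) = (k * k) * (st y * y)"
      using kc by (simp add: st_mult k(1) mult.assoc)
    ultimately have 1: "N (y * (k * k) * st y) = N ((k * k) * (st y * y))" by simp
    have "N (y * (z - k * k) * st y) \<le> N y * N (z - k * k) * N y"
      by (metis N_mult N_st N_nonneg mult_right_mono order_trans)
    also have "\<dots> = N (z - k * k) * (N y)\<^sup>2" by (simp add: power2_eq_square)
    also have "\<dots> \<le> e / (2 * M) * M"
      using M0 by (intro mult_mono less_imp_le[OF k(3)] less_imp_le[OF eM]) (auto simp: M_def)
    finally have 2: "N (y * (z - k * k) * st y) \<le> e / 2" using M0 by simp
    have "N ((z - k * k) * (st y * y)) \<le> N (z - k * k) * (N y)\<^sup>2"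
      by (metis N_mult N_star)
    also have "\<dots> \<le> e / (2 * M) * M"
      using M0 by (intro mult_mono less_imp_le[OF k(3)] less_imp_le[OF eM]) (auto simp: M_def)
    finally have 3: "N ((z - k * k) * (st y * y)) \<le> e / 2" using M0 by simp
    have "y * z * st y = y * (k * k) * st y + y * (z - k * k) * st y"
      "z * (st y * y) = (k * k) * (st y * y) + (z - k * k) * (st y * y)"
      by (simp_all add: algebra_simps)
    then show ?thesis
      using 1 2 3 N_add[of "y * (k * k) * st y" "y * (z - k * k) * st y"]
        N_add[of "(k * k) * (st y * y)" "(z - k * k) * (st y * y)"]
        N_diff[of "y * z * st y" "y * (z - k * k) * st y"]
        N_diff[of "z * (st y * y)" "(z - k * k) * (st y * y)"]
      by (simp add: abs_le_iff)
  qed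
  have "N (y * z * st y) = N (z * (st y * y))"
    by (rule ccontr) (use *[of "\<bar>N (y * z * st y) - N (z * (st y * y))\<bar> / 2"] in auto)
  then show ?thesis by (simp add: z_def)
qed

text \<open>With \<open>y = s + C \<i> * t\<close> split into self-adjoint parts, the mixed terms
  cancel and the sum is twice \<open>s * s + t * t\<close>.\<close>

lemma pos_star_add_star: "pos (st y * y + y * st y)"
proof -
  define s where "s = R (1/2) * (y + st y)"
  define t where "t = C (- \<i> / 2) * (y - st y)"
  have s: "st s = s" by (simp add: s_def st_mult st_add R_commute add.commute)
  have t: "st t = t"
  proof -
    have "st t = (st y - y) * C (cnj (- \<i> / 2))" by (simp add: t_def st_mult st_diff)
    also have "\<dots> = C (\<i> / 2) * (st y - y)" by (simp add: C_commute)
    also have "\<dots> = t" unfolding t_def 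
      by (simp add: algebra_simps C_minus)
    finally show ?thesis .
  qed
  have ss: "s * s = R (1/4) * ((y + st y) * (y + st y))"
    by (simp add: s_def R_mult_R_mult)
  have tt: "t * t = - (R (1/4) * ((y - st y) * (y - st y)))"
  proof -
    have "t * t = C ((- \<i> / 2) * (- \<i> / 2)) * ((y - st y) * (y - st y))"
      unfolding t_def C_mult by (metis C_left_commute mult.assoc)
    also have "(- \<i> / 2) * (- \<i> / 2) = - complex_of_real (1/4)" by simp
    finally show ?thesis unfolding R_def C_minus by simp
  qed
  have "s * s + t * t = R (1/4) * ((y + st y) * (y + st y) - (y - st y) * (y - st y))"
    unfolding ss tt by (simp add: algebra_simps)
  also have "(y + st y) * (y + st y) - (y - st y) * (y - st y) = 2 * (st y * y + y * st y)"
    by (simp add: algebra_simps mult_2 mult_2_right)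
  also have "R (1/4) * \<dots> = R (1/2) * (st y * y + y * st y)"
    using R_half[of "R (1/2) * (st y * y + y * st y)"]
    by (simp add: R_R_mult algebra_simps mult_2 mult_2_right)
  finally have "R 2 * (s * s + t * t) = st y * y + y * st y" by (simp add: R_R_mult)
  then show ?thesis
    using pos_scale[OF pos_add[OF pos_square[OF s] pos_square[OF t]], of 2] by simp
qed

text \<open>Kaplansky's trick: if \<open>y\<^sup>*y\<close> is nearly negative then \<open>yy\<^sup>* = (y\<^sup>*y + yy\<^sup>*) - y\<^sup>*y\<close> is nearly
  positive; since both have the same nonzero spectrum (here: the same norm under \<open>t(2M - t)\<close>), they are small.\<close>

lemma N_star_small:
  assumes p: "pos (R \<eta> - st y * y)" and \<eta>: "0 < \<eta>"
  shows "N (st y * y) \<le> 11 * \<eta>"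
proof (rule ccontr)
  define m where "m = st y * y"
  define b where "b = y * st y"
  define M where "M = N m"
  assume "\<not> N (st y * y) \<le> 11 * \<eta>"
  then have big: "11 * \<eta> < M" by (simp add: M_def m_def)
  have Mb: "N b = M" by (simp add: M_def m_def b_def N_star N_star')
  have sm: "st m = m" and sb: "st b = b" by (simp_all add: m_def b_def st_mult)
  define n where "n = R \<eta> - m"
  have n: "pos n" using p by (simp add: n_def m_def)
  have "pos (b + R \<eta>)"
    using pos_add[OF pos_star_add_star[of y] p] by (simp add: b_def algebra_simps)
  moreover have "N (b + R \<eta>) \<le> M + \<eta>"
    using N_add[of b "R \<eta>"] N_R[of \<eta>] \<eta> by (simp add: Mb)
  ultimately have "N (R (M + \<eta>) - (b + R \<eta>)) \<le> M + \<eta>" by (rule pos_bound)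
  then have 1: "N (R M - b) \<le> M + \<eta>" by (simp add: R_add)
  \<comment> \<open>Upper estimate: the conjugate of 2M - m by y equals 2Mb - b^2 = M^2 - (M - b)^2.
    As only M + \<eta> is known to bound M - b, the square of M + \<eta> is used and the difference
    to M^2 is paid for separately. The result is about M^2.\<close>
  have "N (R ((M + \<eta>)\<^sup>2) - (R M - b) * (R M - b)) \<le> (M + \<eta>)\<^sup>2"
    using 1 by (intro N_minus_square power_mono) (auto simp: st_diff sb)
  moreover have "y * (R (2 * M) - m) * st y
      = (R ((M + \<eta>)\<^sup>2) - (R M - b) * (R M - b)) - R ((M + \<eta>)\<^sup>2 - M\<^sup>2)"
  proof -
    have "y * (R (2 * M) - m) * st y = R (2 * M) * b - b * b"
      by (simp add: m_def b_def algebra_simps R_left_commute)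
    moreover have "R (2 * M) * b = R M * b + R M * b"
      by (metis R_add distrib_right mult_2)
    moreover have "R (M\<^sup>2) = R M * R M" by (simp add: power2_eq_square R_mult)
    ultimately show ?thesis by (simp add: algebra_simps R_diff R_commute[of b])
  qed
  moreover have "\<bar>(M + \<eta>)\<^sup>2 - M\<^sup>2\<bar> = (M + \<eta>)\<^sup>2 - M\<^sup>2"
    using \<eta> big by (intro abs_of_nonneg) (simp add: power_mono)
  ultimately have up: "N (y * (R (2 * M) - m) * st y) \<le> (M + \<eta>)\<^sup>2 + ((M + \<eta>)\<^sup>2 - M\<^sup>2)"
    using N_diff[of "R ((M + \<eta>)\<^sup>2) - (R M - b) * (R M - b)" "R ((M + \<eta>)\<^sup>2 - M\<^sup>2)"]
      N_R[of "(M + \<eta>)\<^sup>2 - M\<^sup>2"] by simp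
  have "N m \<le> 2 * M" using \<eta> big by (simp add: M_def)
  then have eq: "N (y * (R (2 * M) - m) * st y) = N ((R (2 * M) - m) * m)"
    unfolding m_def by (rule N_conjugate_eq)
  \<comment> \<open>Lower estimate: this s makes n(s + n) equal to \<eta>(2M - \<eta>) - (2M - m)m.
    Monotonicity drops the square of n, and since n has norm at least M - \<eta>, the norm of (2M -
    m)m is at least about 2M^2.\<close>
  define s where "s = 2 * M - 2 * \<eta>"
  have s0: "0 \<le> s" using big \<eta> by (simp add: s_def)
  have "pos (R s * n)" using n s0 by (rule pos_scale)
  moreover have "pos ((R s * n + n * n) - R s * n)"
    using pos_square[OF pos_st[OF n]] by simp
  ultimately have "N (R s * n) \<le> N (R s * n + n * n)" by (rule N_mono)
  moreover have "R s * n + n * n = R (\<eta> * (2 * M - \<eta>)) - (R (2 * M) - m) * m"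
  proof -
    have "R s * n + n * n = R s * R \<eta> + R \<eta> * R \<eta> - R s * m - (R \<eta> * m + R \<eta> * m) + m * m"
      by (simp add: n_def algebra_simps R_commute[of m])
    also have "R s * R \<eta> + R \<eta> * R \<eta> = R (\<eta> * (2 * M - \<eta>))"
      unfolding R_mult[symmetric] R_add[symmetric] by (simp add: s_def algebra_simps)
    also have "R \<eta> * m + R \<eta> * m = R (2 * \<eta>) * m"
      unfolding distrib_right[symmetric] R_add[symmetric] by simp
    also have "R (\<eta> * (2 * M - \<eta>)) - R s * m - R (2 * \<eta>) * m
        = R (\<eta> * (2 * M - \<eta>)) - R (s + 2 * \<eta>) * m"
      by (simp only: R_add distrib_right) simp
    also have "s + 2 * \<eta> = 2 * M" by (simp add: s_def)
    finally show ?thesis by (simp add: algebra_simps)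
  qed
  ultimately have low: "s * N n \<le> \<eta> * (2 * M - \<eta>) + N ((R (2 * M) - m) * m)"
    using N_diff[of "R (\<eta> * (2 * M - \<eta>))" "(R (2 * M) - m) * m"] N_R[of "\<eta> * (2 * M - \<eta>)"] s0 \<eta> big
    by (simp add: N_R_mult abs_of_nonneg)
  have "M - \<eta> \<le> N n"
    using N_diff[of "R \<eta>" n] N_R[of \<eta>] \<eta> by (simp add: n_def M_def)
  then have "s * (M - \<eta>) \<le> s * N n" using s0 by (rule mult_left_mono)
  with low up eq have "s * (M - \<eta>) \<le> \<eta> * (2 * M - \<eta>) + (M + \<eta>)\<^sup>2 + ((M + \<eta>)\<^sup>2 - M\<^sup>2)"
    by simp
  \<comment> \<open>The factor 10 arises here by collecting terms; the bound 11 of the lemma lies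
    just above it.\<close>
  then have "M * M + \<eta> * \<eta> \<le> \<eta> * (10 * M)"
    by (simp add: s_def power2_eq_square algebra_simps)
  then have "M * M \<le> \<eta> * (10 * M)" using zero_le_square[of \<eta>] by linarith
  moreover have "\<eta> * (10 * M) < M * M"
  proof -
    have "10 * \<eta> < M" using big \<eta> by simp
    then have "(10 * \<eta>) * M < M * M" using \<eta> by (intro mult_strict_right_mono) auto
    then show ?thesis by (simp add: algebra_simps)
  qed
  ultimately show False by simp
qed

text \<open>For \<open>a = st x * x\<close> the element \<open>w\<close> approximates the absolute
  value of \<open>a\<close>, so \<open>f = w - a\<close> approximates twice its negative part. Then
  \<open>st (x * f) * (x * f) = f * a * f\<close> is nearly negative, hence small by
  \<open>N_star_small\<close>. This makes the cube of \<open>f\<close> small, so \<open>f\<close> is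
  small and \<open>a\<close> is near the positive \<open>w\<close>.\<close>

lemma pos_star_mult_contractive:
  assumes N1: "N (st x * x) \<le> 1"
  shows "pos (st x * x)"
proof (rule pos_closed)
  define a where "a = st x * x"
  have sa: "st a = a" by (simp add: a_def st_mult)
  have Na: "N a \<le> 1" using N1 by (simp add: a_def)
  show "st (st x * x) = st x * x" by (simp add: st_mult)
  fix e' :: real assume e': "0 < e'"
  \<comment> \<open>A cube because \<open>f\<close> is controlled through its cube. The iteration
    error e/200 gives \<open>N r\<close> at most e/100; with \<open>N f \<le> 3\<close> the norm of
    \<open>r * f\<close> is at most \<eta> = 3e/100, and the final bound 23\<eta> stays below
    e.\<close>
  define e where "e = e' ^ 3"
  have e: "0 < e" using e' by (simp add: e_def)
  obtain n where n: "\<And>u. N u \<le> 1 \<Longrightarrow> N (visser u (Suc n) - visser u n) < e / 200"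
    using visser_error_null[of "e / 200"] e by auto
  define u where "u = 1 - a * a"
  define d where "d = visser u (Suc n) - visser u n"
  define w where "w = 1 - visser u n"
  define f where "f = w - a"
  define r where "r = d + d"
  define \<eta> where "\<eta> = 3 * (e / 100)"
  have Nu: "N u \<le> 1" unfolding u_def using sa Na by (rule N_one_minus_square)
  have su: "st u = u" by (simp add: u_def st_diff st_mult sa)
  have ww: "w * w = a * a + r"
    unfolding w_def visser_square by (simp add: u_def d_def r_def add.assoc del: visser.simps)
  have Nr: "N r \<le> e / 100" using N_add[of d d] n[OF Nu] by (simp add: r_def d_def del: visser.simps)
  have sw: "st w = w" by (simp add: w_def st_diff st_visser[OF su])
  have pw: "pos w" using N_visser_le_1[OF Nu, of n] by (intro posI[OF sw, of 1]) (simp add: w_def)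
  have "a * u = u * a" by (simp add: u_def algebra_simps)
  from visser_commute[OF this] have aw: "a * w = w * a" by (simp add: w_def algebra_simps)
  have sf: "st f = f" by (simp add: f_def st_diff sw sa)
  have wf: "w * f = f * w" and af: "a * f = f * a" by (simp_all add: f_def algebra_simps aw)
  have Nw: "N w \<le> 2" using N_diff[of 1 "visser u n"] N_1 N_visser_le_1[OF Nu, of n] by (simp add: w_def)
  have Nf: "N f \<le> 3" using N_diff[of w a] Nw Na by (simp add: f_def)
  \<comment> \<open>The product of a + w and w - a is w^2 - a^2 = r. Up to this error
    \<open>f * a * f\<close> is the negative of the positive element
    \<open>f * w * f\<close>.\<close>
  have key: "f * a * f = r * f - f * w * f"
  proof -
    have "(a + w) * f = r"
      using aw ww by (simp add: f_def algebra_simps)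
    then have "(a + w) * f * f = r * f" by simp
    then show ?thesis using wf af by (simp add: algebra_simps)
  qed
  have pfwf: "pos (f * w * f)"
  proof (rule pos_closed)
    show "st (f * w * f) = f * w * f" by (simp add: st_mult sf sw mult.assoc)
    fix d :: real assume d: "0 < d"
    have d9: "0 < d / 9" using d by simp
    obtain v where v: "st v = v" "\<forall>z. z * w = w * z \<longrightarrow> z * v = v * z" "N (w - v * v) < d / 9"
      using pos_approx_square[OF pw d9] by blast
    have fv: "f * v = v * f" by (rule v(2)[rule_format]) (simp add: wf)
    have "st (f * v) = f * v" by (simp add: st_mult v sf fv)
    then have "pos ((f * v) * (f * v))" by (rule pos_square)
    moreover have "f * w * f - (f * v) * (f * v) = f * (w - v * v) * f"
    proof -
      have "(f * v) * (f * v) = f * (v * v) * f" by (metis fv mult.assoc)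
      then show ?thesis by (simp only:) (simp add: algebra_simps)
    qed
    moreover have "N (f * (w - v * v) * f) \<le> d"
    proof -
      have "N (f * (w - v * v) * f) \<le> N f * N (w - v * v) * N f"
        by (metis N_mult N_nonneg mult_right_mono order_trans)
      also have "\<dots> \<le> 3 * (d / 9) * 3"
        using Nf v(3) d by (intro mult_mono) auto
      finally show ?thesis by simp
    qed
    ultimately show "\<exists>k. pos k \<and> N (f * w * f - k) \<le> d" by metis
  qed
  have srf: "st (r * f) = r * f"
  proof -
    have "r * f = f * a * f + f * w * f" by (simp add: key)
    then show ?thesis by (simp add: st_add st_mult sf sa sw mult.assoc)
  qed
  have Nrf: "N (r * f) \<le> \<eta>"
  proof -
    have "N (r * f) \<le> N r * N f" by (rule N_mult)
    also have "\<dots> \<le> (e / 100) * 3" using Nr Nf e by (intro mult_mono) auto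
    finally show ?thesis by (simp add: \<eta>_def)
  qed
  have \<eta>: "0 < \<eta>" using e by (simp add: \<eta>_def)
  have yy: "st (x * f) * (x * f) = f * a * f" by (simp add: st_mult sf a_def mult.assoc)
  have "pos ((R \<eta> - r * f) + f * w * f)"
    by (intro pos_add pos_diff_of_bound srf Nrf pfwf)
  then have "pos (R \<eta> - st (x * f) * (x * f))" unfolding yy key by (simp add: algebra_simps)
  from N_star_small[OF this \<eta>] have "N (f * a * f) \<le> 11 * \<eta>" unfolding yy .
  moreover have "f * f * f = (r * f - f * a * f) - f * a * f"
  proof -
    have "f * f * f = f * w * f - f * a * f" by (simp add: f_def algebra_simps)
    then show ?thesis unfolding key by simp
  qed
  ultimately have "N (f * f * f) \<le> 23 * \<eta>"
    using N_diff[of "r * f - f * a * f" "f * a * f"] N_diff[of "r * f" "f * a * f"] Nrf by simp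
  \<comment> \<open>Two uses of the C*-identity give the fourth power of \<open>N f\<close> as the
    seminorm of the fourth power of \<open>f\<close>; one factor is then cancelled.\<close>
  moreover have "(N f) ^ 3 \<le> N (f * f * f)"
  proof (cases "N f = 0")
    case False
    have "(N f) ^ 4 = N ((f * f) * (f * f))"
      using N_sq[OF sf] N_sq[of "f * f"] by (simp add: st_mult sf)
    also have "\<dots> \<le> N (f * f * f) * N f" by (metis N_mult mult.assoc)
    finally have "(N f) ^ 3 * N f \<le> N (f * f * f) * N f" by (simp add: power4_eq_xxxx power3_eq_cube)
    then show ?thesis using False N_nonneg[of f] by simp
  qed simp
  ultimately have "(N f) ^ 3 \<le> e' ^ 3"
    using zero_less_power[OF e', of 3] unfolding \<eta>_def e_def by linarith
  then have "N f \<le> e'" using e' power_le_imp_le_base[of "N f" 2 e'] by simp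
  moreover have "a - w = - f" by (simp add: f_def)
  ultimately show "\<exists>k. pos k \<and> N (st x * x - k) \<le> e'"
    using pw unfolding a_def[symmetric] by (metis N_minus)
qed

theorem pos_star_mult: "pos (st x * x)"
proof (cases "N x = 0")
  case True
  then show ?thesis by (intro posI[of _ 0]) (auto simp: st_mult N_star)
next
  case False
  then have N0: "N x > 0" using N_nonneg[of x] by (simp add: less_le)
  let ?z = "R (1 / N x) * x"
  have z: "st ?z * ?z = R ((1 / N x)\<^sup>2) * (st x * x)"
    by (simp add: st_mult R_commute[of "st x"] R_mult_R_mult power2_eq_square)
  have "N (st ?z * ?z) \<le> 1" using N0 by (simp add: N_star N_R_mult power_mult_distrib)
  then have "pos (st ?z * ?z)" by (rule pos_star_mult_contractive)
  moreover have "(N x)\<^sup>2 * (1 / N x)\<^sup>2 = 1" using N0 by (simp add: power_divide)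
  ultimately show ?thesis
    using pos_scale[of "st ?z * ?z" "(N x)\<^sup>2"] by (simp only: z R_R_mult) simp
qed

lemma pos_sum_star: "pos (\<Sum>i\<in>I. st (f i) * f i)"
  by (intro pos_sum pos_star_mult)

lemma N_square_le_sum_star:
  assumes "finite I" "i \<in> I"
  shows "(N (f i))\<^sup>2 \<le> N (\<Sum>i\<in>I. st (f i) * f i)"
proof -
  have "(\<Sum>i\<in>I. st (f i) * f i) - st (f i) * f i = (\<Sum>i\<in>I - {i}. st (f i) * f i)"
    using sum.remove[OF assms, of "\<lambda>i. st (f i) * f i"] by simp
  then have "pos ((\<Sum>i\<in>I. st (f i) * f i) - st (f i) * f i)" by (simp add: pos_sum_star)
  from N_mono[OF pos_star_mult this] show ?thesis by (simp add: N_star)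
qed

lemma pos_conjugate:
  assumes h: "pos h"
  shows "pos (st a * h * a)"
proof (rule pos_closed)
  show "st (st a * h * a) = st a * h * a" by (simp add: st_mult pos_st[OF h] mult.assoc)
  fix e :: real assume e: "0 < e"
  define M where "M = (N a)\<^sup>2 + 1"
  have M0: "M > 0" by (simp add: M_def add_nonneg_pos)
  have e_pos: "0 < e / M" using e M0 by simp
  obtain g where g: "st g = g" "N (h - g * g) < e / M"
    using pos_approx_square[OF h e_pos] by blast
  have "pos (st (g * a) * (g * a))" by (rule pos_star_mult)
  moreover have "st a * h * a - st (g * a) * (g * a) = st a * (h - g * g) * a"
    by (simp add: st_mult g algebra_simps)
  moreover have "N (st a * (h - g * g) * a) \<le> e"
  proof -
    have "N (st a * (h - g * g) * a) \<le> N a * N (h - g * g) * N a"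
      by (metis N_mult N_nonneg N_st mult_right_mono order_trans)
    also have "\<dots> = N (h - g * g) * (N a)\<^sup>2" by (simp add: power2_eq_square)
    also have "\<dots> \<le> e / M * M" using M0
      by (intro mult_mono less_imp_le[OF g(2)] less_imp_le[OF e_pos]) (auto simp: M_def)
    finally show ?thesis using M0 by simp
  qed
  ultimately show "\<exists>k. pos k \<and> N (st a * h * a - k) \<le> e" by metis
qed

section \<open>The inner product of columns and its norm\<close>

text \<open>The ring-valued inner product of the standard Hilbert module, conjugate-linear in the
  first argument.\<close>

definition gram :: "'i set \<Rightarrow> ('i \<Rightarrow> 'x) \<Rightarrow> ('i \<Rightarrow> 'x) \<Rightarrow> 'x" where
  "gram I x y = (\<Sum>i\<in>I. st (x i) * y i)"

text \<open>The inner square of \<open>z = x a - c y\<close> with \<open>a = gram I x y\<close> is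
  positive, and \<open>pos_conjugate\<close> bounds \<open>st a * gram I x x * a\<close> by
  \<open>R c * (st a * a)\<close>; what remains compares \<open>R c * (st a * a)\<close> with
  \<open>R (c * c) * gram I y y\<close>. The extra positive \<open>c\<close> avoids dividing by the
  seminorm of \<open>gram I x x\<close>, which may be 0.\<close>

lemma Cauchy_Schwarz_aux:
  assumes c: "N (gram I x x) \<le> c" "0 < c"
  shows "(N (gram I x y))\<^sup>2 \<le> c * N (gram I y y)"
proof -
  define a where "a = gram I x y"
  have sa: "st a = gram I y x" by (simp add: a_def gram_def st_sum st_mult)
  define z where "z i = x i * a - R c * y i" for i
  have "gram I z z = st a * gram I x x * a - R c * (st a * a) - R c * (st a * a) + R (c * c) * gram I y y"
  proof -
    have "st (z i) * z i = st a * (st (x i) * x i) * a - R c * (st a * (st (x i) * y i))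
        - R c * ((st (y i) * x i) * a) + R (c * c) * (st (y i) * y i)" for i
    proof -
      have "st (z i) * z i = (st a * st (x i) - R c * st (y i)) * (x i * a - R c * y i)"
        by (simp add: z_def st_diff st_mult R_commute)
      also have "\<dots> = st a * (st (x i) * x i) * a - (st a * st (x i)) * (R c * y i)
        - R c * ((st (y i) * x i) * a) + (R c * st (y i)) * (R c * y i)"
        by (simp add: algebra_simps)
      also have "st a * st (x i) * (R c * y i) = R c * (st a * (st (x i) * y i))"
        by (simp add: R_left_commute mult.assoc)
      finally show ?thesis by (simp only: R_mult_R_mult)
    qed
    then have "gram I z z = st a * gram I x x * a - R c * (st a * gram I x y)
        - R c * (gram I y x * a) + R (c * c) * gram I y y"
      by (simp add: gram_def sum.distrib sum_subtractf sum_distrib_left sum_distrib_right)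
    then show ?thesis by (simp add: a_def[symmetric] sa[symmetric])
  qed
  moreover have "st a * (R c - gram I x x) * a = R c * (st a * a) - st a * gram I x x * a"
    by (simp add: left_diff_distrib right_diff_distrib R_left_commute mult.assoc)
  ultimately have eq: "gram I z z + st a * (R c - gram I x x) * a = R (c * c) * gram I y y - R c * (st a * a)"
    by simp
  have "pos (gram I z z)" by (simp add: gram_def pos_sum_star)
  moreover have "pos (st a * (R c - gram I x x) * a)"
    using c by (intro pos_conjugate pos_diff_of_bound) (simp_all add: gram_def st_sum st_mult)
  ultimately have "pos (R (c * c) * gram I y y - R c * (st a * a))"
    unfolding eq[symmetric] by (rule pos_add)
  moreover have "pos (R c * (st a * a))"
    using c by (intro pos_scale pos_star_mult) simp
  ultimately have "N (R c * (st a * a)) \<le> N (R (c * c) * gram I y y)" by (intro N_mono)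
  then show ?thesis using c by (simp add: N_R_mult N_star a_def)
qed

theorem Cauchy_Schwarz: "(N (gram I x y))\<^sup>2 \<le> N (gram I x x) * N (gram I y y)"
proof (rule field_le_epsilon)
  fix e :: real assume e: "0 < e"
  define d where "d = e / (N (gram I y y) + 1)"
  have p: "N (gram I y y) + 1 > 0" by (simp add: add_nonneg_pos)
  have d: "0 < d" "d * N (gram I y y) \<le> e"
    using e p by (simp_all add: d_def field_simps)
  have "(N (gram I x y))\<^sup>2 \<le> (N (gram I x x) + d) * N (gram I y y)"
    using d by (intro Cauchy_Schwarz_aux) (auto simp: add_nonneg_pos)
  then show "(N (gram I x y))\<^sup>2 \<le> N (gram I x x) * N (gram I y y) + e"
    using d by (simp add: algebra_simps)
qed

lemma sqrt_N_gram_triangle: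
  fixes x y :: "'i \<Rightarrow> 'x"
  shows "sqrt (N (gram I (\<lambda>i. x i + y i) (\<lambda>i. x i + y i))) \<le> sqrt (N (gram I x x)) + sqrt (N (gram I y y))"
proof (rule real_le_lsqrt)
  define a b where "a = sqrt (N (gram I x x))" and "b = sqrt (N (gram I y y))"
  have ab: "0 \<le> a" "0 \<le> b" "N (gram I x x) = a\<^sup>2" "N (gram I y y) = b\<^sup>2" by (simp_all add: a_def b_def)
  have 1: "N (gram I x y) \<le> a * b"
  proof (rule power2_le_imp_le)
    show "(N (gram I x y))\<^sup>2 \<le> (a * b)\<^sup>2"
      using Cauchy_Schwarz[of I x y] by (simp only: ab(3,4) power_mult_distrib)
  qed (use ab in simp)
  have "gram I y x = st (gram I x y)" by (simp add: gram_def st_sum st_mult)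
  then have 2: "N (gram I y x) \<le> a * b" using 1 by simp
  have eq: "gram I (\<lambda>i. x i + y i) (\<lambda>i. x i + y i) = (gram I x x + gram I x y) + (gram I y x + gram I y y)"
    by (simp add: gram_def st_add algebra_simps sum.distrib)
  have "N (gram I (\<lambda>i. x i + y i) (\<lambda>i. x i + y i)) \<le> (a\<^sup>2 + a * b) + (a * b + b\<^sup>2)"
    unfolding eq using N_add[of "gram I x x + gram I x y" "gram I y x + gram I y y"]
      N_add[of "gram I x x" "gram I x y"] N_add[of "gram I y x" "gram I y y"] 1 2 ab by linarith
  then show "N (gram I (\<lambda>i. x i + y i) (\<lambda>i. x i + y i)) \<le> (sqrt (N (gram I x x)) + sqrt (N (gram I y y)))\<^sup>2"
    by (simp add: a_def[symmetric] b_def[symmetric] power2_eq_square algebra_simps)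
qed simp

end

section \<open>Square roots\<close>

lemma null_if_bounded_by_null_sequence:
  fixes c :: real
  assumes "0 \<le> c" "f \<longlonglongrightarrow> 0" "\<And>n. n \<ge> K \<Longrightarrow> c \<le> f n"
  shows "c = 0"
proof -
  have "eventually (\<lambda>n. c \<le> f n) sequentially"
    using assms(3) eventually_sequentially by blast
  from tendsto_lowerbound[OF assms(2) this] show ?thesis using assms(1) by simp
qed

section \<open>Approximate inverses of 1 + h\<close>

context cstar_seminormed_ring
begin

text \<open>The error \<open>1 - a y\<^sub>n\<close> is the product of the \<open>1 - a/j\<close> for \<open>j \<le> n\<close>. The steps \<open>1/j\<close> tend to \<open>0\<close> but have
  divergent sum, so one sequence converges in every seminorm, however large \<open>a\<close> is there.\<close>

primrec resolvent_error :: "'x \<Rightarrow> nat \<Rightarrow> 'x" where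
  "resolvent_error a 0 = 1"
| "resolvent_error a (Suc n) = (1 - R (1 / real (Suc n)) * a) * resolvent_error a n"

primrec resolvent_approx :: "'x \<Rightarrow> nat \<Rightarrow> 'x" where
  "resolvent_approx a 0 = 0"
| "resolvent_approx a (Suc n) = resolvent_approx a n + R (1 / real (Suc n)) * resolvent_error a n"

lemma mult_resolvent_approx: "a * resolvent_approx a n = 1 - resolvent_error a n"
  by (induction n) (simp_all add: algebra_simps R_left_commute)

lemma resolvent_error_commute: "a * resolvent_error a n = resolvent_error a n * a"
proof (induction n)
  case (Suc n)
  let ?t = "1 - R (1 / real (Suc n)) * a"
  have "a * ?t = ?t * a" by (simp add: algebra_simps R_left_commute)
  then show ?case using Suc by (metis mult.assoc resolvent_error.simps(2))
qed simp

lemma st_resolvent_error: "st a = a \<Longrightarrow> st (resolvent_error a n) = resolvent_error a n"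
proof (induction n)
  case (Suc n)
  let ?t = "1 - R (1 / real (Suc n)) * a"
  have "st ?t = ?t" using Suc.prems by (simp add: st_diff st_mult R_commute[of a])
  moreover have "resolvent_error a n * ?t = ?t * resolvent_error a n"
    by (simp add: algebra_simps R_left_commute resolvent_error_commute)
  ultimately show ?case using Suc by (simp add: st_mult del: of_nat_Suc)
qed simp

lemma st_resolvent_approx: "st a = a \<Longrightarrow> st (resolvent_approx a n) = resolvent_approx a n"
  by (induction n) (auto simp: st_add st_mult st_resolvent_error R_commute[of "resolvent_error a n" for n])

text \<open>From index \<open>K\<close> on the factors are (n - h)/(n + 1), of norm at most n/(n +
  1) by \<open>pos_bound\<close>, and these bounds telescope to K/n. The earlier factors, which may
  be large, are absorbed in the constant.\<close>

lemma N_resolvent_error: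
  assumes h: "pos h" and K: "N h \<le> real K" "1 \<le> K" and n: "K \<le> n"
  shows "N (resolvent_error (1 + h) n) \<le> real K * N (resolvent_error (1 + h) K) / real n"
  using n
proof (induction n rule: dec_induct)
  case base
  then show ?case using K by simp
next
  case (step n)
  let ?T = "resolvent_error (1 + h)"
  have "R (1 / real (Suc n)) * R (1 + real n) = 1"
    by (simp flip: R_mult)
  then have "1 - R (1 / real (Suc n)) * (1 + h) = R (1 / real (Suc n)) * (R (real n) - h)"
    by (simp add: R_add algebra_simps)
  then have "N (1 - R (1 / real (Suc n)) * (1 + h)) = N (R (real n) - h) / real (Suc n)"
    by (simp add: N_R_mult)
  also have "\<dots> \<le> real n / real (Suc n)"
    using K step.hyps by (intro divide_right_mono pos_bound[OF h]) auto
  finally have b: "N (1 - R (1 / real (Suc n)) * (1 + h)) \<le> real n / real (Suc n)" .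
  have "N (?T (Suc n)) \<le> N (1 - R (1 / real (Suc n)) * (1 + h)) * N (?T n)"
    unfolding resolvent_error.simps(2) by (rule N_mult)
  also have "\<dots> \<le> (real n / real (Suc n)) * N (?T n)"
    using b N_nonneg by (rule mult_right_mono)
  also have "\<dots> \<le> (real n / real (Suc n)) * (real K * N (?T K) / real n)"
    using step.IH by (intro mult_left_mono) auto
  also have "\<dots> = real K * N (?T K) / real (Suc n)"
    using K step.hyps by simp
  finally show ?case .
qed

text \<open>The step 1/(m + 1) times the error bound D/m is D/m - D/(m + 1), so the differences
  telescope.\<close>

lemma N_resolvent_approx_diff:
  assumes h: "pos h" and K: "N h \<le> real K" "1 \<le> K" and n: "K \<le> n" "n \<le> m"
  defines "D \<equiv> real K * N (resolvent_error (1 + h) K)"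
  shows "N (resolvent_approx (1 + h) m - resolvent_approx (1 + h) n) \<le> D / real n - D / real m"
  using n(2)
proof (induction m rule: dec_induct)
  case (step m)
  let ?y = "resolvent_approx (1 + h)" and ?T = "resolvent_error (1 + h)"
  have m: "K \<le> m" "1 \<le> m" using n K step by auto
  have "N (?y (Suc m) - ?y m) = N (?T m) / real (Suc m)"
    by (simp add: N_R_mult del: of_nat_Suc)
  also have "\<dots> \<le> (D / real m) / real (Suc m)"
    unfolding D_def by (intro divide_right_mono N_resolvent_error h K m) simp
  also have "\<dots> = D / real m - D / real (Suc m)"
    using m by (simp add: field_simps)
  finally show ?case
    using step.IH N_triangle[of "?y (Suc m)" "?y n" "?y m"] by simp
qed simp

end

section \<open>Jointly complete families of seminorms\<close>

text \<open>The model is the free algebra with seminorms pulled back along a non-injective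
  evaluation. Limits, inverses and roots are therefore only asserted up to elements that are null in
  every seminorm.\<close>

locale cstar_family =
  fixes C :: "complex \<Rightarrow> 'x::ring_1" and st :: "'x \<Rightarrow> 'x" and L :: "'l set" and N :: "'l \<Rightarrow> 'x \<Rightarrow> real"
  assumes nonempty: "L \<noteq> {}"
    and seminorm: "l \<in> L \<Longrightarrow> cstar_seminormed_ring C st (N l)"
    and complete: "(\<And>l e. l \<in> L \<Longrightarrow> 0 < e \<Longrightarrow> \<exists>K. \<forall>m\<ge>K. \<forall>n\<ge>K. N l (X m - X n) < e)
      \<Longrightarrow> \<exists>a. \<forall>l\<in>L. (\<lambda>n. N l (X n - a)) \<longlonglongrightarrow> 0"
begin

text \<open>\<open>R\<close>, \<open>visser\<close> and \<open>resolvent_approx\<close> do not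
  involve the seminorm. An arbitrary index makes them and their algebraic laws available, and the
  interpretations for the individual \<open>l\<close> speak of the same constants.\<close>

sublocale base: cstar_seminormed_ring C st "N (SOME l. l \<in> L)"
  using nonempty by (intro seminorm) (simp add: some_in_eq)

lemma complete_half:
  assumes "\<And>l e. l \<in> L \<Longrightarrow> 0 < e \<Longrightarrow> \<exists>K. \<forall>n\<ge>K. \<forall>m\<ge>n. N l (X m - X n) < e"
  shows "\<exists>a. \<forall>l\<in>L. (\<lambda>n. N l (X n - a)) \<longlonglongrightarrow> 0"
proof (rule complete)
  fix l and e :: real assume l: "l \<in> L" and e: "0 < e"
  interpret l: cstar_seminormed_ring C st "N l" using l by (rule seminorm)
  obtain K where K: "\<And>n m. n \<ge> K \<Longrightarrow> m \<ge> n \<Longrightarrow> N l (X m - X n) < e"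
    using assms[OF l e] by blast
  then have "N l (X m - X n) < e" if "m \<ge> K" "n \<ge> K" for m n
    using that by (metis l.N_diff_commute nat_le_linear)
  then show "\<exists>K. \<forall>m\<ge>K. \<forall>n\<ge>K. N l (X m - X n) < e" by blast
qed

text \<open>A limit is determined only up to null elements and need not be self-adjoint. Its
  self-adjoint part is no farther from the self-adjoint \<open>X n\<close>.\<close>

lemma complete_selfadjoint:
  assumes "\<And>l e. l \<in> L \<Longrightarrow> 0 < e \<Longrightarrow> \<exists>K. \<forall>n\<ge>K. \<forall>m\<ge>n. N l (X m - X n) < e"
    and st: "\<And>n. st (X n) = X n"
  obtains a where "st a = a" "\<And>l. l \<in> L \<Longrightarrow> (\<lambda>n. N l (X n - a)) \<longlonglongrightarrow> 0"
proof -
  obtain b where b: "\<forall>l\<in>L. (\<lambda>n. N l (X n - b)) \<longlonglongrightarrow> 0"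
    using complete_half[of X] assms(1) by blast
  define a where "a = base.R (1/2) * (b + st b)"
  show ?thesis
  proof (rule that)
    show "st a = a"
      by (simp add: a_def base.st_add base.st_mult base.R_commute[of "b + st b"] add.commute)
    fix l assume l: "l \<in> L"
    interpret l: cstar_seminormed_ring C st "N l" using l by (rule seminorm)
    have "N l (X n - a) \<le> N l (X n - b)" for n
    proof -
      have "X n - a = base.R (1/2) * ((X n + X n) - (b + st b))"
        unfolding a_def right_diff_distrib by (simp only: base.R_half)
      also have "(X n + X n) - (b + st b) = (X n - b) + st (X n - b)"
        by (simp add: base.st_diff st)
      finally have "N l (X n - a) = N l ((X n - b) + st (X n - b)) / 2"
        by (simp only: l.N_R_mult)
      then show ?thesis using l.N_add[of "X n - b" "st (X n - b)"] by simp
    qed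
    then show "(\<lambda>n. N l (X n - a)) \<longlonglongrightarrow> 0"
      by (intro Lim_null_comparison[OF _ b[rule_format, OF l]]) simp
  qed
qed

text \<open>One sequence serves all seminorms. The index \<open>K\<close> from which it converges
  and the constant \<open>D\<close> of its rate D/n may vary with the seminorm, since
  \<open>h\<close> need not be bounded over the family.\<close>

lemma inverse_one_plus_pos:
  assumes "\<And>l. l \<in> L \<Longrightarrow> cstar_seminormed_ring.pos C st (N l) h"
  obtains r where "st r = r" "\<And>l. l \<in> L \<Longrightarrow> N l ((1 + h) * r - 1) = 0"
proof -
  define y where "y = base.resolvent_approx (1 + h)"
  have "base.pos h" using assms nonempty by (simp add: some_in_eq)
  then have sh: "st (1 + h) = 1 + h" by (simp add: base.pos_st base.st_add)
  have *: "\<exists>K D. 1 \<le> K \<and> 0 \<le> D \<and> (\<forall>n\<ge>K. N l (1 - (1 + h) * y n) \<le> D / real n \<and> (\<forall>m\<ge>n. N l (y m - y n) \<le> D / real n))"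
    if l: "l \<in> L" for l
  proof -
    interpret l: cstar_seminormed_ring C st "N l" using l by (rule seminorm)
    have h: "l.pos h" using assms l by simp
    obtain K where K: "max 1 (N l h) \<le> real K" using real_arch_simple by blast
    define D where "D = real K * N l (l.resolvent_error (1 + h) K)"
    have K': "N l h \<le> real K" "1 \<le> K" using K by auto
    have "N l (1 - (1 + h) * y n) \<le> D / real n" if "n \<ge> K" for n
      unfolding y_def D_def base.mult_resolvent_approx
      using l.N_resolvent_error[OF h K' that] by simp
    moreover have "N l (y m - y n) \<le> D / real n" if "n \<ge> K" "m \<ge> n" for m n
    proof -
      have "D \<ge> 0" by (simp add: D_def)
      then show ?thesis
        using l.N_resolvent_approx_diff[OF h K' that] unfolding y_def D_def
        by (smt (verit) divide_nonneg_nonneg of_nat_0_le_iff)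
    qed
    ultimately show ?thesis using K' by (intro exI[of _ K] exI[of _ D]) (auto simp: D_def)
  qed
  obtain r where r: "st r = r" "\<And>l. l \<in> L \<Longrightarrow> (\<lambda>n. N l (y n - r)) \<longlonglongrightarrow> 0"
  proof (rule complete_selfadjoint)
    show "st (y n) = y n" for n unfolding y_def by (rule base.st_resolvent_approx[OF sh])
    fix l and e :: real assume l: "l \<in> L" and e: "0 < e"
    obtain K D where KD: "1 \<le> K" "0 \<le> D" "\<And>n m. n \<ge> K \<Longrightarrow> m \<ge> n \<Longrightarrow> N l (y m - y n) \<le> D / real n"
      using *[OF l] by blast
    obtain M where M: "D / e < real M" using reals_Archimedean2 by blast
    have "N l (y m - y n) < e" if "n \<ge> max K M" "m \<ge> n" for m n
    proof -
      have "D / e < real n" "0 < real n" using M that KD by auto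
      then have "D / real n < e" using e by (simp add: field_simps)
      then show ?thesis using KD(3)[of n m] that by simp
    qed
    then show "\<exists>K. \<forall>n\<ge>K. \<forall>m\<ge>n. N l (y m - y n) < e" by blast
  qed blast
  show ?thesis
  proof (rule that[OF r(1)])
    fix l assume l: "l \<in> L"
    interpret l: cstar_seminormed_ring C st "N l" using l by (rule seminorm)
    obtain K D where KD: "\<And>n. n \<ge> K \<Longrightarrow> N l (1 - (1 + h) * y n) \<le> D / real n"
      using *[OF l] by blast
    show "N l ((1 + h) * r - 1) = 0"
    proof (rule null_if_bounded_by_null_sequence)
      show "(\<lambda>n. D / real n + N l (1 + h) * N l (y n - r)) \<longlonglongrightarrow> 0"
        using r(2)[OF l] lim_const_over_n by (auto intro!: tendsto_eq_intros)
      fix n assume "K \<le> n"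
      have "(1 + h) * r - 1 = - (1 - (1 + h) * y n) - (1 + h) * (y n - r)"
        by (simp add: algebra_simps)
      then have "N l ((1 + h) * r - 1) \<le> N l (1 - (1 + h) * y n) + N l ((1 + h) * (y n - r))"
        using l.N_diff[of "- (1 - (1 + h) * y n)" "(1 + h) * (y n - r)"] by (simp only: l.N_minus)
      then show "N l ((1 + h) * r - 1) \<le> D / real n + N l (1 + h) * N l (y n - r)"
        using KD[OF \<open>K \<le> n\<close>] l.N_mult[of "1 + h" "y n - r"] by linarith
    qed simp
  qed
qed

text \<open>As \<open>u\<close> is contractive in all seminorms at once, the scalar sequence
  \<open>visser_bound\<close> is a common modulus of convergence.\<close>

lemma sqrt_one_minus:
  assumes su: "st u = u" and Nu: "\<And>l. l \<in> L \<Longrightarrow> N l u \<le> 1"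
  obtains s where "st s = s" "\<And>l. l \<in> L \<Longrightarrow> N l (s * s - (1 - u)) = 0"
proof -
  define q where "q = base.visser u"
  obtain a where a: "st a = a" "\<And>l. l \<in> L \<Longrightarrow> (\<lambda>n. N l (q n - a)) \<longlonglongrightarrow> 0"
  proof (rule complete_selfadjoint)
    show "st (q n) = q n" for n unfolding q_def by (rule base.st_visser[OF su])
    fix l and e :: real assume l: "l \<in> L" and e: "0 < e"
    interpret l: cstar_seminormed_ring C st "N l" using l by (rule seminorm)
    obtain K where K: "\<And>m n. m \<ge> K \<Longrightarrow> n \<ge> K \<Longrightarrow> \<bar>visser_bound m - visser_bound n\<bar> < e"
      using convergent_visser_bound e unfolding Cauchy_convergent_iff[symmetric] Cauchy_def dist_real_def
      by blast
    have "N l (q m - q n) < e" if "n \<ge> K" "m \<ge> n" for m n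
      using l.N_visser_diff[OF Nu[OF l] that(2)] K[of m n] that unfolding q_def by simp
    then show "\<exists>K. \<forall>n\<ge>K. \<forall>m\<ge>n. N l (q m - q n) < e" by blast
  qed blast
  show ?thesis
  proof (rule that[of "1 - a"])
    show "st (1 - a) = 1 - a" by (simp add: base.st_diff a)
    fix l assume l: "l \<in> L"
    interpret l: cstar_seminormed_ring C st "N l" using l by (rule seminorm)
    define \<delta> where "\<delta> n = visser_bound (Suc n) - visser_bound n" for n
    define s where "s = 1 - a"
    have \<delta>: "\<delta> \<longlonglongrightarrow> 0" unfolding \<delta>_def by (rule visser_bound_step)
    show "N l ((1 - a) * (1 - a) - (1 - u)) = 0"
      unfolding s_def[symmetric]
    proof (rule null_if_bounded_by_null_sequence)
      show "(\<lambda>n. (N l s + 2) * N l (q n - a) + 2 * \<delta> n) \<longlonglongrightarrow> 0"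
        using a(2)[OF l] \<delta> by (auto intro!: tendsto_eq_intros)
      fix n :: nat assume "0 \<le> n"
      define t where "t = 1 - q n"
      define d where "d = q (Suc n) - q n"
      have tt: "t * t = (1 - u) + d + d"
        unfolding t_def q_def d_def by (rule base.visser_square)
      have eq: "s * s - (1 - u) = s * (s - t) + (s - t) * t + (d + d)"
        unfolding distrib_left right_diff_distrib left_diff_distrib tt by simp
      have st: "s - t = q n - a" by (simp add: s_def t_def)
      have "N l t \<le> 2"
        using l.N_diff[of 1 "q n"] l.N_1 l.N_visser_le_1[OF Nu[OF l], of n] by (simp add: t_def q_def)
      then have "N l ((s - t) * t) \<le> N l (q n - a) * 2"
        using l.N_mult[of "s - t" t] mult_left_mono[of "N l t" 2 "N l (q n - a)"] unfolding st by simp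
      moreover have "N l d \<le> \<delta> n"
        unfolding d_def q_def \<delta>_def by (rule l.N_visser_step[OF Nu[OF l]])
      moreover have "N l (s * (s - t)) \<le> N l s * N l (q n - a)"
        unfolding st by (rule l.N_mult)
      ultimately show "N l (s * s - (1 - u)) \<le> (N l s + 2) * N l (q n - a) + 2 * \<delta> n"
        unfolding eq distrib_right
        using l.N_add[of "s * (s - t) + (s - t) * t" "d + d"] l.N_add[of "s * (s - t)" "(s - t) * t"]
          l.N_add[of d d] by linarith
    qed simp
  qed
qed

text \<open>The square root of \<open>h\<close> is \<open>(r - r\<^sup>2)\<^sup>1\<^sup>/\<^sup>2 (1 + h)\<close> with \<open>r = (1 + h)\<^sup>-\<^sup>1\<close>; the first factor is bounded
  in all seminorms at once, so that one power series (in \<open>v = 1 - 2r\<close>) defines it.\<close>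

theorem sum_star_eq_star:
  fixes I :: "'i set"
  obtains d where "\<And>l. l \<in> L \<Longrightarrow> N l ((\<Sum>i\<in>I. st (c i) * c i) - st d * d) = 0"
proof -
  define h where "h = (\<Sum>i\<in>I. st (c i) * c i)"
  have pos: "cstar_seminormed_ring.pos C st (N l) h" if "l \<in> L" for l
    unfolding h_def by (rule cstar_seminormed_ring.pos_sum_star[OF seminorm[OF that]])
  obtain r where r: "st r = r" "\<And>l. l \<in> L \<Longrightarrow> N l ((1 + h) * r - 1) = 0"
    using inverse_one_plus_pos[OF pos] by blast
  define a where "a = 1 + h"
  have sa: "st a = a" by (simp add: a_def h_def base.st_add base.st_sum base.st_mult)
  have ar: "N l (a * r - 1) = 0" if "l \<in> L" for l using r(2)[OF that] by (simp add: a_def)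
  have ra: "N l (r * a - 1) = 0" if l: "l \<in> L" for l
  proof -
    interpret l: cstar_seminormed_ring C st "N l" using l by (rule seminorm)
    have "st (a * r - 1) = r * a - 1" by (simp add: base.st_diff base.st_mult r sa)
    then show ?thesis using ar[OF l] l.N_st by metis
  qed
  \<comment> \<open>Formally v = (h - 1)/(h + 1), so that 1 - v^2 = 4(r - r^2) = 4h/(1 +
    h)^2.\<close>
  define v where "v = 1 - (r + r)"
  have sv: "st v = v" by (simp add: v_def base.st_diff base.st_add r)
  \<comment> \<open>Since (1 + h)r = 1 up to null elements, v^2 + 4rhr = 1. The second term is a sum
    of squares, so monotonicity bounds v^2 by 1 in every seminorm; \<open>w\<close> collects the
    null error.\<close>
  have Nv: "N l v \<le> 1" if l: "l \<in> L" for l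
  proof -
    interpret l: cstar_seminormed_ring C st "N l" using l by (rule seminorm)
    define w where "w = r * (a * r - 1)"
    have w: "N l w = 0" unfolding w_def by (rule l.N_null_mult_left[OF ar[OF l]])
    have "st (c i * (r + r)) * (c i * (r + r)) = (r + r) * (st (c i) * c i) * (r + r)" for i
      by (simp add: base.st_mult base.st_add r mult.assoc)
    then have "(\<Sum>i\<in>I. st (c i * (r + r)) * (c i * (r + r))) = (r + r) * h * (r + r)"
      by (simp add: h_def sum_distrib_left sum_distrib_right)
    also have "\<dots> = 1 - v * v + (w + w + w + w)"
      by (simp add: v_def w_def a_def algebra_simps)
    finally have *: "st v * v + (\<Sum>i\<in>I. st (c i * (r + r)) * (c i * (r + r))) = 1 + (w + w + w + w)"
      by (simp add: sv)
    have "N l (st v * v) \<le> N l (1 + (w + w + w + w))"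
      unfolding *[symmetric] by (intro l.N_mono l.pos_star_mult) (simp add: l.pos_sum_star)
    also have "\<dots> = N l 1"
      using w l.N_null_add by metis
    finally have "(N l v)\<^sup>2 \<le> 1" using l.N_1 by (simp add: l.N_star)
    then show ?thesis by (simp add: power2_le_iff_abs_le[of 1 "N l v", simplified])
  qed
  have "st (v * v) = v * v" by (simp add: base.st_mult sv)
  moreover have "N l (v * v) \<le> 1" if l: "l \<in> L" for l
  proof -
    interpret l: cstar_seminormed_ring C st "N l" using l by (rule seminorm)
    show ?thesis using Nv[OF l] by (simp add: l.N_sq[OF sv] power_le_one)
  qed
  ultimately obtain s where s: "st s = s" "\<And>l. l \<in> L \<Longrightarrow> N l (s * s - (1 - v * v)) = 0"
    using sqrt_one_minus by blast
  define g where "g = base.R (1/2) * s"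
  define z where "z = s * s - (1 - v * v)"
  have gg: "g * g = (r - r * r) + base.R (1/4) * z"
  proof -
    have "g * g = base.R (1/4) * (s * s)" by (simp add: g_def base.R_mult_R_mult)
    also have "s * s = (r + r - (r * r + r * r)) + (r + r - (r * r + r * r)) + z"
      by (simp add: z_def v_def algebra_simps)
    also have "base.R (1/4) * \<dots> = (r - r * r) + base.R (1/4) * z"
    proof -
      have "base.R (1/4) * ((x + x) + (x + x)) = x" for x
      proof -
        have "base.R (1/4) * ((x + x) + (x + x)) = (base.R (1/4) + base.R (1/4) + base.R (1/4) + base.R (1/4)) * x"
          by (simp add: algebra_simps)
        also have "base.R (1/4) + base.R (1/4) + base.R (1/4) + base.R (1/4) = base.R 1"
          by (simp only: base.R_add[symmetric]) simp
        finally show ?thesis by simp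
      qed
      from this[of "r - r * r"] show ?thesis by (simp add: algebra_simps)
    qed
    finally show ?thesis .
  qed
  have sg: "st g = g" by (simp add: g_def base.st_mult s base.R_commute[of s])
  show ?thesis
  \<comment> \<open>With g^2 = r - r^2 and ar = ra = 1 up to null elements, the square of
    \<open>g * a\<close> is a(r - r^2)a = a - 1 = h.\<close>
  proof (rule that[of "g * a"])
    fix l assume l: "l \<in> L"
    interpret l: cstar_seminormed_ring C st "N l" using l by (rule seminorm)
    have "st (g * a) * (g * a) = a * (g * g) * a" by (simp add: base.st_mult sg sa mult.assoc)
    also have "\<dots> = a * (r - r * r) * a + a * (base.R (1/4) * z) * a"
      unfolding gg by (simp add: algebra_simps)
    also have "a * (r - r * r) * a = h + (a * r - 1) * (a - r * a) - (r * a - 1)"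
      by (simp add: a_def algebra_simps)
    finally have eq: "h - st (g * a) * (g * a)
        = (r * a - 1) + (- ((a * r - 1) * (a - r * a)) - a * (base.R (1/4) * z) * a)"
      by simp
    have "N l ((a * r - 1) * (a - r * a)) = 0"
      by (rule l.N_null_mult_right[OF ar[OF l]])
    moreover have "N l (a * (base.R (1/4) * z) * a) = 0"
      using s(2)[OF l] by (intro l.N_null_mult_right l.N_null_mult_left) (simp add: z_def)
    ultimately have "N l (h - st (g * a) * (g * a)) \<le> 0"
      unfolding eq using ra[OF l] l.N_add[of "r * a - 1" "- ((a * r - 1) * (a - r * a)) - a * (base.R (1/4) * z) * a"]
        l.N_diff[of "- ((a * r - 1) * (a - r * a))" "a * (base.R (1/4) * z) * a"]
        l.N_minus[of "(a * r - 1) * (a - r * a)"]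
      by linarith
    then show "N l ((\<Sum>i\<in>I. st (c i) * c i) - st (g * a) * (g * a)) = 0"
      using l.N_nonneg[of "h - st (g * a) * (g * a)"] unfolding h_def by linarith
  qed
qed

end

section \<open>Matrices over a seminormed ring\<close>

text \<open>Matrices and columns are total functions in this section, and only their values at
  indices below \<open>k\<close> are read.\<close>

definition mat_vec :: "nat \<Rightarrow> (nat \<Rightarrow> nat \<Rightarrow> 'x::ring_1) \<Rightarrow> (nat \<Rightarrow> 'x) \<Rightarrow> nat \<Rightarrow> 'x" where
  "mat_vec k m v i = (\<Sum>j<k. m i j * v j)"

definition mmul :: "nat \<Rightarrow> (nat \<Rightarrow> nat \<Rightarrow> 'x::ring_1) \<Rightarrow> (nat \<Rightarrow> nat \<Rightarrow> 'x) \<Rightarrow> nat \<Rightarrow> nat \<Rightarrow> 'x" where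
  "mmul k m n i j = (\<Sum>r<k. m i r * n r j)"

definition madj :: "('x \<Rightarrow> 'x) \<Rightarrow> (nat \<Rightarrow> nat \<Rightarrow> 'x) \<Rightarrow> nat \<Rightarrow> nat \<Rightarrow> 'x" where
  "madj st m i j = st (m j i)"

lemma mat_vec_mmul: "mat_vec k (mmul k m n) v = mat_vec k m (mat_vec k n v)"
proof
  fix i
  have "mat_vec k (mmul k m n) v i = (\<Sum>j<k. \<Sum>r<k. m i r * n r j * v j)"
    by (simp add: mat_vec_def mmul_def sum_distrib_right)
  also have "\<dots> = (\<Sum>r<k. \<Sum>j<k. m i r * n r j * v j)" by (rule sum.swap)
  also have "\<dots> = mat_vec k m (mat_vec k n v) i"
    by (simp add: mat_vec_def sum_distrib_left mult.assoc)
  finally show "mat_vec k (mmul k m n) v i = mat_vec k m (mat_vec k n v) i" .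
qed

lemma mmul_assoc: "mmul k (mmul k l m) n = mmul k l (mmul k m n)"
proof (intro ext)
  fix i j
  show "mmul k (mmul k l m) n i j = mmul k l (mmul k m n) i j"
    using fun_cong[OF mat_vec_mmul[of k l m "\<lambda>r. n r j"], of i]
    by (simp add: mat_vec_def mmul_def)
qed

section \<open>The operator norm and its C*-identity\<close>

context cstar_seminormed_ring
begin

definition cnorm :: "nat \<Rightarrow> (nat \<Rightarrow> 'x) \<Rightarrow> real" where
  "cnorm k v = sqrt (N (gram {..<k} v v))"

definition opnorm :: "nat \<Rightarrow> (nat \<Rightarrow> nat \<Rightarrow> 'x) \<Rightarrow> real" where
  "opnorm k m = (SUP v\<in>{v. cnorm k v \<le> 1}. cnorm k (mat_vec k m v))"

lemma cnorm_nonneg [simp]: "0 \<le> cnorm k v"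
  by (simp add: cnorm_def)

lemma cnorm_square: "(cnorm k v)\<^sup>2 = N (gram {..<k} v v)"
  by (simp add: cnorm_def)

lemma cnorm_add: "cnorm k (\<lambda>i. v i + w i) \<le> cnorm k v + cnorm k w"
  unfolding cnorm_def by (rule sqrt_N_gram_triangle)

lemma C_mult_C_mult: "(C c * x) * (C d * y) = C (c * d) * (x * y)"
  by (metis C_C_mult C_left_commute mult.assoc)

lemma cnorm_C: "cnorm k (\<lambda>i. C c * v i) = cmod c * cnorm k v"
proof (rule power2_eq_imp_eq)
  have "st (C c * v i) * (C c * v i) = C (cnj c * c) * (st (v i) * v i)" for i
    by (simp add: st_mult C_commute[of "st (v i)"] C_mult_C_mult)
  then have "gram {..<k} (\<lambda>i. C c * v i) (\<lambda>i. C c * v i) = C (cnj c * c) * gram {..<k} v v"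
    by (simp add: gram_def sum_distrib_left)
  then show "(cnorm k (\<lambda>i. C c * v i))\<^sup>2 = (cmod c * cnorm k v)\<^sup>2"
    unfolding power_mult_distrib cnorm_square by (simp add: N_C_mult norm_mult) (simp add: power2_eq_square)
qed auto

lemma N_le_cnorm: "i < k \<Longrightarrow> N (v i) \<le> cnorm k v"
  unfolding cnorm_def gram_def by (intro real_le_rsqrt N_square_le_sum_star) auto

lemma cnorm_le_sum: "cnorm k v \<le> (\<Sum>i<k. N (v i))"
proof -
  have "N (gram {..<k} v v) \<le> (\<Sum>i<k. (N (v i))\<^sup>2)"
    unfolding gram_def using N_sum[of "\<lambda>i. st (v i) * v i" "{..<k}"] by (simp add: N_star)
  then have "cnorm k v \<le> L2_set (\<lambda>i. N (v i)) {..<k}" by (simp add: cnorm_def L2_set_def)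
  also have "\<dots> \<le> (\<Sum>i<k. N (v i))" by (intro L2_set_le_sum) simp
  finally show ?thesis .
qed

lemma N_gram_le: "N (gram {..<k} v w) \<le> cnorm k v * cnorm k w"
proof (rule power2_le_imp_le)
  show "(N (gram {..<k} v w))\<^sup>2 \<le> (cnorm k v * cnorm k w)\<^sup>2"
    unfolding power_mult_distrib cnorm_square by (rule Cauchy_Schwarz)
qed simp

text \<open>A crude bound with two uses: the supremum in \<open>opnorm\<close> is finite, and
  columns of norm 0 are mapped to columns of norm 0.\<close>

lemma cnorm_mat_vec_le_sum: "cnorm k (mat_vec k m v) \<le> (\<Sum>i<k. \<Sum>j<k. N (m i j)) * cnorm k v"
proof -
  have "N (mat_vec k m v i) \<le> (\<Sum>j<k. N (m i j)) * cnorm k v" for i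
  proof -
    have "N (mat_vec k m v i) \<le> (\<Sum>j<k. N (m i j * v j))" unfolding mat_vec_def by (rule N_sum)
    also have "\<dots> \<le> (\<Sum>j<k. N (m i j) * cnorm k v)"
    proof (rule sum_mono)
      fix j assume "j \<in> {..<k}"
      then have "N (m i j) * N (v j) \<le> N (m i j) * cnorm k v"
        by (intro mult_left_mono N_le_cnorm) auto
      then show "N (m i j * v j) \<le> N (m i j) * cnorm k v" using N_mult order_trans by blast
    qed
    finally show ?thesis by (simp add: sum_distrib_right)
  qed
  then have "(\<Sum>i<k. N (mat_vec k m v i)) \<le> (\<Sum>i<k. (\<Sum>j<k. N (m i j)) * cnorm k v)"
    by (intro sum_mono)
  then show ?thesis using cnorm_le_sum[of k "mat_vec k m v"] by (simp add: sum_distrib_right)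
qed

lemma opnorm_bdd: "bdd_above ((\<lambda>v. cnorm k (mat_vec k m v)) ` {v. cnorm k v \<le> 1})"
proof (rule bdd_aboveI2)
  fix v assume v: "v \<in> {v. cnorm k v \<le> 1}"
  have "0 \<le> (\<Sum>i<k. \<Sum>j<k. N (m i j))" by (intro sum_nonneg) auto
  then have "(\<Sum>i<k. \<Sum>j<k. N (m i j)) * cnorm k v \<le> (\<Sum>i<k. \<Sum>j<k. N (m i j)) * 1"
    using v by (intro mult_left_mono) auto
  then show "cnorm k (mat_vec k m v) \<le> (\<Sum>i<k. \<Sum>j<k. N (m i j))"
    using cnorm_mat_vec_le_sum[of k m v] by simp
qed

lemma cnorm_0: "cnorm k (\<lambda>i. 0) = 0"
  by (simp add: cnorm_def gram_def)

lemma opnorm_leI: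
  assumes "\<And>v. cnorm k v \<le> 1 \<Longrightarrow> cnorm k (mat_vec k m v) \<le> c"
  shows "opnorm k m \<le> c"
  unfolding opnorm_def using assms cnorm_0 by (intro cSUP_least) (auto intro!: exI[of _ "\<lambda>i. 0"])

lemma opnorm_upper: "cnorm k v \<le> 1 \<Longrightarrow> cnorm k (mat_vec k m v) \<le> opnorm k m"
  unfolding opnorm_def using opnorm_bdd by (intro cSUP_upper) auto

lemma opnorm_nonneg: "0 \<le> opnorm k m"
  by (rule order_trans[OF cnorm_nonneg opnorm_upper[of k "\<lambda>i. 0"]]) (simp add: cnorm_0)

lemma mat_vec_C: "mat_vec k m (\<lambda>i. C c * v i) = (\<lambda>i. C c * mat_vec k m v i)"
  by (rule ext) (simp add: mat_vec_def sum_distrib_left C_left_commute)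

lemma cnorm_mat_vec_le: "cnorm k (mat_vec k m v) \<le> opnorm k m * cnorm k v"
proof (cases "cnorm k v = 0")
  case True
  then show ?thesis using cnorm_mat_vec_le_sum[of k m v] by simp
next
  case False
  then have pos: "0 < cnorm k v" using cnorm_nonneg[of k v] by linarith
  define c where "c = complex_of_real (1 / cnorm k v)"
  have c: "cmod c = 1 / cnorm k v" using pos by (simp add: c_def norm_divide)
  have "cnorm k (mat_vec k m (\<lambda>i. C c * v i)) \<le> opnorm k m"
    using pos by (intro opnorm_upper) (simp add: cnorm_C c)
  then show ?thesis using pos unfolding mat_vec_C cnorm_C c by (simp add: field_simps)
qed

lemma opnorm_le_sum: "opnorm k m \<le> (\<Sum>i<k. \<Sum>j<k. N (m i j))"
proof (rule opnorm_leI)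
  fix v assume "cnorm k v \<le> 1"
  moreover have "0 \<le> (\<Sum>i<k. \<Sum>j<k. N (m i j))" by (intro sum_nonneg) auto
  ultimately have "(\<Sum>i<k. \<Sum>j<k. N (m i j)) * cnorm k v \<le> (\<Sum>i<k. \<Sum>j<k. N (m i j)) * 1"
    by (intro mult_left_mono) auto
  then show "cnorm k (mat_vec k m v) \<le> (\<Sum>i<k. \<Sum>j<k. N (m i j))"
    using cnorm_mat_vec_le_sum[of k m v] by simp
qed

text \<open>Evaluation at a standard basis column. Together with \<open>opnorm_le_sum\<close> it
  describes null matrices, Cauchy sequences and limits entry by entry.\<close>

lemma N_le_opnorm:
  assumes "i < k" "j < k"
  shows "N (m i j) \<le> opnorm k m"
proof -
  define e where "e r = (if r = j then 1 else 0 :: 'x)" for r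
  have "gram {..<k} e e = (\<Sum>r<k. if r = j then 1 else 0)"
    unfolding gram_def e_def by (intro sum.cong) auto
  then have "gram {..<k} e e = 1" using assms by simp
  then have "cnorm k e \<le> 1" using N_1 by (simp add: cnorm_def)
  moreover have "mat_vec k m e i = (\<Sum>r<k. if r = j then m i r else 0)"
    unfolding mat_vec_def e_def by (intro sum.cong) auto
  ultimately show ?thesis
    using assms N_le_cnorm[OF assms(1), of "mat_vec k m e"] opnorm_upper[of k e m] by simp
qed

lemma opnorm_eq_0_iff: "opnorm k m = 0 \<longleftrightarrow> (\<forall>i<k. \<forall>j<k. N (m i j) = 0)"
proof
  assume 0: "opnorm k m = 0"
  show "\<forall>i<k. \<forall>j<k. N (m i j) = 0"
  proof (intro allI impI)
    fix i j assume "i < k" "j < k"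
    then have "N (m i j) \<le> opnorm k m" by (rule N_le_opnorm)
    then show "N (m i j) = 0" using 0 by (intro order_antisym) auto
  qed
next
  assume "\<forall>i<k. \<forall>j<k. N (m i j) = 0"
  then show "opnorm k m = 0"
    using opnorm_le_sum[of k m] opnorm_nonneg[of k m] by simp
qed

lemma opnorm_add: "opnorm k (\<lambda>i j. m i j + n i j) \<le> opnorm k m + opnorm k n"
proof (rule opnorm_leI)
  fix v assume v: "cnorm k v \<le> 1"
  have "mat_vec k (\<lambda>i j. m i j + n i j) v = (\<lambda>i. mat_vec k m v i + mat_vec k n v i)"
    by (rule ext) (simp add: mat_vec_def distrib_right sum.distrib)
  then show "cnorm k (mat_vec k (\<lambda>i j. m i j + n i j) v) \<le> opnorm k m + opnorm k n"
    using cnorm_add[of k "mat_vec k m v" "mat_vec k n v"] opnorm_upper[OF v, of m] opnorm_upper[OF v, of n]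
    by simp
qed

lemma opnorm_C_le: "opnorm k (\<lambda>i j. C c * m i j) \<le> cmod c * opnorm k m"
proof (rule opnorm_leI)
  fix v assume v: "cnorm k v \<le> 1"
  have "mat_vec k (\<lambda>i j. C c * m i j) v = (\<lambda>i. C c * mat_vec k m v i)"
    by (rule ext) (simp add: mat_vec_def mult.assoc sum_distrib_left)
  then show "cnorm k (mat_vec k (\<lambda>i j. C c * m i j) v) \<le> cmod c * opnorm k m"
    using opnorm_upper[OF v, of m] by (simp add: cnorm_C mult_left_mono)
qed

lemma opnorm_C: "opnorm k (\<lambda>i j. C c * m i j) = cmod c * opnorm k m"
proof (cases "c = 0")
  case True
  then show ?thesis using opnorm_eq_0_iff[of k "\<lambda>i j. 0"] by simp
next
  case False
  have "opnorm k m = opnorm k (\<lambda>i j. C (1 / c) * (C c * m i j))"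
    using False by (simp add: C_C_mult)
  also have "\<dots> \<le> cmod (1 / c) * opnorm k (\<lambda>i j. C c * m i j)" by (rule opnorm_C_le)
  finally have "cmod c * opnorm k m \<le> opnorm k (\<lambda>i j. C c * m i j)"
    using False by (simp add: norm_divide field_simps)
  then show ?thesis using opnorm_C_le[of k c m] by simp
qed

lemma opnorm_mmul: "opnorm k (mmul k m n) \<le> opnorm k m * opnorm k n"
proof (rule opnorm_leI)
  fix v assume v: "cnorm k v \<le> 1"
  have "cnorm k (mat_vec k m (mat_vec k n v)) \<le> opnorm k m * cnorm k (mat_vec k n v)" by (rule cnorm_mat_vec_le)
  also have "\<dots> \<le> opnorm k m * opnorm k n"
    using opnorm_upper[OF v] by (intro mult_left_mono opnorm_nonneg)
  finally show "cnorm k (mat_vec k (mmul k m n) v) \<le> opnorm k m * opnorm k n" by (simp add: mat_vec_mmul)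
qed

lemma gram_mat_vec: "gram {..<k} (mat_vec k m v) w = gram {..<k} v (mat_vec k (madj st m) w)"
proof -
  have "gram {..<k} (mat_vec k m v) w = (\<Sum>i<k. \<Sum>j<k. st (v j) * st (m i j) * w i)"
    by (simp add: gram_def mat_vec_def st_sum st_mult sum_distrib_right)
  also have "\<dots> = (\<Sum>j<k. \<Sum>i<k. st (v j) * st (m i j) * w i)" by (rule sum.swap)
  also have "\<dots> = gram {..<k} v (mat_vec k (madj st m) w)"
    by (simp add: gram_def mat_vec_def madj_def sum_distrib_left mult.assoc)
  finally show ?thesis .
qed

text \<open>The squared norm of \<open>mat_vec k m v\<close> is the seminorm of the inner product of
  \<open>v\<close> with its image under \<open>mmul k (madj st m) m\<close>; the Cauchy-Schwarz
  inequality finishes.\<close>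

lemma opnorm_square_le: "(opnorm k m)\<^sup>2 \<le> opnorm k (mmul k (madj st m) m)"
proof -
  have "opnorm k m \<le> sqrt (opnorm k (mmul k (madj st m) m))"
  proof (rule opnorm_leI)
    fix v assume v: "cnorm k v \<le> 1"
    have "(cnorm k (mat_vec k m v))\<^sup>2 = N (gram {..<k} v (mat_vec k (mmul k (madj st m) m) v))"
      by (simp add: cnorm_square gram_mat_vec mat_vec_mmul)
    also have "\<dots> \<le> cnorm k v * cnorm k (mat_vec k (mmul k (madj st m) m) v)" by (rule N_gram_le)
    also have "\<dots> \<le> 1 * opnorm k (mmul k (madj st m) m)"
      using v opnorm_upper[OF v] by (intro mult_mono) auto
    finally show "cnorm k (mat_vec k m v) \<le> sqrt (opnorm k (mmul k (madj st m) m))"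
      by (simp add: real_le_rsqrt)
  qed
  then have "(opnorm k m)\<^sup>2 \<le> (sqrt (opnorm k (mmul k (madj st m) m)))\<^sup>2"
    using opnorm_nonneg by (rule power_mono)
  then show ?thesis using opnorm_nonneg by simp
qed

lemma opnorm_madj_le: "opnorm k m \<le> opnorm k (madj st m)"
proof (cases "opnorm k m = 0")
  case False
  then have "0 < opnorm k m" using opnorm_nonneg[of k m] by linarith
  moreover have "opnorm k m * opnorm k m \<le> opnorm k (madj st m) * opnorm k m"
    using opnorm_square_le[of k m] opnorm_mmul[of k "madj st m" m] by (simp add: power2_eq_square)
  ultimately show ?thesis by simp
qed (simp add: opnorm_nonneg)

lemma opnorm_star: "opnorm k (mmul k (madj st m) m) = (opnorm k m)\<^sup>2"
proof -
  have "madj st (madj st m) = m" by (simp add: madj_def fun_eq_iff)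
  then have "opnorm k (madj st m) \<le> opnorm k m" using opnorm_madj_le[of k "madj st m"] by simp
  then have "opnorm k (madj st m) * opnorm k m \<le> opnorm k m * opnorm k m"
    by (intro mult_right_mono opnorm_nonneg)
  then show ?thesis
    using opnorm_square_le[of k m] opnorm_mmul[of k "madj st m" m] by (simp add: power2_eq_square)
qed

end

section \<open>The free algebra over a locally C*-algebra\<close>

text \<open>A wrapper around lists that makes concatenation the addition of a
  \<open>monoid_add\<close>. Finitely supported functions on such a monoid multiply by convolution,
  which turns \<open>free_algebra\<close> into a \<open>ring_1\<close>.\<close>

datatype 'a word = Word "'a list"

instantiation word :: (type) monoid_add
begin

definition zero_word :: "'a word" where "0 = Word []"

fun plus_word :: "'a word \<Rightarrow> 'a word \<Rightarrow> 'a word" where "Word v + Word w = Word (v @ w)"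

instance
proof
  fix a b c :: "'a word"
  show "a + b + c = a + (b + c)" by (cases a; cases b; cases c) simp
  show "0 + a = a" by (cases a) (simp add: zero_word_def)
  show "a + 0 = a" by (cases a) (simp add: zero_word_def)
qed

end

type_synonym 'a free_algebra = "'a word \<Rightarrow>\<^sub>0 complex"

lemma free_algebra_induct [case_names zero single add]:
  fixes f :: "'a free_algebra"
  assumes "P 0" "\<And>w c. P (Poly_Mapping.single w c)" "\<And>f g. P f \<Longrightarrow> P g \<Longrightarrow> P (f + g)"
  shows "P f"
proof (induction f rule: Poly_Mapping.update_induct)
  case const
  show ?case by (rule assms)
next
  case (update f a b)
  have "Poly_Mapping.update a b f = f + Poly_Mapping.single a b"
    using update.hyps(1)
    by (intro poly_mapping_eqI) (auto simp: lookup_update lookup_add lookup_single when_def in_keys_iff)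
  then show ?case using update assms by simp
qed

primrec wstar :: "('a \<Rightarrow> 'a) \<Rightarrow> 'a word \<Rightarrow> 'a word" where
  "wstar s (Word w) = Word (rev (map s w))"

definition fstar :: "('a \<Rightarrow> 'a) \<Rightarrow> 'a free_algebra \<Rightarrow> 'a free_algebra" where
  "fstar s f = (\<Sum>w\<in>Poly_Mapping.keys f. Poly_Mapping.single (wstar s w) (cnj (Poly_Mapping.lookup f w)))"

lemma fstar_0 [simp]: "fstar s 0 = 0"
  by (simp add: fstar_def)

lemma fstar_add: "fstar s (f + g) = fstar s f + fstar s g"
  unfolding fstar_def by (rule setsum_keys_plus_distrib) (simp_all add: single_add)

lemma fstar_single: "fstar s (Poly_Mapping.single w c) = Poly_Mapping.single (wstar s w) (cnj c)"
  by (simp add: fstar_def)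

lemma wstar_add: "wstar s (v + w) = wstar s w + wstar s v"
  by (cases v; cases w) simp

lemma fstar_mult: "fstar s (f * g) = fstar s g * fstar s f"
proof (induction f rule: free_algebra_induct)
  case (single w c)
  show ?case
    by (induction g rule: free_algebra_induct)
      (simp_all add: fstar_single fstar_add mult_single wstar_add distrib_left distrib_right mult.commute)
qed (simp_all add: fstar_add distrib_left distrib_right)

lemma fstar_fstar:
  assumes "\<And>a. s (s a) = a"
  shows "fstar s (fstar s f) = f"
proof (induction f rule: free_algebra_induct)
  case (single w c)
  have "map (s \<circ> s) v = v" for v using assms by (simp add: map_idI)
  then show ?case by (cases w) (simp add: fstar_single rev_map)
qed (simp_all add: fstar_add)

definition fconst :: "complex \<Rightarrow> 'a free_algebra" where
  "fconst c = Poly_Mapping.single 0 c"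

lemma fconst_commute: "f * fconst c = fconst c * f"
  by (induction f rule: free_algebra_induct)
    (simp_all add: fconst_def mult_single distrib_left distrib_right mult.commute)

definition gen :: "'a \<Rightarrow> 'a free_algebra" where
  "gen a = Poly_Mapping.single (Word [a]) 1"

lemma fconst_add: "fconst (c + d) = fconst c + fconst d"
  and fconst_mult: "fconst (c * d) = fconst c * fconst d"
  and fconst_1: "fconst 1 = 1"
  and fstar_fconst: "fstar s (fconst c) = fconst (cnj c)"
  by (simp_all add: fconst_def single_add mult_single fstar_single) (simp add: zero_word_def)

lemma (in abelian_monoid) finsum_mono_neutral_left:
  assumes "finite K" "I \<subseteq> K" "\<And>i. i \<in> K - I \<Longrightarrow> f i = \<zero>" "f \<in> K \<rightarrow> carrier G"
  shows "finsum G f I = finsum G f K"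
  using assms by (intro add.finprod_mono_neutral_cong_left) auto

section \<open>Evaluation of the free algebra\<close>

context unital_star_algebra
begin

text \<open>The unqualified facts of \<^locale>\<open>ring\<close> refer to \<^const>\<open>complex_ring\<close> in this locale.\<close>

lemma alg_ring: "ring A" ..

lemma alg_abelian_group: "abelian_group A" ..

lemma alg_abelian_monoid: "abelian_monoid A" ..

lemmas alg_assoc = monoid.m_assoc[OF ringE(2)[OF alg_ring]]
  and alg_l_distr = ringE(3)[OF alg_ring]
  and alg_r_distr = ringE(4)[OF alg_ring]

lemma smult_closed' [simp]: "x \<in> carrier A \<Longrightarrow> c \<odot> x \<in> carrier A"
  using smult_closed[of c x] by (simp add: complex_ring_def)

lemma smult_add_left: "x \<in> carrier A \<Longrightarrow> (c + d) \<odot> x = c \<odot> x \<oplus> d \<odot> x"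
  using smult_l_distr[of c d x] by (simp add: complex_ring_def)

lemma smult_mult: "x \<in> carrier A \<Longrightarrow> (c * d) \<odot> x = c \<odot> (d \<odot> x)"
  using smult_assoc1[of c d x] by (simp add: complex_ring_def)

lemma smult_1: "x \<in> carrier A \<Longrightarrow> 1 \<odot> x = x"
  using smult_one[of x] by (simp add: complex_ring_def)

lemma smult_0: "x \<in> carrier A \<Longrightarrow> 0 \<odot> x = \<zero>"
  using smult_l_null[of x] by (simp add: complex_ring_def)

lemma smult_zero: "c \<odot> \<zero> = \<zero>"
  using smult_r_null[of c] by (simp add: complex_ring_def)

lemma star_one: "star A \<one> = \<one>"
  using star_mult[of "star A \<one>" \<one>] by (simp add: star_closed star_star)

lemma star_zero: "star A \<zero> = \<zero>"
  using star_smult[of \<zero> 0] by (simp add: smult_zero smult_0 star_closed)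

text \<open>Extended by the identity off the carrier, since \<open>fstar_fstar\<close> asks for an
  involution of the whole type.\<close>

definition total_star :: "'a \<Rightarrow> 'a" where
  "total_star a = (if a \<in> carrier A then star A a else a)"

lemma total_star_total_star: "total_star (total_star a) = a"
  by (simp add: total_star_def star_closed star_star)

text \<open>Letters off the carrier evaluate to zero. Zero is fixed by the star, so
  \<open>letter_total_star\<close> holds for every letter.\<close>

definition letter :: "'a \<Rightarrow> 'a" where
  "letter a = (if a \<in> carrier A then a else \<zero>)"

lemma letter_closed [simp]: "letter a \<in> carrier A"
  by (simp add: letter_def)

lemma letter_total_star: "letter (total_star a) = star A (letter a)"
  by (simp add: letter_def total_star_def star_closed star_zero)

primrec word_eval :: "'a word \<Rightarrow> 'a" where
  "word_eval (Word w) = foldr (\<lambda>a x. letter a \<otimes> x) w \<one>"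

lemma word_eval_closed [simp]: "word_eval w \<in> carrier A"
proof -
  have "foldr (\<lambda>a x. letter a \<otimes> x) v \<one> \<in> carrier A" for v by (induction v) auto
  then show ?thesis by (cases w) simp
qed

lemma word_eval_0 [simp]: "word_eval 0 = \<one>"
  by (simp add: zero_word_def)

lemma word_eval_Cons: "word_eval (Word (a # w)) = letter a \<otimes> word_eval (Word w)"
  by simp

lemma word_eval_append: "word_eval (Word (v @ w)) = word_eval (Word v) \<otimes> word_eval (Word w)"
proof (induction v)
  case Nil
  show ?case using word_eval_closed[of "Word w"] by simp
next
  case (Cons a v)
  have "word_eval (Word ((a # v) @ w)) = letter a \<otimes> (word_eval (Word v) \<otimes> word_eval (Word w))"
    unfolding append_Cons word_eval_Cons Cons.IH ..
  also have "\<dots> = (letter a \<otimes> word_eval (Word v)) \<otimes> word_eval (Word w)"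
    by (rule alg_assoc[symmetric]) (rule letter_closed word_eval_closed)+
  finally show ?case unfolding word_eval_Cons .
qed

lemma word_eval_add: "word_eval (v + w) = word_eval v \<otimes> word_eval w"
  by (cases v; cases w) (simp only: plus_word.simps word_eval_append)

lemma word_eval_wstar: "word_eval (wstar total_star w) = star A (word_eval w)"
proof -
  have "word_eval (Word (rev (map total_star v))) = star A (word_eval (Word v))" for v
  proof (induction v)
    case Nil
    show ?case by (simp add: star_one)
  next
    case (Cons a v)
    have "word_eval (Word (rev (map total_star (a # v))))
        = star A (word_eval (Word v)) \<otimes> word_eval (Word [total_star a])"
      by (simp only: list.map rev.simps word_eval_append Cons.IH)
    also have "word_eval (Word [total_star a]) = star A (letter a)"
      by (simp add: letter_total_star star_closed)
    finally show ?case unfolding word_eval_Cons by (simp only: star_mult letter_closed word_eval_closed)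
  qed
  then show ?thesis by (cases w) simp
qed

text \<open>The canonical star-homomorphism of the free algebra onto the carrier, with
  \<open>gen\<close> as a right inverse there.\<close>

definition ev :: "'a free_algebra \<Rightarrow> 'a" where
  "ev f = (\<Oplus>w\<in>Poly_Mapping.keys f. Poly_Mapping.lookup f w \<odot> word_eval w)"

lemma ev_closed [simp]: "ev f \<in> carrier A"
  unfolding ev_def by (rule abelian_monoid.finsum_closed[OF alg_abelian_monoid]) auto

lemma ev_eq_finsum:
  assumes "finite K" "Poly_Mapping.keys f \<subseteq> K"
  shows "ev f = (\<Oplus>w\<in>K. Poly_Mapping.lookup f w \<odot> word_eval w)"
  unfolding ev_def using assms
  by (intro abelian_monoid.finsum_mono_neutral_left[OF alg_abelian_monoid]) (auto simp: in_keys_iff smult_0)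

lemma ev_add: "ev (f + g) = ev f \<oplus> ev g"
proof -
  let ?K = "Poly_Mapping.keys f \<union> Poly_Mapping.keys g"
  have "ev (f + g) = (\<Oplus>w\<in>?K. Poly_Mapping.lookup f w \<odot> word_eval w \<oplus> Poly_Mapping.lookup g w \<odot> word_eval w)"
    by (subst ev_eq_finsum[of ?K]) (auto simp: Poly_Mapping.keys_add lookup_add smult_add_left)
  also have "\<dots> = ev f \<oplus> ev g"
    by (subst abelian_monoid.finsum_addf[OF alg_abelian_monoid]) (auto simp: ev_eq_finsum[of ?K])
  finally show ?thesis .
qed

lemma ev_0 [simp]: "ev 0 = \<zero>"
  by (simp add: ev_def)

lemma ev_single: "ev (Poly_Mapping.single w c) = c \<odot> word_eval w"
proof -
  have "ev (Poly_Mapping.single w c) = (\<Oplus>v\<in>{w}. Poly_Mapping.lookup (Poly_Mapping.single w c) v \<odot> word_eval v)"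
    by (rule ev_eq_finsum) auto
  then show ?thesis by simp
qed

lemma ev_mult: "ev (f * g) = ev f \<otimes> ev g"
proof (induction f rule: free_algebra_induct)
  case (single w c)
  show ?case
  proof (induction g rule: free_algebra_induct)
    case (single v d)
    show ?case
      by (simp add: mult_single ev_single word_eval_add smult_mult_left smult_mult_right mult.commute
          flip: smult_mult)
  qed (simp_all add: distrib_left ev_add alg_r_distr)
qed (simp_all add: distrib_right ev_add alg_l_distr)

lemma ev_fstar: "ev (fstar total_star f) = star A (ev f)"
  by (induction f rule: free_algebra_induct)
    (simp_all add: fstar_add ev_add fstar_single ev_single word_eval_wstar star_smult star_add star_zero)

lemma ev_gen: "a \<in> carrier A \<Longrightarrow> ev (gen a) = a"
  by (simp add: gen_def ev_single letter_def smult_1)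

lemma ev_fconst_mult: "ev (fconst c * f) = c \<odot> ev f"
  by (simp add: ev_mult fconst_def ev_single smult_mult_left)

lemma ev_1 [simp]: "ev 1 = \<one>"
  using ev_single[of 0 1] by (simp add: smult_1)

lemma ev_minus: "ev (- f) = \<ominus> ev f"
proof -
  have "ev (- f) \<oplus> ev f = \<zero>" using ev_add[of "- f" f] by simp
  from abelian_group.minus_equality[OF alg_abelian_group this] show ?thesis by simp
qed

lemma ev_diff: "ev (f - g) = ev f \<ominus> ev g"
  using ev_add[of f "- g"] by (simp add: ev_minus abelian_group.minus_eq[OF alg_abelian_group])

lemma ev_sum: "finite I \<Longrightarrow> ev (sum f I) = (\<Oplus>i\<in>I. ev (f i))"
  by (induction I rule: finite_induct) (simp_all add: ev_add)

end

text \<open>The roots and inverses above are limits of sequences, and completeness in sequential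
  form passes to matrix algebras entry by entry. The locale can thus be applied again to matrices
  over matrices.\<close>

locale seq_cstar_algebra = unital_star_algebra A
  for A :: "'a star_algebra" (structure) +
  fixes \<Lambda> :: "'l set" and p :: "'l \<Rightarrow> 'a \<Rightarrow> real"
  assumes index_nonempty: "\<Lambda> \<noteq> {}"
    and seminorms: "l \<in> \<Lambda> \<Longrightarrow> cstar_seminorm A (p l)"
    and seq_complete:
      "\<lbrakk>\<And>n. X n \<in> carrier A; \<And>l e. l \<in> \<Lambda> \<Longrightarrow> 0 < e \<Longrightarrow> \<exists>K. \<forall>m\<ge>K. \<forall>n\<ge>K. p l (X m \<ominus> X n) < e\<rbrakk>
       \<Longrightarrow> \<exists>a\<in>carrier A. \<forall>l\<in>\<Lambda>. (\<lambda>n. p l (X n \<ominus> a)) \<longlonglongrightarrow> 0"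
begin

sublocale free: cstar_family fconst "fstar total_star" \<Lambda> "\<lambda>l f. p l (ev f)"
proof (rule cstar_family.intro)
  show "\<Lambda> \<noteq> {}" by (rule index_nonempty)
  show "cstar_seminormed_ring fconst (fstar total_star) (\<lambda>f. p l (ev f))" if "l \<in> \<Lambda>" for l
  proof
    have s: "cstar_seminorm A (p l)" using that by (rule seminorms)
    fix c d :: complex and f g :: "'a free_algebra"
    show "fconst (c + d) = (fconst c + fconst d :: 'a free_algebra)" by (rule fconst_add)
    show "fconst (c * d) = (fconst c * fconst d :: 'a free_algebra)" by (rule fconst_mult)
    show "fconst 1 = (1 :: 'a free_algebra)" by (rule fconst_1)
    show "f * fconst c = fconst c * f" by (rule fconst_commute)
    show "fstar total_star (f + g) = fstar total_star f + fstar total_star g" by (rule fstar_add)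
    show "fstar total_star (f * g) = fstar total_star g * fstar total_star f" by (rule fstar_mult)
    show "fstar total_star (fstar total_star f) = f" by (rule fstar_fstar) (rule total_star_total_star)
    show "fstar total_star (fconst c) = fconst (cnj c)" by (rule fstar_fconst)
    show "p l (ev (f + g)) \<le> p l (ev f) + p l (ev g)"
      using s ev_closed unfolding ev_add cstar_seminorm_def by blast
    show "p l (ev (fconst c * f)) = cmod c * p l (ev f)"
      using s ev_closed unfolding ev_fconst_mult cstar_seminorm_def by blast
    show "p l (ev (f * g)) \<le> p l (ev f) * p l (ev g)"
      using s ev_closed unfolding ev_mult cstar_seminorm_def by blast
    show "p l (ev (fstar total_star f * f)) = (p l (ev f))\<^sup>2"
      using s ev_closed unfolding ev_mult ev_fstar cstar_seminorm_def by blast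
  qed
  fix X :: "nat \<Rightarrow> 'a free_algebra"
  assume *: "\<And>l e. l \<in> \<Lambda> \<Longrightarrow> 0 < e \<Longrightarrow> \<exists>K. \<forall>m\<ge>K. \<forall>n\<ge>K. p l (ev (X m - X n)) < e"
  have "\<exists>a\<in>carrier A. \<forall>l\<in>\<Lambda>. (\<lambda>n. p l (ev (X n) \<ominus> a)) \<longlonglongrightarrow> 0"
    by (rule seq_complete) (simp, unfold ev_diff[symmetric], rule *)
  then obtain a where a: "a \<in> carrier A" "\<forall>l\<in>\<Lambda>. (\<lambda>n. p l (ev (X n) \<ominus> a)) \<longlonglongrightarrow> 0" by blast
  then show "\<exists>a. \<forall>l\<in>\<Lambda>. (\<lambda>n. p l (ev (X n - a))) \<longlonglongrightarrow> 0"
    unfolding ev_diff by (metis ev_gen)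
qed

end

text \<open>The image filter of a Cauchy sequence is Cauchy, hence convergent in the topology. The
  generating sets include the seminorm balls around the limit, so convergence holds in each
  seminorm.\<close>

lemma (in locally_cstar_algebra) seq_cstar_algebra: "seq_cstar_algebra A \<Lambda> p"
proof
  show "\<Lambda> \<noteq> {}" by (rule index_nonempty)
  show "cstar_seminorm A (p l)" if "l \<in> \<Lambda>" for l using that by (rule seminorms)
  fix X :: "nat \<Rightarrow> 'a"
  assume X: "\<And>n. X n \<in> carrier A"
    and C: "\<And>l e. l \<in> \<Lambda> \<Longrightarrow> 0 < e \<Longrightarrow> \<exists>K. \<forall>m\<ge>K. \<forall>n\<ge>K. p l (X m \<ominus> X n) < e"
  let ?F = "filtermap X sequentially" and ?T = "seminorm_topology A \<Lambda> p"
  have "\<exists>a. limitin ?T (\<lambda>x. x) a ?F"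
  proof (rule complete)
    show "?F \<noteq> bot" by (simp add: filtermap_bot_iff)
    show "eventually (\<lambda>x. x \<in> carrier A) ?F" using X by (simp add: eventually_filtermap)
    fix l and e :: real assume "l \<in> \<Lambda>" "0 < e"
    then obtain K where K: "\<forall>m\<ge>K. \<forall>n\<ge>K. p l (X m \<ominus> X n) < e" using C by blast
    have "eventually (\<lambda>x. \<exists>m\<ge>K. x = X m) ?F"
      unfolding eventually_filtermap eventually_sequentially by blast
    then show "eventually (\<lambda>(x, y). p l (x \<ominus> y) < e) (?F \<times>\<^sub>F ?F)"
      unfolding eventually_prod_filter using K by fast
  qed
  then obtain a where a: "limitin ?T (\<lambda>x. x) a ?F" by blast
  have "a \<in> topspace ?T" using a by (simp add: limitin_def)
  then have aA: "a \<in> carrier A"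
    unfolding seminorm_topology_def topology_generated_by_topspace by blast
  have "(\<lambda>n. p l (X n \<ominus> a)) \<longlonglongrightarrow> 0" if l: "l \<in> \<Lambda>" for l
  proof (rule tendstoI)
    have s: "cstar_seminorm A (p l)" using l by (rule seminorms)
    have "p l (0 \<odot> \<zero>) = 0" using s unfolding cstar_seminorm_def by auto
    then have p0: "p l \<zero> = 0" by (simp add: smult_0)
    have nonneg: "0 \<le> p l x" if "x \<in> carrier A" for x
    proof -
      have "(-1) \<odot> x \<in> carrier A" using that by simp
      then have "p l (x \<oplus> (-1) \<odot> x) \<le> p l x + p l ((-1) \<odot> x)"
        using s that unfolding cstar_seminorm_def by blast
      moreover have "p l ((-1) \<odot> x) = cmod (-1) * p l x"
        using s that unfolding cstar_seminorm_def by blast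
      moreover have "x \<oplus> (-1) \<odot> x = \<zero>"
        using smult_add_left[OF that, of 1 "-1"] that by (simp add: smult_1 smult_0)
      ultimately show ?thesis using p0 by simp
    qed
    fix e :: real assume e: "0 < e"
    let ?U = "{y \<in> carrier A. p l (y \<ominus> a) < e}"
    have "openin ?T ?U"
      unfolding seminorm_topology_def using aA l e by (intro topology_generated_by_Basis) blast
    moreover have "a \<in> ?U" using aA e p0 by (simp add: abelian_group.minus_eq[OF alg_abelian_group] abelian_group.r_neg[OF alg_abelian_group])
    ultimately have "eventually (\<lambda>x. x \<in> ?U) ?F" using a unfolding limitin_def by blast
    then show "eventually (\<lambda>n. dist (p l (X n \<ominus> a)) 0 < e) sequentially"
      unfolding eventually_filtermap by eventually_elim (use nonneg aA in auto)
  qed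
  then show "\<exists>a\<in>carrier A. \<forall>l\<in>\<Lambda>. (\<lambda>n. p l (X n \<ominus> a)) \<longlonglongrightarrow> 0" using aA by blast
qed

section \<open>Matrix algebras\<close>

context unital_star_algebra
begin

text \<open>By \<open>evm_cases\<close> every matrix of the algebra has this form, so the laws of
  \<open>mat_algebra k A\<close> follow from computations with finite sums in a
  \<open>ring_1\<close>.\<close>

definition evm :: "nat \<Rightarrow> (nat \<Rightarrow> nat \<Rightarrow> 'a free_algebra) \<Rightarrow> nat \<times> nat \<Rightarrow> 'a" where
  "evm k m = (\<lambda>(i, j)\<in>idx k. ev (m i j))"

definition evv :: "nat \<Rightarrow> (nat \<Rightarrow> 'a free_algebra) \<Rightarrow> nat \<Rightarrow> 'a" where
  "evv k v = (\<lambda>i\<in>{..<k}. ev (v i))"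

lemma evm_entry: "i < k \<Longrightarrow> j < k \<Longrightarrow> evm k m (i, j) = ev (m i j)"
  by (simp add: evm_def)

lemma evv_entry: "i < k \<Longrightarrow> evv k v i = ev (v i)"
  by (simp add: evv_def)

lemma evm_closed: "evm k m \<in> carrier (mat_algebra k A)"
  by (auto simp: evm_def mat_algebra_def)

lemma evm_cong: "(\<And>i j. i < k \<Longrightarrow> j < k \<Longrightarrow> m i j = n i j) \<Longrightarrow> evm k m = evm k n"
  unfolding evm_def by (rule restrict_ext) auto

lemma evm_gen:
  assumes "M \<in> carrier (mat_algebra k A)"
  shows "evm k (\<lambda>i j. gen (M (i, j))) = M"
proof (rule extensionalityI[of _ "idx k"])
  show "M \<in> extensional (idx k)" using assms by (simp add: mat_algebra_def PiE_def)
  show "evm k (\<lambda>i j. gen (M (i, j))) ij = M ij" if "ij \<in> idx k" for ij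
    using assms that by (auto simp: mat_algebra_def PiE_iff evm_entry ev_gen)
qed (simp add: evm_def)

lemma evm_cases:
  assumes "M \<in> carrier (mat_algebra k A)"
  obtains m where "M = evm k m"
  using evm_gen[OF assms] by metis

lemma evv_cases:
  assumes "x \<in> {..<k} \<rightarrow>\<^sub>E carrier A"
  obtains v where "x = evv k v"
proof -
  have "evv k (\<lambda>i. gen (x i)) = x"
    using assms by (intro ext) (auto simp: evv_def restrict_def PiE_iff extensional_def ev_gen)
  then show ?thesis using that by metis
qed

lemma finsum_ev: "(\<And>i. i \<in> I \<Longrightarrow> f i = ev (g i)) \<Longrightarrow> finite I \<Longrightarrow> (\<Oplus>i\<in>I. f i) = ev (\<Sum>i\<in>I. g i)"
  by (subst ev_sum) (auto intro!: abelian_monoid.finsum_cong'[OF alg_abelian_monoid])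

lemma evm_mult: "evm k m \<otimes>\<^bsub>mat_algebra k A\<^esub> evm k n = evm k (mmul k m n)"
  unfolding evm_def[of k "mmul k m n"] mmul_def
  by (auto simp: mat_algebra_def evm_entry ev_mult intro!: restrict_ext finsum_ev)

lemma evm_add: "evm k m \<oplus>\<^bsub>mat_algebra k A\<^esub> evm k n = evm k (\<lambda>i j. m i j + n i j)"
  unfolding evm_def[of k "\<lambda>i j. m i j + n i j"]
  by (auto simp: mat_algebra_def evm_entry ev_add intro!: restrict_ext)

lemma evm_smult: "c \<odot>\<^bsub>mat_algebra k A\<^esub> evm k m = evm k (\<lambda>i j. fconst c * m i j)"
  unfolding evm_def[of k "\<lambda>i j. fconst c * m i j"]
  by (auto simp: mat_algebra_def evm_entry ev_fconst_mult intro!: restrict_ext)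

lemma evm_star: "star (mat_algebra k A) (evm k m) = evm k (madj (fstar total_star) m)"
  unfolding evm_def[of k "madj (fstar total_star) m"]
  by (auto simp: mat_algebra_def evm_entry ev_fstar madj_def intro!: restrict_ext)

lemma evm_one: "\<one>\<^bsub>mat_algebra k A\<^esub> = evm k (\<lambda>i j. if i = j then 1 else 0)"
  unfolding evm_def by (auto simp: mat_algebra_def intro!: restrict_ext)

lemma evm_zero: "\<zero>\<^bsub>mat_algebra k A\<^esub> = evm k (\<lambda>i j. 0)"
  unfolding evm_def by (auto simp: mat_algebra_def intro!: restrict_ext)

lemma ring_mat_algebra: "ring (mat_algebra k A)"
proof (rule ringI)
  show "abelian_group (mat_algebra k A)"
  proof (rule abelian_groupI)
    fix x y z assume xyz: "x \<in> carrier (mat_algebra k A)" "y \<in> carrier (mat_algebra k A)" "z \<in> carrier (mat_algebra k A)"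
    show "x \<oplus>\<^bsub>mat_algebra k A\<^esub> y \<oplus>\<^bsub>mat_algebra k A\<^esub> z = x \<oplus>\<^bsub>mat_algebra k A\<^esub> (y \<oplus>\<^bsub>mat_algebra k A\<^esub> z)"
      using xyz by (elim evm_cases) (simp add: evm_add add.assoc)
  next
    fix x y assume xy: "x \<in> carrier (mat_algebra k A)" "y \<in> carrier (mat_algebra k A)"
    show "x \<oplus>\<^bsub>mat_algebra k A\<^esub> y \<in> carrier (mat_algebra k A)"
      using xy by (elim evm_cases) (simp add: evm_add evm_closed)
    show "x \<oplus>\<^bsub>mat_algebra k A\<^esub> y = y \<oplus>\<^bsub>mat_algebra k A\<^esub> x"
      using xy by (elim evm_cases) (simp add: evm_add add.commute)
  next
    fix x assume x: "x \<in> carrier (mat_algebra k A)"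
    show "\<zero>\<^bsub>mat_algebra k A\<^esub> \<oplus>\<^bsub>mat_algebra k A\<^esub> x = x"
      using x by (elim evm_cases) (simp add: evm_add evm_zero)
    obtain m where "x = evm k m" using x by (rule evm_cases)
    then have "evm k (\<lambda>i j. - m i j) \<oplus>\<^bsub>mat_algebra k A\<^esub> x = \<zero>\<^bsub>mat_algebra k A\<^esub>"
      by (simp add: evm_add evm_zero)
    then show "\<exists>y\<in>carrier (mat_algebra k A). y \<oplus>\<^bsub>mat_algebra k A\<^esub> x = \<zero>\<^bsub>mat_algebra k A\<^esub>"
      using evm_closed by blast
  qed (simp add: evm_zero evm_closed)
  show "monoid (mat_algebra k A)"
  proof (rule monoidI)
    fix x y z assume xyz: "x \<in> carrier (mat_algebra k A)" "y \<in> carrier (mat_algebra k A)" "z \<in> carrier (mat_algebra k A)"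
    show "x \<otimes>\<^bsub>mat_algebra k A\<^esub> y \<otimes>\<^bsub>mat_algebra k A\<^esub> z = x \<otimes>\<^bsub>mat_algebra k A\<^esub> (y \<otimes>\<^bsub>mat_algebra k A\<^esub> z)"
      using xyz by (elim evm_cases) (simp add: evm_mult mmul_assoc)
  next
    fix x y assume xy: "x \<in> carrier (mat_algebra k A)" "y \<in> carrier (mat_algebra k A)"
    show "x \<otimes>\<^bsub>mat_algebra k A\<^esub> y \<in> carrier (mat_algebra k A)"
      using xy by (elim evm_cases) (simp add: evm_mult evm_closed)
  next
    fix x assume x: "x \<in> carrier (mat_algebra k A)"
    then obtain m where m: "x = evm k m" by (rule evm_cases)
    have "mmul k (\<lambda>i j. if i = j then 1 else 0) m i j = m i j" if "i < k" for i j
    proof -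
      have "mmul k (\<lambda>i j. if i = j then 1 else 0) m i j = (\<Sum>r<k. if i = r then m r j else 0)"
        unfolding mmul_def by (intro sum.cong) auto
      then show ?thesis using that by simp
    qed
    then show "\<one>\<^bsub>mat_algebra k A\<^esub> \<otimes>\<^bsub>mat_algebra k A\<^esub> x = x"
      unfolding m evm_one evm_mult by (intro evm_cong)
    have "mmul k m (\<lambda>i j. if i = j then 1 else 0) i j = m i j" if "j < k" for i j
    proof -
      have "mmul k m (\<lambda>i j. if i = j then 1 else 0) i j = (\<Sum>r<k. if r = j then m i r else 0)"
        unfolding mmul_def by (intro sum.cong) auto
      then show ?thesis using that by simp
    qed
    then show "x \<otimes>\<^bsub>mat_algebra k A\<^esub> \<one>\<^bsub>mat_algebra k A\<^esub> = x"
      unfolding m evm_one evm_mult by (intro evm_cong)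
  qed (simp add: evm_one evm_closed)
  fix x y z assume xyz: "x \<in> carrier (mat_algebra k A)" "y \<in> carrier (mat_algebra k A)" "z \<in> carrier (mat_algebra k A)"
  show "(x \<oplus>\<^bsub>mat_algebra k A\<^esub> y) \<otimes>\<^bsub>mat_algebra k A\<^esub> z
      = x \<otimes>\<^bsub>mat_algebra k A\<^esub> z \<oplus>\<^bsub>mat_algebra k A\<^esub> y \<otimes>\<^bsub>mat_algebra k A\<^esub> z"
    using xyz by (elim evm_cases) (auto simp: evm_mult evm_add mmul_def distrib_right sum.distrib intro!: evm_cong)
  show "z \<otimes>\<^bsub>mat_algebra k A\<^esub> (x \<oplus>\<^bsub>mat_algebra k A\<^esub> y)
      = z \<otimes>\<^bsub>mat_algebra k A\<^esub> x \<oplus>\<^bsub>mat_algebra k A\<^esub> z \<otimes>\<^bsub>mat_algebra k A\<^esub> y"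
    using xyz by (elim evm_cases) (auto simp: evm_mult evm_add mmul_def distrib_left sum.distrib intro!: evm_cong)
qed

lemma module_mat_algebra: "module complex_ring (mat_algebra k A)"
proof (rule moduleI)
  show "cring complex_ring" ..
  show "abelian_group (mat_algebra k A)" using ring_mat_algebra by (rule ringE)
  fix a b x y
  assume x: "x \<in> carrier (mat_algebra k A)" and y: "y \<in> carrier (mat_algebra k A)"
  show "a \<odot>\<^bsub>mat_algebra k A\<^esub> x \<in> carrier (mat_algebra k A)"
    using x by (elim evm_cases) (simp add: evm_smult evm_closed)
  show "(a \<oplus>\<^bsub>complex_ring\<^esub> b) \<odot>\<^bsub>mat_algebra k A\<^esub> x
      = a \<odot>\<^bsub>mat_algebra k A\<^esub> x \<oplus>\<^bsub>mat_algebra k A\<^esub> b \<odot>\<^bsub>mat_algebra k A\<^esub> x"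
    using x by (elim evm_cases) (simp add: complex_ring_def evm_smult evm_add fconst_add distrib_right)
  show "a \<odot>\<^bsub>mat_algebra k A\<^esub> (x \<oplus>\<^bsub>mat_algebra k A\<^esub> y)
      = a \<odot>\<^bsub>mat_algebra k A\<^esub> x \<oplus>\<^bsub>mat_algebra k A\<^esub> a \<odot>\<^bsub>mat_algebra k A\<^esub> y"
    using x y by (elim evm_cases) (simp add: evm_smult evm_add distrib_left)
  show "(a \<otimes>\<^bsub>complex_ring\<^esub> b) \<odot>\<^bsub>mat_algebra k A\<^esub> x
      = a \<odot>\<^bsub>mat_algebra k A\<^esub> (b \<odot>\<^bsub>mat_algebra k A\<^esub> x)"
    using x by (elim evm_cases) (simp add: complex_ring_def evm_smult fconst_mult mult.assoc)
  show "\<one>\<^bsub>complex_ring\<^esub> \<odot>\<^bsub>mat_algebra k A\<^esub> x = x"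
    using x by (elim evm_cases) (simp add: complex_ring_def evm_smult fconst_1)
qed

lemma fstar_sum: "fstar s (sum f I) = (\<Sum>i\<in>I. fstar s (f i))"
  by (induction I rule: infinite_finite_induct) (simp_all add: fstar_add)

lemma unital_star_algebra_mat_algebra: "unital_star_algebra (mat_algebra k A)"
proof (intro unital_star_algebra.intro ring_mat_algebra module_mat_algebra unital_star_algebra_axioms.intro)
  fix x y c
  assume x: "x \<in> carrier (mat_algebra k A)"
  then obtain m where m: "x = evm k m" by (rule evm_cases)
  show "star (mat_algebra k A) x \<in> carrier (mat_algebra k A)"
    by (simp add: m evm_star evm_closed)
  show "star (mat_algebra k A) (star (mat_algebra k A) x) = x"
    unfolding m evm_star by (rule evm_cong) (simp add: madj_def fstar_fstar total_star_total_star)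
  show "star (mat_algebra k A) (c \<odot>\<^bsub>mat_algebra k A\<^esub> x) = cnj c \<odot>\<^bsub>mat_algebra k A\<^esub> star (mat_algebra k A) x"
    unfolding m evm_star evm_smult madj_def fstar_mult fstar_fconst fconst_commute ..
  assume y: "y \<in> carrier (mat_algebra k A)"
  then obtain n where n: "y = evm k n" by (rule evm_cases)
  have 1: "fconst c * g * h = fconst c * (g * h)" "g * (fconst c * h) = fconst c * (g * h)"
    for g h :: "'a free_algebra"
    using fconst_commute[of g c] by (simp_all add: mult.assoc[symmetric])
  show "(c \<odot>\<^bsub>mat_algebra k A\<^esub> x) \<otimes>\<^bsub>mat_algebra k A\<^esub> y = c \<odot>\<^bsub>mat_algebra k A\<^esub> (x \<otimes>\<^bsub>mat_algebra k A\<^esub> y)"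
    unfolding m n evm_smult evm_mult by (rule evm_cong) (simp add: mmul_def 1(1) sum_distrib_left)
  show "x \<otimes>\<^bsub>mat_algebra k A\<^esub> (c \<odot>\<^bsub>mat_algebra k A\<^esub> y) = c \<odot>\<^bsub>mat_algebra k A\<^esub> (x \<otimes>\<^bsub>mat_algebra k A\<^esub> y)"
    unfolding m n evm_smult evm_mult by (rule evm_cong) (simp only: mmul_def 1(2) sum_distrib_left)
  show "star (mat_algebra k A) (x \<oplus>\<^bsub>mat_algebra k A\<^esub> y)
      = star (mat_algebra k A) x \<oplus>\<^bsub>mat_algebra k A\<^esub> star (mat_algebra k A) y"
    unfolding m n evm_star evm_add by (rule evm_cong) (simp add: madj_def fstar_add)
  show "star (mat_algebra k A) (x \<otimes>\<^bsub>mat_algebra k A\<^esub> y)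
      = star (mat_algebra k A) y \<otimes>\<^bsub>mat_algebra k A\<^esub> star (mat_algebra k A) x"
    unfolding m n evm_star evm_mult by (rule evm_cong) (simp add: madj_def mmul_def fstar_sum fstar_mult)
qed

lemma evm_diff: "evm k m \<ominus>\<^bsub>mat_algebra k A\<^esub> evm k n = evm k (\<lambda>i j. m i j - n i j)"
proof -
  note ag = ringE(1)[OF ring_mat_algebra]
  have "evm k (\<lambda>i j. - n i j) \<oplus>\<^bsub>mat_algebra k A\<^esub> evm k n = \<zero>\<^bsub>mat_algebra k A\<^esub>"
    by (simp add: evm_add evm_zero)
  from abelian_group.minus_equality[OF ag this evm_closed evm_closed]
  show ?thesis unfolding abelian_group.minus_eq[OF ag] by (simp add: evm_add)
qed

lemma finsum_evm:
  assumes "finite I" "\<And>i. i \<in> I \<Longrightarrow> F i = evm k (m i)"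
  shows "finsum (mat_algebra k A) F I = evm k (\<lambda>r s. \<Sum>i\<in>I. m i r s)"
  using assms
proof (induction I rule: finite_induct)
  case empty
  show ?case
    by (simp add: evm_zero abelian_monoid.finsum_empty[OF abelian_group.axioms(1)[OF ringE(1)[OF ring_mat_algebra]]])
next
  case (insert i I)
  have "finsum (mat_algebra k A) F (insert i I) = F i \<oplus>\<^bsub>mat_algebra k A\<^esub> finsum (mat_algebra k A) F I"
    using insert.hyps insert.prems evm_closed
    by (intro abelian_monoid.finsum_insert[OF abelian_group.axioms(1)[OF ringE(1)[OF ring_mat_algebra]]]) auto
  then show ?case using insert by (simp add: evm_add)
qed

end

section \<open>Matrix algebras are again complete with C*-seminorms\<close>

context seq_cstar_algebra
begin

lemma col_norm_evv:
  assumes l: "l \<in> \<Lambda>"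
  shows "col_norm k A (p l) (evv k v) = cstar_seminormed_ring.cnorm (fstar total_star) (\<lambda>f. p l (ev f)) k v"
proof -
  interpret l: cstar_seminormed_ring fconst "fstar total_star" "\<lambda>f. p l (ev f)" using l by (rule free.seminorm)
  have "(\<Oplus>i\<in>{..<k}. star A (evv k v i) \<otimes> evv k v i) = ev (\<Sum>i<k. fstar total_star (v i) * v i)"
    by (intro finsum_ev) (simp_all add: evv_entry ev_mult ev_fstar)
  then show ?thesis by (simp add: col_norm_def l.cnorm_def l.gram_def)
qed

lemma mat_apply_evm: "mat_apply k A (evm k m) (evv k v) = evv k (mat_vec k m v)"
  unfolding evv_def[of k "mat_vec k m v"] mat_vec_def mat_apply_def
  by (auto simp: evm_entry evv_entry ev_mult intro!: restrict_ext finsum_ev)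

text \<open>The unit ball of columns over the carrier is the image under \<open>evv\<close> of the
  unit ball over the free algebra, so both suprema range over the same numbers.\<close>

lemma mat_seminorm_evm:
  assumes l: "l \<in> \<Lambda>"
  shows "mat_seminorm k A (p l) (evm k m) = cstar_seminormed_ring.opnorm (fstar total_star) (\<lambda>f. p l (ev f)) k m"
proof -
  interpret l: cstar_seminormed_ring fconst "fstar total_star" "\<lambda>f. p l (ev f)" using l by (rule free.seminorm)
  have "{x \<in> {..<k} \<rightarrow>\<^sub>E carrier A. col_norm k A (p l) x \<le> 1} = evv k ` {v. l.cnorm k v \<le> 1}"
  proof (intro equalityI subsetI)
    fix x assume x: "x \<in> {x \<in> {..<k} \<rightarrow>\<^sub>E carrier A. col_norm k A (p l) x \<le> 1}"
    then obtain v where "x = evv k v" using evv_cases by blast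
    then show "x \<in> evv k ` {v. l.cnorm k v \<le> 1}" using x by (simp add: col_norm_evv[OF l])
  next
    fix x assume "x \<in> evv k ` {v. l.cnorm k v \<le> 1}"
    then obtain v where "x = evv k v" "l.cnorm k v \<le> 1" by blast
    moreover have "evv k v \<in> {..<k} \<rightarrow>\<^sub>E carrier A" by (auto simp: evv_def)
    ultimately show "x \<in> {x \<in> {..<k} \<rightarrow>\<^sub>E carrier A. col_norm k A (p l) x \<le> 1}"
      by (simp add: col_norm_evv[OF l])
  qed
  then show ?thesis
    by (simp add: mat_seminorm_def l.opnorm_def image_image mat_apply_evm col_norm_evv[OF l])
qed

lemma mat_seminorm_eq_0_iff:
  assumes l: "l \<in> \<Lambda>" and M: "M \<in> carrier (mat_algebra k A)"
  shows "mat_seminorm k A (p l) M = 0 \<longleftrightarrow> (\<forall>i<k. \<forall>j<k. p l (M (i, j)) = 0)"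
proof -
  interpret l: cstar_seminormed_ring fconst "fstar total_star" "\<lambda>f. p l (ev f)" using l by (rule free.seminorm)
  obtain m where "M = evm k m" using M by (rule evm_cases)
  then show ?thesis by (simp add: mat_seminorm_evm[OF l] l.opnorm_eq_0_iff evm_entry)
qed

lemma cstar_seminorm_mat_seminorm:
  assumes l: "l \<in> \<Lambda>"
  shows "cstar_seminorm (mat_algebra k A) (mat_seminorm k A (p l))"
proof -
  interpret l: cstar_seminormed_ring fconst "fstar total_star" "\<lambda>f. p l (ev f)" using l by (rule free.seminorm)
  show ?thesis
    unfolding cstar_seminorm_def
    by (intro conjI ballI allI; elim evm_cases)
      (simp_all add: evm_add evm_mult evm_smult evm_star mat_seminorm_evm[OF l]
        l.opnorm_add l.opnorm_C l.opnorm_mmul l.opnorm_star)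
qed

text \<open>The operator norm lies between each entry and the sum of all entries: the former makes
  the entries Cauchy, the latter makes the matrix of entrywise limits a limit.\<close>

theorem seq_cstar_algebra_mat_algebra:
  "seq_cstar_algebra (mat_algebra k A) \<Lambda> (\<lambda>l. mat_seminorm k A (p l))"
proof (intro seq_cstar_algebra.intro unital_star_algebra_mat_algebra seq_cstar_algebra_axioms.intro)
  show "\<Lambda> \<noteq> {}" by (rule index_nonempty)
  show "cstar_seminorm (mat_algebra k A) (mat_seminorm k A (p l))" if "l \<in> \<Lambda>" for l
    using that by (rule cstar_seminorm_mat_seminorm)
  fix X :: "nat \<Rightarrow> nat \<times> nat \<Rightarrow> 'a"
  assume X: "\<And>n. X n \<in> carrier (mat_algebra k A)"
    and C: "\<And>l e. l \<in> \<Lambda> \<Longrightarrow> 0 < e \<Longrightarrow>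
      \<exists>K. \<forall>m\<ge>K. \<forall>n\<ge>K. mat_seminorm k A (p l) (X m \<ominus>\<^bsub>mat_algebra k A\<^esub> X n) < e"
  define x where "x n i j = gen (X n (i, j))" for n i j
  have Xx: "X n = evm k (x n)" for n unfolding x_def using evm_gen[OF X] by simp
  have "\<exists>a. \<forall>l\<in>\<Lambda>. (\<lambda>n. p l (ev (x n i j - a))) \<longlonglongrightarrow> 0" if ij: "i < k" "j < k" for i j
  proof (rule free.complete)
    fix l and e :: real assume l: "l \<in> \<Lambda>" and e: "0 < e"
    interpret l: cstar_seminormed_ring fconst "fstar total_star" "\<lambda>f. p l (ev f)" using l by (rule free.seminorm)
    obtain K where K: "\<forall>m\<ge>K. \<forall>n\<ge>K. mat_seminorm k A (p l) (X m \<ominus>\<^bsub>mat_algebra k A\<^esub> X n) < e"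
      using C[OF l e] by blast
    have "p l (ev (x m i j - x n i j)) < e" if "m \<ge> K" "n \<ge> K" for m n
    proof -
      have "p l (ev (x m i j - x n i j)) \<le> l.opnorm k (\<lambda>i j. x m i j - x n i j)"
        using l.N_le_opnorm[OF ij, of "\<lambda>i j. x m i j - x n i j"] .
      also have "\<dots> = mat_seminorm k A (p l) (X m \<ominus>\<^bsub>mat_algebra k A\<^esub> X n)"
        by (simp add: Xx evm_diff mat_seminorm_evm[OF l])
      also have "\<dots> < e" using K that by blast
      finally show ?thesis .
    qed
    then show "\<exists>K. \<forall>m\<ge>K. \<forall>n\<ge>K. p l (ev (x m i j - x n i j)) < e" by blast
  qed
  then obtain a where a: "\<And>i j l. i < k \<Longrightarrow> j < k \<Longrightarrow> l \<in> \<Lambda> \<Longrightarrow> (\<lambda>n. p l (ev (x n i j - a i j))) \<longlonglongrightarrow> 0"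
    by metis
  have "(\<lambda>n. mat_seminorm k A (p l) (X n \<ominus>\<^bsub>mat_algebra k A\<^esub> evm k a)) \<longlonglongrightarrow> 0" if l: "l \<in> \<Lambda>" for l
  proof -
    interpret l: cstar_seminormed_ring fconst "fstar total_star" "\<lambda>f. p l (ev f)" using l by (rule free.seminorm)
    have "(\<lambda>n. \<Sum>i<k. \<Sum>j<k. p l (ev (x n i j - a i j))) \<longlonglongrightarrow> (\<Sum>i<k. \<Sum>j<k. 0)"
      using a l by (intro tendsto_sum) auto
    then have lim: "(\<lambda>n. \<Sum>i<k. \<Sum>j<k. p l (ev (x n i j - a i j))) \<longlonglongrightarrow> 0" by simp
    have "norm (l.opnorm k (\<lambda>i j. x n i j - a i j)) \<le> (\<Sum>i<k. \<Sum>j<k. p l (ev (x n i j - a i j)))" for n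
      using l.opnorm_le_sum[of k "\<lambda>i j. x n i j - a i j"] l.opnorm_nonneg[of k "\<lambda>i j. x n i j - a i j"] by simp
    then have "(\<lambda>n. l.opnorm k (\<lambda>i j. x n i j - a i j)) \<longlonglongrightarrow> 0"
      by (intro Lim_null_comparison[OF _ lim] always_eventually allI)
    then show ?thesis by (simp add: Xx evm_diff mat_seminorm_evm[OF l])
  qed
  then show "\<exists>a\<in>carrier (mat_algebra k A). \<forall>l\<in>\<Lambda>.
      (\<lambda>n. mat_seminorm k A (p l) (X n \<ominus>\<^bsub>mat_algebra k A\<^esub> a)) \<longlonglongrightarrow> 0"
    using evm_closed by blast
qed

end

section \<open>Decomposable maps\<close>

context cstar_seminormed_ring
begin

lemma N_add_null: "N x = 0 \<Longrightarrow> N y = 0 \<Longrightarrow> N (x + y) = 0"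
  using N_add[of x y] N_nonneg[of "x + y"] by linarith

lemma N_diff_null: "N x = 0 \<Longrightarrow> N y = 0 \<Longrightarrow> N (x - y) = 0"
  using N_diff[of x y] N_nonneg[of "x - y"] by linarith

lemma N_sum_null: "(\<And>i. i \<in> I \<Longrightarrow> N (f i) = 0) \<Longrightarrow> N (sum f I) = 0"
  by (induction I rule: infinite_finite_induct) (auto intro: N_add_null)

lemma pos_gram: "pos (gram I x x)"
  unfolding gram_def by (rule pos_sum_star)

lemma gram_null_entry:
  assumes "finite I" "N (gram I x x + gram I y y) = 0" "t \<in> I"
  shows "N (y t) = 0"
proof -
  have "N (gram I y y) \<le> N (gram I x x + gram I y y)"
    by (intro N_mono pos_gram) (simp add: pos_gram)
  moreover have "(N (y t))\<^sup>2 \<le> N (gram I y y)"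
    unfolding gram_def using assms(1,3) by (rule N_square_le_sum_star)
  ultimately show ?thesis using assms(2) by (simp add: power2_eq_square) (metis mult_eq_0_iff N_nonneg order_antisym mult_nonneg_nonneg)
qed

text \<open>The families \<open>v\<close> and \<open>u\<close> represent the completely positive and
  the copositive part, whence the exchanged \<open>i\<close> and \<open>j\<close> at
  \<open>u\<close>; \<open>P\<close> is the value of the given map at the square under
  consideration.\<close>

lemma decomposition_null:
  fixes v u :: "nat \<Rightarrow> nat \<Rightarrow> 'i \<Rightarrow> 'x"
  assumes fin: "finite I"
    and null: "\<And>i j r s. i < 2 \<Longrightarrow> j < 2 \<Longrightarrow> r < 2 \<Longrightarrow> s < 2 \<Longrightarrow>
      N (gram I (v i r) (v j s) + gram I (u j r) (u i s) - (if r = i \<and> s = j then P else 0)) = 0"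
  shows "N (gram I (u 0 0) (u 0 0)) = 0"
proof -
  have "N (gram I (v 0 1) (v 0 1) + gram I (u 0 1) (u 0 1)) = 0"
    using null[of 0 0 1 1] by simp
  then have u01: "N (u 0 1 t) = 0" if "t \<in> I" for t
    using gram_null_entry[OF fin] that by blast
  then have g1: "N (gram I (u 1 0) (u 0 1)) = 0"
    unfolding gram_def by (intro N_sum_null N_null_mult_left)
  have g2: "N (gram I (u 0 1) (u 1 0)) = 0"
    unfolding gram_def using u01 by (intro N_sum_null N_null_mult_right) simp
  \<comment> \<open>The four instances with r = i and s = j, in the mixed ones after removing the
    null terms of \<open>u\<close>. In a + b - c - d the four copies of \<open>P\<close> cancel, and
    \<open>v\<close> contributes the inner square of \<open>v 0 0 - v 1 1\<close>.\<close>
  define a where "a = gram I (v 0 0) (v 0 0) + gram I (u 0 0) (u 0 0) - P"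
  define b where "b = gram I (v 1 1) (v 1 1) + gram I (u 1 1) (u 1 1) - P"
  define c where "c = gram I (v 0 0) (v 1 1) + gram I (u 1 0) (u 0 1) - P - gram I (u 1 0) (u 0 1)"
  define d where "d = gram I (v 1 1) (v 0 0) + gram I (u 0 1) (u 1 0) - P - gram I (u 0 1) (u 1 0)"
  have a: "N a = 0" and b: "N b = 0" using null[of 0 0 0 0] null[of 1 1 1 1] by (simp_all add: a_def b_def)
  have c: "N c = 0" unfolding c_def using null[of 0 1 0 1] by (intro N_diff_null[OF _ g1]) simp
  have d: "N d = 0" unfolding d_def using null[of 1 0 1 0] by (intro N_diff_null[OF _ g2]) simp
  define w where "w t = v 0 0 t - v 1 1 t" for t
  have "gram I w w = gram I (v 0 0) (v 0 0) - gram I (v 0 0) (v 1 1) - gram I (v 1 1) (v 0 0) + gram I (v 1 1) (v 1 1)"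
    by (simp add: gram_def w_def st_diff algebra_simps sum.distrib sum_subtractf)
  then have "gram I w w + gram I (u 1 1) (u 1 1) + gram I (u 0 0) (u 0 0) = a + b - c - d"
    by (simp add: a_def b_def c_def d_def)
  then have "N (gram I w w + gram I (u 1 1) (u 1 1) + gram I (u 0 0) (u 0 0)) = 0"
    using a b c d by (simp add: N_add_null N_diff_null)
  moreover have "N (gram I (u 0 0) (u 0 0)) \<le> N (gram I w w + gram I (u 1 1) (u 1 1) + gram I (u 0 0) (u 0 0))"
    by (intro N_mono pos_gram) (simp add: pos_gram pos_add)
  ultimately show ?thesis using N_nonneg[of "gram I (u 0 0) (u 0 0)"] by linarith
qed

text \<open>The sum of i^m times the square of h + i^m over m = 0, ..., 3. The sums of i^m and of
  i^(2m) vanish, so only the term in \<open>h\<close> survives. Hence a linear map that is null on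
  squares is null everywhere.\<close>

lemma polarization:
  "C 4 * h = st (h + 1) * (h + 1) + C \<i> * (st (h + C \<i>) * (h + C \<i>))
    + C (- 1) * (st (h - 1) * (h - 1)) + C (- \<i>) * (st (h - C \<i>) * (h - C \<i>))"
proof -
  have ii: "C \<i> * C \<i> = - 1" "C \<i> * (C \<i> * x) = - x" for x
    by (simp_all add: C_C_mult C_minus flip: C_mult)
  have "C 4 = 1 + 1 + 1 + 1" by (simp add: C_numeral)
  then have four: "C 4 * h = h + h + h + h" by (simp only: distrib_right mult_1)
  have e1: "st (h + C \<i>) * (h + C \<i>) = st h * h + C \<i> * st h - C \<i> * h + 1"
    by (simp add: st_add C_minus algebra_simps ii C_commute[of "st h"])
  have e2: "st (h - C \<i>) * (h - C \<i>) = st h * h - C \<i> * st h + C \<i> * h + 1"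
    by (simp add: st_diff C_minus algebra_simps ii C_commute[of "st h"])
  show ?thesis
    unfolding e1 e2 four by (simp add: st_add st_diff C_minus algebra_simps ii)
qed

end

section \<open>Matrices over matrices\<close>

context unital_star_algebra
begin

definition evmm :: "nat \<Rightarrow> nat \<Rightarrow> (nat \<Rightarrow> nat \<Rightarrow> nat \<Rightarrow> nat \<Rightarrow> 'a free_algebra) \<Rightarrow> nat \<times> nat \<Rightarrow> nat \<times> nat \<Rightarrow> 'a" where
  "evmm k n y = (\<lambda>(i, j)\<in>idx k. evm n (y i j))"

lemma evmm_entry: "i < k \<Longrightarrow> j < k \<Longrightarrow> evmm k n y (i, j) = evm n (y i j)"
  by (simp add: evmm_def)

lemma evmm_closed: "evmm k n y \<in> carrier (mat_algebra k (mat_algebra n A))"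
  using evm_closed by (auto simp: evmm_def mat_algebra_def[of k])

lemma evmm_cong:
  "(\<And>i j r s. i < k \<Longrightarrow> j < k \<Longrightarrow> r < n \<Longrightarrow> s < n \<Longrightarrow> y i j r s = z i j r s) \<Longrightarrow> evmm k n y = evmm k n z"
  unfolding evmm_def by (rule restrict_ext) (auto intro!: evm_cong)

lemma evmm_cases:
  assumes "W \<in> carrier (mat_algebra k (mat_algebra n A))"
  obtains y where "W = evmm k n y"
proof -
  have "evmm k n (\<lambda>i j r s. gen (W (i, j) (r, s))) = W"
  proof (rule extensionalityI[of _ "idx k"])
    show "W \<in> extensional (idx k)" using assms by (simp add: mat_algebra_def[of k] PiE_def)
    show "evmm k n (\<lambda>i j r s. gen (W (i, j) (r, s))) ij = W ij" if "ij \<in> idx k" for ij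
    proof -
      obtain i j where ij: "ij = (i, j)" by (cases ij)
      have "W (i, j) \<in> carrier (mat_algebra n A)"
        using assms that unfolding ij by (auto simp: mat_algebra_def[of k])
      then show ?thesis using that unfolding ij by (simp add: evmm_entry evm_gen)
    qed
  qed (simp add: evmm_def)
  then show ?thesis using that by metis
qed

lemma evmm_add:
  "evmm k n y \<oplus>\<^bsub>mat_algebra k (mat_algebra n A)\<^esub> evmm k n z = evmm k n (\<lambda>i j r s. y i j r s + z i j r s)"
  unfolding evmm_def[of k n "\<lambda>i j r s. y i j r s + z i j r s"]
  by (auto simp: mat_algebra_def[of k] evmm_entry evm_add intro!: restrict_ext)

text \<open>Block (i, j), entry (r, s) of the square of \<open>y\<close>. The two row indices l and
  t are merged into one sum, so that each entry is the inner product of the columns of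
  \<open>y\<close> labelled (i, r) and (j, s).\<close>

definition gram_block :: "nat \<Rightarrow> nat \<Rightarrow> (nat \<Rightarrow> nat \<Rightarrow> nat \<Rightarrow> nat \<Rightarrow> 'a free_algebra)
    \<Rightarrow> nat \<Rightarrow> nat \<Rightarrow> nat \<Rightarrow> nat \<Rightarrow> 'a free_algebra" where
  "gram_block k n y i j r s
    = (\<Sum>(l, t)\<in>{..<k} \<times> {..<n}. fstar total_star (y l i t r) * y l j t s)"

lemma evmm_star_mult:
  "star (mat_algebra k (mat_algebra n A)) (evmm k n y) \<otimes>\<^bsub>mat_algebra k (mat_algebra n A)\<^esub> evmm k n y
    = evmm k n (gram_block k n y)"
proof -
  have "(\<Oplus>\<^bsub>mat_algebra n A\<^esub>l\<in>{..<k}. star (mat_algebra k (mat_algebra n A)) (evmm k n y) (i, l)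
      \<otimes>\<^bsub>mat_algebra n A\<^esub> evmm k n y (l, j)) = evm n (gram_block k n y i j)"
    if "i < k" "j < k" for i j
  proof -
    have "star (mat_algebra k (mat_algebra n A)) (evmm k n y) (i, l)
      \<otimes>\<^bsub>mat_algebra n A\<^esub> evmm k n y (l, j) = evm n (mmul n (madj (fstar total_star) (y l i)) (y l j))"
      if "l \<in> {..<k}" for l
    proof -
      have "star (mat_algebra k (mat_algebra n A)) (evmm k n y) (i, l) = star (mat_algebra n A) (evm n (y l i))"
        using that \<open>i < k\<close> by (simp add: mat_algebra_def[of k] evmm_entry)
      then show ?thesis using that \<open>j < k\<close> by (simp add: evmm_entry evm_star evm_mult)
    qed
    then have "(\<Oplus>\<^bsub>mat_algebra n A\<^esub>l\<in>{..<k}. star (mat_algebra k (mat_algebra n A)) (evmm k n y) (i, l)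
      \<otimes>\<^bsub>mat_algebra n A\<^esub> evmm k n y (l, j))
      = evm n (\<lambda>r s. \<Sum>l<k. mmul n (madj (fstar total_star) (y l i)) (y l j) r s)"
      by (intro finsum_evm) auto
    also have "\<dots> = evm n (gram_block k n y i j)"
      by (intro evm_cong) (simp add: gram_block_def mmul_def madj_def sum.cartesian_product)
    finally show ?thesis .
  qed
  then show ?thesis
    unfolding evmm_def[of k n "gram_block k n y"]
    by (subst mat_algebra_def[of k]) (auto intro!: restrict_ext)
qed

end

context seq_cstar_algebra
begin

lemma nested_seminorm_eq_0_iff:
  assumes l: "l \<in> \<Lambda>"
  shows "mat_seminorm k (mat_algebra n A) (mat_seminorm n A (p l)) (evmm k n y) = 0
    \<longleftrightarrow> (\<forall>i<k. \<forall>j<k. \<forall>r<n. \<forall>s<n. p l (ev (y i j r s)) = 0)"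
  using seq_cstar_algebra.mat_seminorm_eq_0_iff[OF seq_cstar_algebra_mat_algebra l evmm_closed]
  by (simp add: evmm_entry mat_seminorm_eq_0_iff[OF l evm_closed] evm_entry)

text \<open>The nested operator seminorm matters only through its null matrices, which are null
  entry by entry; positivity thus becomes a condition on entries and on \<open>p l\<close>.\<close>

lemma local_pos_evmm_iff:
  assumes l: "l \<in> \<Lambda>"
  shows "local_pos (mat_algebra k (mat_algebra n A)) (mat_seminorm k (mat_algebra n A) (mat_seminorm n A (p l))) W
    \<longleftrightarrow> (\<exists>y z. (\<forall>i<k. \<forall>j<k. \<forall>r<n. \<forall>s<n. p l (ev (z i j r s)) = 0)
          \<and> W = evmm k n (\<lambda>i j r s. gram_block k n y i j r s + z i j r s))"
proof
  assume "local_pos (mat_algebra k (mat_algebra n A)) (mat_seminorm k (mat_algebra n A) (mat_seminorm n A (p l))) W"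
  then obtain b c where b: "b \<in> carrier (mat_algebra k (mat_algebra n A))"
    and c: "c \<in> carrier (mat_algebra k (mat_algebra n A))"
    and W: "W = star (mat_algebra k (mat_algebra n A)) b \<otimes>\<^bsub>mat_algebra k (mat_algebra n A)\<^esub> b
      \<oplus>\<^bsub>mat_algebra k (mat_algebra n A)\<^esub> c"
    and null: "mat_seminorm k (mat_algebra n A) (mat_seminorm n A (p l)) c = 0"
    unfolding local_pos_def by blast
  obtain y z where "b = evmm k n y" "c = evmm k n z" using evmm_cases b c by metis
  then show "\<exists>y z. (\<forall>i<k. \<forall>j<k. \<forall>r<n. \<forall>s<n. p l (ev (z i j r s)) = 0)
      \<and> W = evmm k n (\<lambda>i j r s. gram_block k n y i j r s + z i j r s)"
    using W null by (auto simp: evmm_star_mult evmm_add nested_seminorm_eq_0_iff[OF l])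
next
  assume "\<exists>y z. (\<forall>i<k. \<forall>j<k. \<forall>r<n. \<forall>s<n. p l (ev (z i j r s)) = 0)
      \<and> W = evmm k n (\<lambda>i j r s. gram_block k n y i j r s + z i j r s)"
  then obtain y z where "\<forall>i<k. \<forall>j<k. \<forall>r<n. \<forall>s<n. p l (ev (z i j r s)) = 0"
    and "W = evmm k n (\<lambda>i j r s. gram_block k n y i j r s + z i j r s)" by blast
  then show "local_pos (mat_algebra k (mat_algebra n A)) (mat_seminorm k (mat_algebra n A) (mat_seminorm n A (p l))) W"
    unfolding local_pos_def
    by (intro bexI[of _ "evmm k n y"] bexI[of _ "evmm k n z"])
      (auto simp: evmm_star_mult evmm_add nested_seminorm_eq_0_iff[OF l] evmm_closed)
qed

lemma local_zero_evmm_iff: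
  "l \<in> \<Lambda> \<Longrightarrow> local_zero (mat_algebra k (mat_algebra n A)) (mat_seminorm k (mat_algebra n A) (mat_seminorm n A (p l))) (evmm k n y)
    \<longleftrightarrow> (\<forall>i<k. \<forall>j<k. \<forall>r<n. \<forall>s<n. p l (ev (y i j r s)) = 0)"
  by (simp add: local_zero_def evmm_closed nested_seminorm_eq_0_iff)

lemma local_zero_evm_iff:
  "l \<in> \<Lambda> \<Longrightarrow> local_zero (mat_algebra k A) (mat_seminorm k A (p l)) (evm k y)
    \<longleftrightarrow> (\<forall>i<k. \<forall>j<k. p l (ev (y i j)) = 0)"
  by (simp add: local_zero_def evm_closed mat_seminorm_eq_0_iff evm_entry)

lemma local_pos_evmE:
  assumes l: "l \<in> \<Lambda>" and M: "local_pos (mat_algebra k A) (mat_seminorm k A (p l)) M"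
  obtains y z where "\<And>i j. i < k \<Longrightarrow> j < k \<Longrightarrow> p l (ev (z i j)) = 0"
    "M = evm k (\<lambda>i j. mmul k (madj (fstar total_star) y) y i j + z i j)"
proof -
  obtain b c where b: "b \<in> carrier (mat_algebra k A)" and c: "c \<in> carrier (mat_algebra k A)"
    and eq: "M = star (mat_algebra k A) b \<otimes>\<^bsub>mat_algebra k A\<^esub> b \<oplus>\<^bsub>mat_algebra k A\<^esub> c"
    and null: "mat_seminorm k A (p l) c = 0"
    using M unfolding local_pos_def by blast
  obtain y where y: "b = evm k y" using b by (rule evm_cases)
  obtain z where z: "c = evm k z" using c by (rule evm_cases)
  show ?thesis
  proof (rule that[of z y])
    show "p l (ev (z i j)) = 0" if "i < k" "j < k" for i j
      using null that mat_seminorm_eq_0_iff[OF l evm_closed] by (simp add: z evm_entry)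
    show "M = evm k (\<lambda>i j. mmul k (madj (fstar total_star) y) y i j + z i j)"
      unfolding eq y z evm_star evm_mult evm_add ..
  qed
qed

lemma finsum_star_mult_eq:
  assumes "finite I" "\<And>i. i \<in> I \<Longrightarrow> c i \<in> carrier A"
  obtains d where "d \<in> carrier A"
    "\<And>l. l \<in> \<Lambda> \<Longrightarrow> p l ((\<Oplus>i\<in>I. star A (c i) \<otimes> c i) \<ominus> star A d \<otimes> d) = 0"
proof -
  obtain d where d: "\<And>l. l \<in> \<Lambda> \<Longrightarrow>
      p l (ev ((\<Sum>i\<in>I. fstar total_star (gen (c i)) * gen (c i)) - fstar total_star d * d)) = 0"
    using free.sum_star_eq_star[where I = I and c = "\<lambda>i. gen (c i)"] by blast
  have "(\<Oplus>i\<in>I. star A (c i) \<otimes> c i) = ev (\<Sum>i\<in>I. fstar total_star (gen (c i)) * gen (c i))"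
    using assms by (intro finsum_ev) (simp_all add: ev_mult ev_fstar ev_gen)
  then show ?thesis using d by (intro that[of "ev d"]) (simp_all add: ev_diff ev_mult ev_fstar)
qed

text \<open>The single square is obtained from \<open>sum_star_eq_star\<close> in the matrix algebra
  of size \<open>k\<close>, which is itself sequentially complete. The null difference between the
  sum and this square joins the null part \<open>z\<close>.\<close>

lemma local_pos_evm_sum:
  assumes l: "l \<in> \<Lambda>" and "finite T"
    and z: "\<And>i j. i < k \<Longrightarrow> j < k \<Longrightarrow> p l (ev (z i j)) = 0"
  shows "local_pos (mat_algebra k A) (mat_seminorm k A (p l))
    (evm k (\<lambda>i j. (\<Sum>t\<in>T. mmul k (madj (fstar total_star) (y t)) (y t) i j) + z i j))"
proof -
  interpret l: cstar_seminormed_ring fconst "fstar total_star" "\<lambda>f. p l (ev f)" using l by (rule free.seminorm)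
  interpret M: seq_cstar_algebra "mat_algebra k A" \<Lambda> "\<lambda>l. mat_seminorm k A (p l)"
    by (rule seq_cstar_algebra_mat_algebra)
  define x where "x i j = (\<Sum>t\<in>T. mmul k (madj (fstar total_star) (y t)) (y t) i j)" for i j
  obtain d where d: "d \<in> carrier (mat_algebra k A)"
    "\<And>l. l \<in> \<Lambda> \<Longrightarrow> mat_seminorm k A (p l) ((\<Oplus>\<^bsub>mat_algebra k A\<^esub>t\<in>T. star (mat_algebra k A) (evm k (y t))
      \<otimes>\<^bsub>mat_algebra k A\<^esub> evm k (y t)) \<ominus>\<^bsub>mat_algebra k A\<^esub> star (mat_algebra k A) d \<otimes>\<^bsub>mat_algebra k A\<^esub> d) = 0"
    using M.finsum_star_mult_eq[of T "\<lambda>t. evm k (y t)"] \<open>finite T\<close> evm_closed by blast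
  obtain e where e: "d = evm k e" using d(1) by (rule evm_cases)
  define w where "w = mmul k (madj (fstar total_star) e) e"
  have "(\<Oplus>\<^bsub>mat_algebra k A\<^esub>t\<in>T. star (mat_algebra k A) (evm k (y t)) \<otimes>\<^bsub>mat_algebra k A\<^esub> evm k (y t)) = evm k x"
    unfolding x_def by (intro finsum_evm \<open>finite T\<close>) (simp add: evm_star evm_mult)
  then have "mat_seminorm k A (p l) (evm k (\<lambda>i j. x i j - w i j)) = 0"
    using d(2)[OF l] by (simp add: e evm_star evm_mult evm_diff w_def)
  then have "p l (ev (x i j - w i j)) = 0" if "i < k" "j < k" for i j
    using that mat_seminorm_eq_0_iff[OF l evm_closed] by (simp add: evm_entry)
  then have null: "mat_seminorm k A (p l) (evm k (\<lambda>i j. (x i j - w i j) + z i j)) = 0"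
    using z mat_seminorm_eq_0_iff[OF l evm_closed] by (simp add: evm_entry l.N_add_null)
  have "evm k (\<lambda>i j. x i j + z i j) = evm k w \<oplus>\<^bsub>mat_algebra k A\<^esub> evm k (\<lambda>i j. (x i j - w i j) + z i j)"
    unfolding evm_add by (rule evm_cong) simp
  then have "evm k (\<lambda>i j. x i j + z i j) = star (mat_algebra k A) (evm k e) \<otimes>\<^bsub>mat_algebra k A\<^esub> evm k e
      \<oplus>\<^bsub>mat_algebra k A\<^esub> evm k (\<lambda>i j. (x i j - w i j) + z i j)"
    by (simp add: w_def evm_star evm_mult)
  then show ?thesis
    unfolding local_pos_def x_def[symmetric] using null evm_closed by blast
qed

end

section \<open>The argument with 2 by 2 blocks\<close>

text \<open>A single index \<open>l\<close> serves both maps, so that both can be applied to the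
  same positive block matrix \<open>Z\<close> and their entries compared.\<close>

lemma copositive_part_null:
  assumes A: "seq_cstar_algebra A \<Lambda> p" and B: "seq_cstar_algebra B \<Delta> q"
    and n: "2 \<le> n" and l: "l \<in> \<Lambda>" and d: "d \<in> \<Delta>"
    and \<theta>: "linear_map (mat_algebra n A) (mat_algebra n B) \<theta>"
    and sum: "\<And>x. x \<in> carrier (mat_algebra n A) \<Longrightarrow> mat_map n \<phi> x = \<psi> x \<oplus>\<^bsub>mat_algebra n B\<^esub> \<theta> x"
    and \<phi>: "linear_map A B \<phi>"
    and \<psi>: "\<psi> \<in> carrier (mat_algebra n A) \<rightarrow> carrier (mat_algebra n B)"
    and pos_\<psi>: "\<And>W. W \<in> carrier (mat_algebra 2 (mat_algebra n A)) \<Longrightarrow>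
      local_pos (mat_algebra 2 (mat_algebra n A)) (mat_seminorm 2 (mat_algebra n A) (mat_seminorm n A (p l))) W \<Longrightarrow>
      local_pos (mat_algebra 2 (mat_algebra n B)) (mat_seminorm 2 (mat_algebra n B) (mat_seminorm n B (q d))) (mat_map 2 \<psi> W)"
    and pos_\<theta>: "\<And>W. W \<in> carrier (mat_algebra 2 (mat_algebra n A)) \<Longrightarrow>
      local_pos (mat_algebra 2 (mat_algebra n A)) (mat_seminorm 2 (mat_algebra n A) (mat_seminorm n A (p l))) W \<Longrightarrow>
      local_pos (mat_algebra 2 (mat_algebra n B)) (mat_seminorm 2 (mat_algebra n B) (mat_seminorm n B (q d))) (mat_map_transposed 2 \<theta> W)"
  shows "q d (\<theta> (unital_star_algebra.evm A n (\<lambda>r s. if r = 0 \<and> s = 0 then h else 0)) (0, 0)) = 0"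
proof -
  interpret A: seq_cstar_algebra A \<Lambda> p by (rule A)
  interpret B: seq_cstar_algebra B \<Delta> q by (rule B)
  interpret N: cstar_seminormed_ring fconst "fstar B.total_star" "\<lambda>f. q d (B.ev f)"
    using d by (rule B.free.seminorm)
  define E where "E i j f = A.evm n (\<lambda>r s. if r = i \<and> s = j then f else 0)" for i j f
  have E_closed: "E i j f \<in> carrier (mat_algebra n A)" for i j f by (simp add: E_def A.evm_closed)
  have \<phi>0: "\<phi> \<zero>\<^bsub>A\<^esub> = \<zero>\<^bsub>B\<^esub>"
  proof -
    have "\<phi> (0 \<odot>\<^bsub>A\<^esub> A.ev 0) = 0 \<odot>\<^bsub>B\<^esub> \<phi> (A.ev 0)"
      using \<phi> A.ev_closed unfolding linear_map_def by blast
    moreover have "\<phi> (A.ev 0) \<in> carrier B" using \<phi> A.ev_closed unfolding linear_map_def by blast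
    ultimately show ?thesis using A.ev_closed[of 0] by (simp add: A.smult_0 B.smult_0 A.smult_zero)
  qed
  have square: "q d (\<theta> (E 0 0 (fstar A.total_star g * g)) (0, 0)) = 0" for g
  proof -
    define f where "f = fstar A.total_star g * g"
    \<comment> \<open>Choi's matrix, the sum of e_ij (x) e_ij for i, j below 2, tensored with f. It
      is the square of \<open>y\<close>, which has a single nonzero row (l = 0, t = 0) carrying g in
      the columns labelled (i, i).\<close>
    define Z where "Z = A.evmm 2 n (\<lambda>i j r s. if r = i \<and> s = j then f else 0)"
    define y where "y l i t r = (if l = 0 \<and> t = 0 \<and> r = i then g else 0)" for l i t r :: nat
    have gram_y: "A.gram_block 2 n y i j r s = (if r = i \<and> s = j then f else 0)" for i j r s
    proof -
      have "A.gram_block 2 n y i j r s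
          = (\<Sum>lt\<in>{..<2::nat} \<times> {..<n}. if lt = (0, 0) then (if r = i \<and> s = j then f else 0) else 0)"
        unfolding A.gram_block_def by (intro sum.cong) (auto simp: y_def f_def split: if_splits)
      then show ?thesis using n by simp
    qed
    have Z: "Z \<in> carrier (mat_algebra 2 (mat_algebra n A))" by (simp add: Z_def A.evmm_closed)
    have "Z = A.evmm 2 n (\<lambda>i j r s. A.gram_block 2 n y i j r s + 0)"
      unfolding Z_def gram_y by simp
    then have Zpos: "local_pos (mat_algebra 2 (mat_algebra n A)) (mat_seminorm 2 (mat_algebra n A) (mat_seminorm n A (p l))) Z"
      unfolding A.local_pos_evmm_iff[OF l]
      by (intro exI[of _ y] exI[of _ "\<lambda>_ _ _ _. 0"]) (use cstar_seminormed_ring.N_0[OF A.free.seminorm[OF l]] in simp)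
    have ZE: "Z (i, j) = E i j f" if "i < 2" "j < 2" for i j
      using that by (simp add: Z_def E_def A.evmm_entry)
    obtain v z where z: "\<forall>i<2. \<forall>j<2. \<forall>r<n. \<forall>s<n. q d (B.ev (z i j r s)) = 0"
      and v: "mat_map 2 \<psi> Z = B.evmm 2 n (\<lambda>i j r s. B.gram_block 2 n v i j r s + z i j r s)"
      using pos_\<psi>[OF Z Zpos] unfolding B.local_pos_evmm_iff[OF d] by blast
    obtain u w where w: "\<forall>i<2. \<forall>j<2. \<forall>r<n. \<forall>s<n. q d (B.ev (w i j r s)) = 0"
      and u: "mat_map_transposed 2 \<theta> Z = B.evmm 2 n (\<lambda>i j r s. B.gram_block 2 n u i j r s + w i j r s)"
      using pos_\<theta>[OF Z Zpos] unfolding B.local_pos_evmm_iff[OF d] by blast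
    define I where "I = {..<2::nat} \<times> {..<n}"
    define V where "V i r = (\<lambda>(l, t). v l i t r)" for i r
    define U where "U i r = (\<lambda>(l, t). u l i t r)" for i r
    have gram_v: "B.gram_block 2 n v i j r s = N.gram I (V i r) (V j s)" for i j r s
      by (simp add: B.gram_block_def N.gram_def I_def V_def split_def)
    have gram_u: "B.gram_block 2 n u i j r s = N.gram I (U i r) (U j s)" for i j r s
      by (simp add: B.gram_block_def N.gram_def I_def U_def split_def)
    have \<psi>_entry: "\<psi> (E i j f) (r, s) = B.ev (N.gram I (V i r) (V j s) + z i j r s)"
      if "i < 2" "j < 2" "r < n" "s < n" for i j r s
      using fun_cong[OF fun_cong[OF v, of "(i, j)"], of "(r, s)"] that
      by (simp add: mat_map_def ZE B.evmm_entry B.evm_entry gram_v)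
    \<comment> \<open>The transposed map puts the image of block (i, j) at position (j, i), which
      exchanges the indices of \<open>U\<close> and \<open>w\<close>.\<close>
    have \<theta>_entry: "\<theta> (E i j f) (r, s) = B.ev (N.gram I (U j r) (U i s) + w j i r s)"
      if "i < 2" "j < 2" "r < n" "s < n" for i j r s
      using fun_cong[OF fun_cong[OF u, of "(j, i)"], of "(r, s)"] that
      by (simp add: mat_map_transposed_def ZE B.evmm_entry B.evm_entry gram_u)
    define P where "P = gen (\<phi> (A.ev f))"
    have evP: "B.ev P = \<phi> (A.ev f)"
      unfolding P_def using \<phi> A.ev_closed by (intro B.ev_gen) (auto simp: linear_map_def)
    have "q d (B.ev (N.gram I (V i r) (V j s) + N.gram I (U j r) (U i s) - (if r = i \<and> s = j then P else 0))) = 0"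
      if ij: "i < 2" "j < 2" and rs: "r < 2" "s < 2" for i j r s
    proof -
      have rs': "r < n" "s < n" using rs n by auto
      have "mat_map n \<phi> (E i j f) (r, s) = \<psi> (E i j f) (r, s) \<oplus>\<^bsub>B\<^esub> \<theta> (E i j f) (r, s)"
        using rs' sum[OF E_closed] by (simp add: mat_algebra_def)
      then have "B.ev (if r = i \<and> s = j then P else 0)
          = B.ev ((N.gram I (V i r) (V j s) + z i j r s) + (N.gram I (U j r) (U i s) + w j i r s))"
        unfolding \<psi>_entry[OF ij rs'] \<theta>_entry[OF ij rs'] B.ev_add[symmetric]
        using rs' by (auto simp: mat_map_def E_def A.evm_entry evP \<phi>0)
      then have "B.ev ((N.gram I (V i r) (V j s) + z i j r s) + (N.gram I (U j r) (U i s) + w j i r s)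
          - (if r = i \<and> s = j then P else 0)) = B.ev 0"
        by (metis B.ev_diff diff_self)
      then have "q d (B.ev ((N.gram I (V i r) (V j s) + z i j r s) + (N.gram I (U j r) (U i s) + w j i r s)
          - (if r = i \<and> s = j then P else 0))) = 0" by (simp only: N.N_0)
      moreover have "q d (B.ev (z i j r s + w j i r s)) = 0"
        using z w ij rs' by (intro N.N_add_null) auto
      ultimately have "q d (B.ev (((N.gram I (V i r) (V j s) + z i j r s) + (N.gram I (U j r) (U i s) + w j i r s)
          - (if r = i \<and> s = j then P else 0)) - (z i j r s + w j i r s))) = 0"
        by (rule N.N_diff_null)
      then show ?thesis by (simp add: algebra_simps)
    qed
    then have "q d (B.ev (N.gram I (U 0 0) (U 0 0))) = 0"
      by (intro N.decomposition_null[where I = I and v = V and u = U and P = P]) (auto simp: I_def)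
    then have "q d (B.ev (N.gram I (U 0 0) (U 0 0) + w 0 0 0 0)) = 0"
      using w n by (intro N.N_add_null) auto
    then show ?thesis using \<theta>_entry[of 0 0 0 0] n by (simp add: f_def)
  qed
  \<comment> \<open>\<open>T\<close> is linear only after evaluation, which is enough because
    \<open>q d\<close> is applied to evaluated elements.\<close>
  define T where "T f = gen (\<theta> (E 0 0 f) (0, 0))" for f
  have n0: "0 < n" using n by simp
  have \<theta>_entry_closed: "\<theta> (E 0 0 f) (0, 0) \<in> carrier B" for f
  proof -
    have "\<theta> (E 0 0 f) \<in> carrier (mat_algebra n B)"
      using \<theta> E_closed unfolding linear_map_def by blast
    then show ?thesis using n0 by (auto simp: mat_algebra_def)
  qed
  then have evT: "B.ev (T f) = \<theta> (E 0 0 f) (0, 0)" for f unfolding T_def by (rule B.ev_gen)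
  have T_add: "B.ev (T (f + g)) = B.ev (T f + T g)" for f g
  proof -
    have "E 0 0 (f + g) = E 0 0 f \<oplus>\<^bsub>mat_algebra n A\<^esub> E 0 0 g"
      unfolding E_def A.evm_add by (rule A.evm_cong) simp
    then have "\<theta> (E 0 0 (f + g)) = \<theta> (E 0 0 f) \<oplus>\<^bsub>mat_algebra n B\<^esub> \<theta> (E 0 0 g)"
      using \<theta> E_closed unfolding linear_map_def by simp
    then show ?thesis using n0 unfolding evT B.ev_add by (simp add: mat_algebra_def)
  qed
  have T_C: "B.ev (T (fconst c * f)) = B.ev (fconst c * T f)" for c f
  proof -
    have "E 0 0 (fconst c * f) = c \<odot>\<^bsub>mat_algebra n A\<^esub> E 0 0 f"
      unfolding E_def A.evm_smult by (rule A.evm_cong) simp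
    then have "\<theta> (E 0 0 (fconst c * f)) = c \<odot>\<^bsub>mat_algebra n B\<^esub> \<theta> (E 0 0 f)"
      using \<theta> E_closed unfolding linear_map_def by simp
    then show ?thesis using n0 unfolding B.ev_fconst_mult evT by (simp add: mat_algebra_def)
  qed
  have sq: "q d (B.ev (T (fstar A.total_star g * g))) = 0" for g unfolding evT by (rule square)
  have add: "q d (B.ev (T (f + g))) = 0" if "q d (B.ev (T f)) = 0" "q d (B.ev (T g)) = 0" for f g
    unfolding T_add using that by (rule N.N_add_null)
  have C: "q d (B.ev (T (fconst c * f))) = 0" if "q d (B.ev (T f)) = 0" for c f
    unfolding T_C N.N_C_mult using that by simp
  have "q d (B.ev (T (fconst 4 * h))) = 0"
    unfolding A.free.base.polarization[of h] by (intro add C sq)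
  then have "q d (B.ev (T h)) = 0" unfolding T_C N.N_C_mult by simp
  then show ?thesis by (simp add: evT E_def)
qed

theorem theorem4p6:
  fixes A :: "'a star_algebra" and \<Lambda> :: "'l set" and p :: "'l \<Rightarrow> 'a \<Rightarrow> real"
    and B :: "'b star_algebra" and \<Delta> :: "'d set" and q :: "'d \<Rightarrow> 'b \<Rightarrow> real"
    and \<phi> :: "'a \<Rightarrow> 'b" and n :: nat
  assumes "locally_cstar_algebra A \<Lambda> p"
    and "locally_cstar_algebra B \<Delta> q"
    and "linear_map A B \<phi>"
    and "n \<ge> 2"
    and "local_decomposable
           (mat_algebra n A) \<Lambda> (\<lambda>l. mat_seminorm n A (p l))
           (mat_algebra n B) \<Delta> (\<lambda>d. mat_seminorm n B (q d))
           (mat_map n \<phi>)"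
  shows "local_completely_positive A \<Lambda> p B \<Delta> q \<phi>"
proof -
  interpret A: seq_cstar_algebra A \<Lambda> p using assms(1) by (rule locally_cstar_algebra.seq_cstar_algebra)
  interpret B: seq_cstar_algebra B \<Delta> q using assms(2) by (rule locally_cstar_algebra.seq_cstar_algebra)
  have n0: "0 < n" using assms(4) by simp
  obtain \<psi> \<theta> where
    cp: "local_completely_positive (mat_algebra n A) \<Lambda> (\<lambda>l. mat_seminorm n A (p l))
      (mat_algebra n B) \<Delta> (\<lambda>d. mat_seminorm n B (q d)) \<psi>"
    and ccp: "local_completely_copositive (mat_algebra n A) \<Lambda> (\<lambda>l. mat_seminorm n A (p l))
      (mat_algebra n B) \<Delta> (\<lambda>d. mat_seminorm n B (q d)) \<theta>"
    and sum: "\<And>x. x \<in> carrier (mat_algebra n A) \<Longrightarrow> mat_map n \<phi> x = \<psi> x \<oplus>\<^bsub>mat_algebra n B\<^esub> \<theta> x"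
    using assms(5) unfolding local_decomposable_def by blast
  have \<psi>: "\<psi> \<in> carrier (mat_algebra n A) \<rightarrow> carrier (mat_algebra n B)"
    using cp by (simp add: local_completely_positive_def linear_map_def)
  have \<theta>: "linear_map (mat_algebra n A) (mat_algebra n B) \<theta>"
    using ccp by (simp add: local_completely_copositive_def)
  define E where "E f = A.evm n (\<lambda>r s. if r = 0 \<and> s = 0 then f else 0)" for f
  have E_closed: "E f \<in> carrier (mat_algebra n A)" for f by (simp add: E_def A.evm_closed)
  have \<phi>_closed: "\<phi> (A.ev f) \<in> carrier B" for f
    using assms(3) A.ev_closed unfolding linear_map_def by blast
  have entry_closed: "\<psi> (E f) (0, 0) \<in> carrier B" "\<theta> (E f) (0, 0) \<in> carrier B" for f
  proof -
    have "\<psi> (E f) \<in> carrier (mat_algebra n B)" "\<theta> (E f) \<in> carrier (mat_algebra n B)"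
      using \<psi> \<theta> E_closed unfolding linear_map_def by blast+
    then show "\<psi> (E f) (0, 0) \<in> carrier B" "\<theta> (E f) (0, 0) \<in> carrier B"
      using n0 by (auto simp: mat_algebra_def)
  qed
  have \<phi>_eq: "\<phi> (A.ev f) = B.ev (gen (\<psi> (E f) (0, 0)) + gen (\<theta> (E f) (0, 0)))" for f
  proof -
    have "mat_map n \<phi> (E f) (0, 0) = \<psi> (E f) (0, 0) \<oplus>\<^bsub>B\<^esub> \<theta> (E f) (0, 0)"
      using n0 sum[OF E_closed] by (simp add: mat_algebra_def)
    moreover have "mat_map n \<phi> (E f) (0, 0) = \<phi> (A.ev f)"
      using n0 by (simp add: mat_map_def E_def A.evm_entry)
    ultimately show ?thesis using entry_closed by (simp add: B.ev_add B.ev_gen)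
  qed
  have "\<exists>l\<in>\<Lambda>. \<forall>k\<ge>1. \<forall>M\<in>carrier (mat_algebra k A).
        (local_pos (mat_algebra k A) (mat_seminorm k A (p l)) M \<longrightarrow>
         local_pos (mat_algebra k B) (mat_seminorm k B (q d)) (mat_map k \<phi> M)) \<and>
        (local_zero (mat_algebra k A) (mat_seminorm k A (p l)) M \<longrightarrow>
         local_zero (mat_algebra k B) (mat_seminorm k B (q d)) (mat_map k \<phi> M))"
    if d: "d \<in> \<Delta>" for d
  proof -
    interpret N: cstar_seminormed_ring fconst "fstar B.total_star" "\<lambda>f. q d (B.ev f)"
      using d by (rule B.free.seminorm)
    obtain l1 where l1: "l1 \<in> \<Lambda>" and
      \<psi>_pos: "\<And>k W. 1 \<le> k \<Longrightarrow> W \<in> carrier (mat_algebra k (mat_algebra n A)) \<Longrightarrow>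
        local_pos (mat_algebra k (mat_algebra n A)) (mat_seminorm k (mat_algebra n A) (mat_seminorm n A (p l1))) W \<Longrightarrow>
        local_pos (mat_algebra k (mat_algebra n B)) (mat_seminorm k (mat_algebra n B) (mat_seminorm n B (q d))) (mat_map k \<psi> W)" and
      \<psi>_zero: "\<And>k W. 1 \<le> k \<Longrightarrow> W \<in> carrier (mat_algebra k (mat_algebra n A)) \<Longrightarrow>
        local_zero (mat_algebra k (mat_algebra n A)) (mat_seminorm k (mat_algebra n A) (mat_seminorm n A (p l1))) W \<Longrightarrow>
        local_zero (mat_algebra k (mat_algebra n B)) (mat_seminorm k (mat_algebra n B) (mat_seminorm n B (q d))) (mat_map k \<psi> W)"
      using cp d unfolding local_completely_positive_def by blast
    obtain l2 where l2: "l2 \<in> \<Lambda>" and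
      \<theta>_pos: "\<And>k W. 1 \<le> k \<Longrightarrow> W \<in> carrier (mat_algebra k (mat_algebra n A)) \<Longrightarrow>
        local_pos (mat_algebra k (mat_algebra n A)) (mat_seminorm k (mat_algebra n A) (mat_seminorm n A (p l2))) W \<Longrightarrow>
        local_pos (mat_algebra k (mat_algebra n B)) (mat_seminorm k (mat_algebra n B) (mat_seminorm n B (q d))) (mat_map_transposed k \<theta> W)"
      using ccp d unfolding local_completely_copositive_def by blast
    \<comment> \<open>A common index above those of the two parts. Elements null for the larger
      seminorm are null for both smaller ones, so positivity modulo \<open>p l\<close> implies
      positivity modulo \<open>p l1\<close> and \<open>p l2\<close>.\<close>
    obtain l where l: "l \<in> \<Lambda>" and le: "\<And>x. x \<in> carrier A \<Longrightarrow> p l1 x \<le> p l x \<and> p l2 x \<le> p l x"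
      using locally_cstar_algebra.upward_filtered[OF assms(1) l1 l2] by blast
    have null: "p l1 (A.ev f) = 0 \<and> p l2 (A.ev f) = 0" if "p l (A.ev f) = 0" for f
    proof -
      have "0 \<le> p l1 (A.ev f)" "0 \<le> p l2 (A.ev f)"
        using cstar_seminormed_ring.N_nonneg[OF A.free.seminorm[OF l1]]
          cstar_seminormed_ring.N_nonneg[OF A.free.seminorm[OF l2]] by auto
      then show ?thesis using le[OF A.ev_closed, of f] that by linarith
    qed
    have pos_mono: "local_pos (mat_algebra k (mat_algebra n A)) (mat_seminorm k (mat_algebra n A) (mat_seminorm n A (p l'))) W"
      if W_pos: "local_pos (mat_algebra k (mat_algebra n A)) (mat_seminorm k (mat_algebra n A) (mat_seminorm n A (p l))) W"
        and l'_cases: "l' = l1 \<or> l' = l2" for k W l'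
    proof -
      have l': "l' \<in> \<Lambda>" using l'_cases l1 l2 by blast
      obtain y z where z: "\<forall>i<k. \<forall>j<k. \<forall>r<n. \<forall>s<n. p l (A.ev (z i j r s)) = 0"
        and W: "W = A.evmm k n (\<lambda>i j r s. A.gram_block k n y i j r s + z i j r s)"
        using W_pos unfolding A.local_pos_evmm_iff[OF l] by blast
      have "\<forall>i<k. \<forall>j<k. \<forall>r<n. \<forall>s<n. p l' (A.ev (z i j r s)) = 0"
        using z null l'_cases by blast
      then show ?thesis using W unfolding A.local_pos_evmm_iff[OF l'] by blast
    qed
    have \<theta>_null: "q d (\<theta> (E h) (0, 0)) = 0" for h
      unfolding E_def
      by (rule copositive_part_null[OF A.seq_cstar_algebra_axioms B.seq_cstar_algebra_axioms assms(4) l d \<theta> sum assms(3) \<psi>])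
        (assumption, rule \<psi>_pos, simp, assumption, rule pos_mono, assumption, simp,
          rule \<theta>_pos, simp, assumption, rule pos_mono, assumption, simp)
    show ?thesis
    proof (intro bexI[OF _ l] allI impI ballI conjI)
      fix k :: nat and M assume k: "1 \<le> k" and M: "M \<in> carrier (mat_algebra k A)"
      \<comment> \<open>Embeds matrices of size k over A into matrices over the algebra of n by n
        matrices, using the (0, 0) corner of every block.\<close>
      let ?lift = "\<lambda>m. A.evmm k n (\<lambda>i j r s. if r = 0 \<and> s = 0 then m i j else 0)"
      have lift_entry: "?lift m (i, j) = E (m i j)" if "i < k" "j < k" for m i j
        using that by (simp add: A.evmm_entry E_def)
      {
        assume "local_pos (mat_algebra k A) (mat_seminorm k A (p l)) M"
        then obtain y z where z: "\<And>i j. i < k \<Longrightarrow> j < k \<Longrightarrow> p l (A.ev (z i j)) = 0"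
          and My: "M = A.evm k (\<lambda>i j. mmul k (madj (fstar A.total_star) y) y i j + z i j)"
          using A.local_pos_evmE[OF l] by blast
        define m where "m i j = mmul k (madj (fstar A.total_star) y) y i j + z i j" for i j
        define y' where "y' a i t r = (if t = 0 \<and> r = 0 then y a i else 0)" for a i t r :: nat
        define z' where "z' i j r s = (if r = 0 \<and> s = 0 then z i j else 0)" for i j r s :: nat
        have "?lift m = A.evmm k n (\<lambda>i j r s. A.gram_block k n y' i j r s + z' i j r s)"
        proof (rule A.evmm_cong)
          fix i j r s :: nat
          have "A.gram_block k n y' i j r s = (\<Sum>a<k. \<Sum>t<n. if t = 0 then
              (if r = 0 \<and> s = 0 then fstar A.total_star (y a i) * y a j else 0) else 0)"
            unfolding A.gram_block_def sum.cartesian_product by (intro sum.cong) (auto simp: y'_def)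
          then show "(if r = 0 \<and> s = 0 then m i j else 0) = A.gram_block k n y' i j r s + z' i j r s"
            using n0 by (simp add: m_def z'_def mmul_def madj_def)
        qed
        moreover have "\<forall>i<k. \<forall>j<k. \<forall>r<n. \<forall>s<n. p l (A.ev (z' i j r s)) = 0"
          using z cstar_seminormed_ring.N_0[OF A.free.seminorm[OF l]] by (simp add: z'_def)
        ultimately have lift_pos: "local_pos (mat_algebra k (mat_algebra n A))
            (mat_seminorm k (mat_algebra n A) (mat_seminorm n A (p l))) (?lift m)"
          unfolding A.local_pos_evmm_iff[OF l] by blast
        have "local_pos (mat_algebra k (mat_algebra n B))
            (mat_seminorm k (mat_algebra n B) (mat_seminorm n B (q d))) (mat_map k \<psi> (?lift m))"
          by (rule \<psi>_pos[OF k A.evmm_closed pos_mono[OF lift_pos]]) simp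
        then obtain v w where w: "\<forall>i<k. \<forall>j<k. \<forall>r<n. \<forall>s<n. q d (B.ev (w i j r s)) = 0"
          and v: "mat_map k \<psi> (?lift m) = B.evmm k n (\<lambda>i j r s. B.gram_block k n v i j r s + w i j r s)"
          unfolding B.local_pos_evmm_iff[OF d] by blast
        have \<psi>_entry: "\<psi> (E (m i j)) (0, 0) = B.ev (B.gram_block k n v i j 0 0 + w i j 0 0)"
          if "i < k" "j < k" for i j
          using fun_cong[OF fun_cong[OF v, of "(i, j)"], of "(0, 0)"] that n0
          by (simp add: mat_map_def lift_entry B.evmm_entry B.evm_entry)
        \<comment> \<open>The contribution of the copositive part is null by
          \<open>\<theta>_null\<close> and is absorbed in the null term.\<close>
        define w' where "w' i j = w i j 0 0 + gen (\<theta> (E (m i j)) (0, 0))" for i j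
        \<comment> \<open>For each t the entries \<open>v a i t 0\<close> form a k by k matrix in a
          and i. The (0, 0) corner of the block square is the sum over t of the squares of these n
          matrices, to which \<open>local_pos_evm_sum\<close> applies.\<close>
        have "mat_map k \<phi> M = B.evm k (\<lambda>i j.
            (\<Sum>t<n. mmul k (madj (fstar B.total_star) (\<lambda>a i. v a i t 0)) (\<lambda>a i. v a i t 0) i j) + w' i j)"
        proof -
          have "\<phi> (M (i, j)) = B.ev ((\<Sum>t<n. mmul k (madj (fstar B.total_star) (\<lambda>a i. v a i t 0)) (\<lambda>a i. v a i t 0) i j) + w' i j)"
            if ij: "i < k" "j < k" for i j
          proof -
            have "\<phi> (M (i, j)) = B.ev ((B.gram_block k n v i j 0 0 + w i j 0 0) + gen (\<theta> (E (m i j)) (0, 0)))"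
              using ij by (simp add: My A.evm_entry \<phi>_eq B.ev_add B.ev_gen entry_closed \<psi>_entry flip: m_def)
            also have "B.gram_block k n v i j 0 0
                = (\<Sum>t<n. mmul k (madj (fstar B.total_star) (\<lambda>a i. v a i t 0)) (\<lambda>a i. v a i t 0) i j)"
              unfolding B.gram_block_def mmul_def madj_def sum.cartesian_product[symmetric] by (rule sum.swap)
            finally show ?thesis by (simp add: w'_def add.assoc)
          qed
          then show ?thesis
            unfolding mat_map_def B.evm_def by (intro restrict_ext) auto
        qed
        moreover have "q d (B.ev (w' i j)) = 0" if "i < k" "j < k" for i j
          unfolding w'_def using that w n0 \<theta>_null
          by (intro N.N_add_null) (auto simp: B.ev_gen entry_closed)
        ultimately show "local_pos (mat_algebra k B) (mat_seminorm k B (q d)) (mat_map k \<phi> M)"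
          using B.local_pos_evm_sum[OF d, of "{..<n}" k w'] by simp
      next
        assume zero: "local_zero (mat_algebra k A) (mat_seminorm k A (p l)) M"
        obtain m where m: "M = A.evm k m" using M by (rule A.evm_cases)
        have mnull: "p l (A.ev (m i j)) = 0" if "i < k" "j < k" for i j
          using zero that unfolding m A.local_zero_evm_iff[OF l] by blast
        have "\<forall>i<k. \<forall>j<k. \<forall>r<n. \<forall>s<n. p l1 (A.ev (if r = 0 \<and> s = 0 then m i j else 0)) = 0"
          using null mnull cstar_seminormed_ring.N_0[OF A.free.seminorm[OF l1]] by simp
        then have "local_zero (mat_algebra k (mat_algebra n B))
            (mat_seminorm k (mat_algebra n B) (mat_seminorm n B (q d))) (mat_map k \<psi> (?lift m))"
          by (intro \<psi>_zero k A.evmm_closed) (simp add: A.local_zero_evmm_iff[OF l1])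
        moreover obtain v where v: "mat_map k \<psi> (?lift m) = B.evmm k n v"
          using calculation B.evmm_cases unfolding local_zero_def by blast
        ultimately have vnull: "q d (B.ev (v i j 0 0)) = 0" if "i < k" "j < k" for i j
          using that n0 B.local_zero_evmm_iff[OF d] by simp
        have \<psi>_entry: "\<psi> (E (m i j)) (0, 0) = B.ev (v i j 0 0)" if "i < k" "j < k" for i j
          using fun_cong[OF fun_cong[OF v, of "(i, j)"], of "(0, 0)"] that n0
          by (simp add: mat_map_def lift_entry B.evmm_entry B.evm_entry)
        have "mat_map k \<phi> M = B.evm k (\<lambda>i j. gen (\<psi> (E (m i j)) (0, 0)) + gen (\<theta> (E (m i j)) (0, 0)))"
          unfolding mat_map_def B.evm_def by (intro restrict_ext) (auto simp: m A.evm_entry \<phi>_eq)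
        moreover have "q d (B.ev (gen (\<psi> (E (m i j)) (0, 0)) + gen (\<theta> (E (m i j)) (0, 0)))) = 0"
          if "i < k" "j < k" for i j
          using that vnull \<theta>_null \<psi>_entry
          by (intro N.N_add_null) (simp_all add: B.ev_gen entry_closed)
        ultimately show "local_zero (mat_algebra k B) (mat_seminorm k B (q d)) (mat_map k \<phi> M)"
          by (simp add: B.local_zero_evm_iff[OF d])
      }
    qed
  qed
  then show ?thesis using assms(3) unfolding local_completely_positive_def by blast
qed

end
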